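(* Given a safety 1ARA$_1$ $\mathcal{A}$, a safety IPCANT $\mathcal{C}_\mathcal{A}$ is computable in polynomial space, such that $\mathcal{C}_\mathcal{A}$ and $\mathcal{A}$ have the same alphabet, the basis size of $\mathcal{C}_\mathcal{A}$ is linear in the number of states of $\mathcal{A}$, and $\mathrm{L}(\mathcal{C}_\mathcal{A}) = \{\mathrm{str}(\sigma) : \sigma \in \mathrm{L}(\mathcal{A})\}$.
   Context: A data $\omega$-word $\sigma$ over finite alphabet $\Sigma$ is an $\omega$-word $\mathrm{str}(\sigma)$ over $\Sigma$ together with an equivalence relation $\sim$ on $\mathbb{N}$. A safety 1ARA$_1$ (safety one-way alternating automaton with 1 register) is $\mathcal{A}=\langle \Sigma, Q, q_I, \delta\rangle$ with $\delta: Q \times \Sigma \times \{\uparrow, \not\uparrow\} \to$ positive Boolean formulae over $Q \cup \{\downarrow q : q \in Q\}$; a pair $Q', Q'_\downarrow$ satisfies $q$ iff $q\in Q'$ and ${\downarrow}q$ iff $q\in Q'_\downarrow$. Configurations are pairs $\langle q, D\rangle$ with $D$ a class of $\sim$; $F \xrightarrow{\sigma,i} F'$ iff for each $\langle q, D\rangle \in F$ there are $Q^{q,D}, Q^{q,D}_\downarrow$ satisfying $\delta(q, \sigma(i), \uparrow)$ if $D = [i]_\sim$ and $\delta(q,\sigma(i),\not\uparrow)$ otherwise, with $F'$ the union of $\{\langle q', D\rangle : q' \in Q^{q,D}\}$ and $\{\langle q', [i]_\sim\rangle : q' \in Q^{q,D}_\downarrow\}$. $\mathcal{A}$ accepts $\sigma$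 iff there is an infinite run $F_0 \xrightarrow{\sigma,0} F_1 \xrightarrow{\sigma,1}\cdots$ with $F_0 = \{\langle q_I, [0]_\sim\rangle\}$; $\mathrm{L}(\mathcal{A})$ is the set of accepted data $\omega$-words. A safety IPCANT is $\langle \Sigma, Q, q_I, X, C, \delta\rangle$: finite basis $X$, counters $C \subseteq \mathcal{P}(X)\setminus\{\emptyset\}$ valued in $\mathbb{N}$, transitions in $Q\times(\Sigma\uplus\{\varepsilon\})\times\text{Instr}\times Q$ with no $\varepsilon$-cycle, instructions being increments, decrements (firable iff nonzero) and simultaneous nondeterministic transfers $\langle\mathtt{transf},f\rangle$ for distributive $f:C\to\mathcal{P}(C)$ (each $v(c)$ is split among counters in $f(c)$); $f$ is distributive if $c \subseteq \bigcup_i c_i$ and $c'_i \in f(c_i)$ imply some $c' \in f(c)$ with $c' \subseteq \bigcup_i c'_i$. Counters may erroneously increase at any time (incrementing errors). It accepts an $\omega$-word $w$ iff it has an infinite run from the initial state with all counters zero whose labels concatenate to $w$; $\mathrm{L}(\mathcal{C}_\mathcal{A})$ is its language. *)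

theory Defs
  imports "HOL-Computational_Algebra.Polynomial"
begin

section \<open>Data words and safety one-way alternating automata with one register\<close>

record 'a data_word =
  str :: "nat \<Rightarrow> 'a"
  sim :: "(nat \<times> nat) set"

definition data_word_over :: "'a set \<Rightarrow> 'a data_word \<Rightarrow> bool" where
  "data_word_over \<Sigma> \<sigma> \<longleftrightarrow> range (str \<sigma>) \<subseteq> \<Sigma> \<and> equiv UNIV (sim \<sigma>)"

definition cls :: "'a data_word \<Rightarrow> nat \<Rightarrow> nat set" where
  "cls \<sigma> i = sim \<sigma> `` {i}"

text \<open>Positive Boolean formulae over the atoms \<open>q\<close> (\<open>Keep q\<close>) and \<open>\<down>q\<close> (\<open>Store q\<close>).\<close>

datatype (atom_states: 'q) pbf =
    Tt | Ff | Keep 'q | Store 'q | And "'q pbf" "'q pbf" | Or "'q pbf" "'q pbf"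

fun sat :: "'q set \<Rightarrow> 'q set \<Rightarrow> 'q pbf \<Rightarrow> bool" where
  "sat P Pd Tt \<longleftrightarrow> True"
| "sat P Pd Ff \<longleftrightarrow> False"
| "sat P Pd (Keep q) \<longleftrightarrow> q \<in> P"
| "sat P Pd (Store q) \<longleftrightarrow> q \<in> Pd"
| "sat P Pd (And \<phi> \<psi>) \<longleftrightarrow> sat P Pd \<phi> \<and> sat P Pd \<psi>"
| "sat P Pd (Or \<phi> \<psi>) \<longleftrightarrow> sat P Pd \<phi> \<or> sat P Pd \<psi>"

text \<open>The Boolean argument of the transition function is \<^term>\<open>True\<close> for \<open>\<up>\<close> (the register
  holds the class of the current position) and \<^term>\<open>False\<close> for its negation.  Values of the
  transition function outside the alphabet and the state set play no role.\<close>

record ('a, 'q) ara =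
  ara_alph :: "'a set"
  ara_states :: "'q set"
  ara_init :: 'q
  ara_delta :: "'q \<Rightarrow> 'a \<Rightarrow> bool \<Rightarrow> 'q pbf"

definition safety_ara :: "('a, 'q) ara \<Rightarrow> bool" where
  "safety_ara A \<longleftrightarrow>
     finite (ara_alph A) \<and> finite (ara_states A) \<and> ara_init A \<in> ara_states A \<and>
     (\<forall>q \<in> ara_states A. \<forall>a \<in> ara_alph A. \<forall>b. atom_states (ara_delta A q a b) \<subseteq> ara_states A)"

definition ara_step ::
  "('a, 'q) ara \<Rightarrow> 'a data_word \<Rightarrow> nat \<Rightarrow> ('q \<times> nat set) set \<Rightarrow> ('q \<times> nat set) set \<Rightarrow> bool" where
  "ara_step A \<sigma> i F F' \<longleftrightarrow>
     (\<exists>P Pd.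
        (\<forall>(q, D) \<in> F. P q D \<subseteq> ara_states A \<and> Pd q D \<subseteq> ara_states A \<and>
           sat (P q D) (Pd q D) (ara_delta A q (str \<sigma> i) (D = cls \<sigma> i))) \<and>
        F' = {(q', D) | q' q D. (q, D) \<in> F \<and> q' \<in> P q D} \<union>
             {(q', cls \<sigma> i) | q' q D. (q, D) \<in> F \<and> q' \<in> Pd q D})"

definition ara_accepts :: "('a, 'q) ara \<Rightarrow> 'a data_word \<Rightarrow> bool" where
  "ara_accepts A \<sigma> \<longleftrightarrow>
     (\<exists>F. F 0 = {(ara_init A, cls \<sigma> 0)} \<and> (\<forall>i. ara_step A \<sigma> i (F i) (F (Suc i))))"

definition ara_lang :: "('a, 'q) ara \<Rightarrow> 'a data_word set" where
  "ara_lang A = {\<sigma>. data_word_over (ara_alph A) \<sigma> \<and> ara_accepts A \<sigma>}"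


section \<open>Safety incrementing powerset counter automata with nondeterministic transfers\<close>

datatype 'x instr =
    Inc "'x set" | Dec "'x set" | Transf "'x set \<Rightarrow> 'x set set"

text \<open>The label \<^const>\<open>None\<close> stands for \<open>\<epsilon>\<close>.\<close>

record ('a, 's, 'x) ipcant =
  ipc_alph :: "'a set"
  ipc_states :: "'s set"
  ipc_init :: 's
  ipc_basis :: "'x set"
  ipc_counters :: "'x set set"
  ipc_delta :: "('s \<times> 'a option \<times> 'x instr \<times> 's) set"

definition distributive :: "'x set set \<Rightarrow> ('x set \<Rightarrow> 'x set set) \<Rightarrow> bool" where
  "distributive C f \<longleftrightarrow>
     (\<forall>c \<in> C. \<forall>(n::nat) d d'.
        (\<forall>i<n. d i \<in> C \<and> d' i \<in> f (d i)) \<and> c \<subseteq> (\<Union>i<n. d i)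
          \<longrightarrow> (\<exists>c' \<in> f c. c' \<subseteq> (\<Union>i<n. d' i)))"

text \<open>A function from \<open>C\<close> to the subsets of \<open>C\<close> is represented by its extension with the empty
  set outside \<open>C\<close>, so that equal functions yield equal instructions.\<close>

fun instr_ok :: "'x set set \<Rightarrow> 'x instr \<Rightarrow> bool" where
  "instr_ok C (Inc c) \<longleftrightarrow> c \<in> C"
| "instr_ok C (Dec c) \<longleftrightarrow> c \<in> C"
| "instr_ok C (Transf f) \<longleftrightarrow>
     (\<forall>c \<in> C. f c \<subseteq> C) \<and> (\<forall>c. c \<notin> C \<longrightarrow> f c = {}) \<and> distributive C f"

definition safety_ipcant :: "('a, 's, 'x) ipcant \<Rightarrow> bool" where
  "safety_ipcant M \<longleftrightarrow>
     finite (ipc_alph M) \<and> finite (ipc_states M) \<and> ipc_init M \<in> ipc_states M \<and>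
     finite (ipc_basis M) \<and> ipc_counters M \<subseteq> Pow (ipc_basis M) - {{}} \<and>
     (\<forall>(s, l, ins, s') \<in> ipc_delta M.
        s \<in> ipc_states M \<and> s' \<in> ipc_states M \<and> set_option l \<subseteq> ipc_alph M \<and>
        instr_ok (ipc_counters M) ins) \<and>
     acyclic {(s, s'). \<exists>ins. (s, None, ins, s') \<in> ipc_delta M}"

text \<open>Error-free effect of an instruction.  In a transfer, \<open>K c c'\<close> is the part of the value of
  \<open>c\<close> that is moved to \<open>c'\<close>; if \<open>f c\<close> is empty then the transfer is firable only when \<open>c\<close> has
  value zero.\<close>

fun exec :: "'x set set \<Rightarrow> 'x instr \<Rightarrow> ('x set \<Rightarrow> nat) \<Rightarrow> ('x set \<Rightarrow> nat) \<Rightarrow> bool" where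
  "exec C (Inc c) v v' \<longleftrightarrow> v' = v(c := v c + 1)"
| "exec C (Dec c) v v' \<longleftrightarrow> v c \<noteq> 0 \<and> v' = v(c := v c - 1)"
| "exec C (Transf f) v v' \<longleftrightarrow>
     (\<exists>K. (\<forall>c \<in> C. v c = (\<Sum>c' \<in> f c. K c c')) \<and>
          (\<forall>c' \<in> C. v' c' = (\<Sum>c | c \<in> C \<and> c' \<in> f c. K c c')))"

text \<open>Incrementing errors may occur before and after the execution of an instruction.  Only the
  values of valuations on the counters matter.\<close>

definition exec_incr ::
  "'x set set \<Rightarrow> 'x instr \<Rightarrow> ('x set \<Rightarrow> nat) \<Rightarrow> ('x set \<Rightarrow> nat) \<Rightarrow> bool" where
  "exec_incr C ins v v' \<longleftrightarrow>
     (\<exists>u u'. (\<forall>c \<in> C. v c \<le> u c) \<and> exec C ins u u' \<and> (\<forall>c \<in> C. u' c \<le> v' c))"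

text \<open>The labels of the run concatenate to the \<open>\<omega>\<close>-word \<open>w\<close>: the strictly increasing \<open>g\<close>
  enumerates the positions of the labels different from \<open>\<epsilon>\<close>.\<close>

definition labels_concat :: "(nat \<Rightarrow> 'a option) \<Rightarrow> (nat \<Rightarrow> 'a) \<Rightarrow> bool" where
  "labels_concat l w \<longleftrightarrow>
     (\<exists>g. strict_mono g \<and> range g = {i. l i \<noteq> None} \<and> (\<forall>n. l (g n) = Some (w n)))"

definition ipc_accepts :: "('a, 's, 'x) ipcant \<Rightarrow> (nat \<Rightarrow> 'a) \<Rightarrow> bool" where
  "ipc_accepts M w \<longleftrightarrow>
     (\<exists>s v l ins.
        s 0 = ipc_init M \<and> (\<forall>c \<in> ipc_counters M. v 0 c = 0) \<and>
        (\<forall>i. (s i, l i, ins i, s (Suc i)) \<in> ipc_delta M \<and>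
             exec_incr (ipc_counters M) (ins i) (v i) (v (Suc i))) \<and>
        labels_concat l w)"

definition ipc_lang :: "('a, 's, 'x) ipcant \<Rightarrow> (nat \<Rightarrow> 'a) set" where
  "ipc_lang M = {w. ipc_accepts M w}"


section \<open>Encodings of automata as strings\<close>

text \<open>Letters, states and basis elements are natural numbers, written in binary with the least
  significant bit first and a terminating \<open>Stop\<close>.  Finite sets are written as bracketed lists of
  the codes of their elements, in any order, so that a set has several encodings.  All codes are
  prefix-free, hence codes of tuples are plain concatenations.\<close>

datatype tok = Bit bool | Stop | Open | Close

fun nat_bits :: "nat \<Rightarrow> tok list" where
  "nat_bits n = (if n = 0 then [] else Bit (odd n) # nat_bits (n div 2))"

declare nat_bits.simps [simp del]

definition code_nat :: "nat \<Rightarrow> tok list" where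
  "code_nat n = nat_bits n @ [Stop]"

definition code_set :: "('e \<Rightarrow> tok list \<Rightarrow> bool) \<Rightarrow> 'e set \<Rightarrow> tok list \<Rightarrow> bool" where
  "code_set E S w \<longleftrightarrow>
     (\<exists>xs ws. set xs = S \<and> list_all2 E xs ws \<and> w = Open # concat ws @ [Close])"

definition code_nat_set :: "nat set \<Rightarrow> tok list \<Rightarrow> bool" where
  "code_nat_set = code_set (\<lambda>n w. w = code_nat n)"

fun code_pbf :: "nat pbf \<Rightarrow> tok list" where
  "code_pbf Tt = code_nat 0"
| "code_pbf Ff = code_nat 1"
| "code_pbf (Keep q) = code_nat 2 @ code_nat q"
| "code_pbf (Store q) = code_nat 3 @ code_nat q"
| "code_pbf (And \<phi> \<psi>) = code_nat 4 @ code_pbf \<phi> @ code_pbf \<psi>"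
| "code_pbf (Or \<phi> \<psi>) = code_nat 5 @ code_pbf \<phi> @ code_pbf \<psi>"

definition code_ara :: "(nat, nat) ara \<Rightarrow> tok list \<Rightarrow> bool" where
  "code_ara A w \<longleftrightarrow>
     (\<exists>wa ws wd.
        code_nat_set (ara_alph A) wa \<and> code_nat_set (ara_states A) ws \<and>
        code_set
          (\<lambda>(q, a, b) u.
             u = code_nat q @ code_nat a @ code_nat (of_bool b) @ code_pbf (ara_delta A q a b))
          (ara_states A \<times> ara_alph A \<times> UNIV) wd \<and>
        w = wa @ ws @ code_nat (ara_init A) @ wd)"

text \<open>A transfer function is written as the table of its values on all counters.\<close>

fun code_instr :: "nat set set \<Rightarrow> nat instr \<Rightarrow> tok list \<Rightarrow> bool" where
  "code_instr C (Inc c) w \<longleftrightarrow> (\<exists>u. code_nat_set c u \<and> w = code_nat 0 @ u)"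
| "code_instr C (Dec c) w \<longleftrightarrow> (\<exists>u. code_nat_set c u \<and> w = code_nat 1 @ u)"
| "code_instr C (Transf f) w \<longleftrightarrow>
     (\<exists>u. code_set
            (\<lambda>c t. \<exists>t1 t2. code_nat_set c t1 \<and> code_set code_nat_set (f c) t2 \<and> t = t1 @ t2) C u \<and>
          w = code_nat 2 @ u)"

fun code_label :: "nat option \<Rightarrow> tok list" where
  "code_label None = code_nat 0"
| "code_label (Some a) = code_nat 1 @ code_nat a"

definition code_ipcant :: "(nat, nat, nat) ipcant \<Rightarrow> tok list \<Rightarrow> bool" where
  "code_ipcant M w \<longleftrightarrow>
     (\<exists>wa ws wx wc wd.
        code_nat_set (ipc_alph M) wa \<and> code_nat_set (ipc_states M) ws \<and>
        code_nat_set (ipc_basis M) wx \<and> code_set code_nat_set (ipc_counters M) wc \<and>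
        code_set
          (\<lambda>(s, l, ins, s') t.
             \<exists>u. code_instr (ipc_counters M) ins u \<and>
                 t = code_nat s @ code_label l @ u @ code_nat s')
          (ipc_delta M) wd \<and>
        w = wa @ ws @ code_nat (ipc_init M) @ wx @ wc @ wd)"


section \<open>Polynomial-space computability\<close>

text \<open>Deterministic Turing machines with a read-only two-way input tape, finitely many work tapes
  and a write-only output tape.  States and work symbols are initial segments of the natural
  numbers, the initial state is 0, and the blank symbol is 0.  Work tapes are infinite to the right
  only; a move to the left from cell 0 has no effect.  The input word occupies the cells
  \<open>1, \<dots>, n\<close> of the input tape, between end markers in the cells \<open>0\<close> and \<open>n + 1\<close>, which the
  input head cannot leave.  The transition function maps a state, the scanned input symbol and the
  scanned work symbols to \<^const>\<open>None\<close> (halt), or to a new state, an input head move, a written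
  symbol and a move for each work tape, and an optional symbol to append to the output.\<close>

datatype dir = MoveL | Stay | MoveR

datatype 't input_cell = LeftEnd | RightEnd | Cell 't

record 't tm =
  tm_states :: nat
  tm_symbols :: nat
  tm_tapes :: nat
  tm_trans ::
    "nat \<Rightarrow> 't input_cell \<Rightarrow> nat list \<Rightarrow> (nat \<times> dir \<times> (nat \<times> dir) list \<times> 't option) option"

definition turing_machine :: "'t::finite tm \<Rightarrow> bool" where
  "turing_machine T \<longleftrightarrow>
     0 < tm_states T \<and> 0 < tm_symbols T \<and>
     (\<forall>q x ys. q < tm_states T \<and> length ys = tm_tapes T \<and> (\<forall>y \<in> set ys. y < tm_symbols T) \<longrightarrow>
        (case tm_trans T q x ys of
           None \<Rightarrow> True
         | Some (q', d, acts, z) \<Rightarrow>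
             q' < tm_states T \<and> length acts = tm_tapes T \<and> (\<forall>(y, e) \<in> set acts. y < tm_symbols T)))"

record 't tm_config =
  cf_state :: nat
  cf_input :: nat
  cf_work :: "((nat \<Rightarrow> nat) \<times> nat) list"
  cf_output :: "'t list"

definition init_config :: "'t tm \<Rightarrow> 't tm_config" where
  "init_config T = \<lparr>cf_state = 0, cf_input = 0,
     cf_work = replicate (tm_tapes T) (\<lambda>_. 0, 0), cf_output = []\<rparr>"

definition read_input :: "'t list \<Rightarrow> nat \<Rightarrow> 't input_cell" where
  "read_input w h =
     (if h = 0 then LeftEnd else if h \<le> length w then Cell (w ! (h - 1)) else RightEnd)"

fun move :: "dir \<Rightarrow> nat \<Rightarrow> nat" where
  "move MoveL h = h - 1"
| "move Stay h = h"
| "move MoveR h = h + 1"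

definition tm_next :: "'t tm \<Rightarrow> 't list \<Rightarrow> 't tm_config \<Rightarrow> 't tm_config option" where
  "tm_next T w c =
     (case tm_trans T (cf_state c) (read_input w (cf_input c)) (map (\<lambda>(t, h). t h) (cf_work c)) of
        None \<Rightarrow> None
      | Some (q', d, acts, z) \<Rightarrow>
          Some \<lparr>cf_state = q',
                cf_input = min (move d (cf_input c)) (length w + 1),
                cf_work = map2 (\<lambda>(t, h) (y, e). (t(h := y), move e h)) (cf_work c) acts,
                cf_output = cf_output c @ (case z of None \<Rightarrow> [] | Some a \<Rightarrow> [a])\<rparr>)"

definition within_space :: "nat \<Rightarrow> 't tm_config \<Rightarrow> bool" where
  "within_space m c \<longleftrightarrow> (\<forall>(t, h) \<in> set (cf_work c). h < m)"

text \<open>On input \<open>w\<close>, the machine halts with output \<open>y\<close>, and only the first \<open>m\<close> cells of each work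
  tape are visited.  As usual for space bounds, the output is not counted: it may be exponentially
  long.\<close>

definition tm_computes_in_space :: "'t tm \<Rightarrow> 't list \<Rightarrow> 't list \<Rightarrow> nat \<Rightarrow> bool" where
  "tm_computes_in_space T w y m \<longleftrightarrow>
     (\<exists>c. (\<lambda>c c'. within_space m c \<and> tm_next T w c = Some c')\<^sup>*\<^sup>* (init_config T) c \<and>
          within_space m c \<and> tm_next T w c = None \<and> cf_output c = y)"

definition polyspace_computable_on ::
  "'t::finite list set \<Rightarrow> ('t list \<Rightarrow> 't list) \<Rightarrow> bool" where
  "polyspace_computable_on I f \<longleftrightarrow>
     (\<exists>T (p :: nat poly). turing_machine T \<and>
        (\<forall>w \<in> I. tm_computes_in_space T w (f w) (poly p (length w))))"

instance tok :: finite
proof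
  have "(UNIV :: tok set) \<subseteq> range Bit \<union> {Stop, Open, Close}"
  proof
    fix t :: tok
    show "t \<in> range Bit \<union> {Stop, Open, Close}" by (cases t) auto
  qed
  then show "finite (UNIV :: tok set)"
    by (rule finite_subset) simp
qed

end

theory Submission
  imports Defs
begin

text \<open>The counters of the incrementing automaton are sets of states of the alternating automaton: the
  value of \<open>c\<close> is the number of classes whose set of obligations is \<open>c\<close>.  At each position the
  automaton decrements the counter of the current class, guesses the new set of obligations of that
  class, transfers all remaining counters accordingly and increments the counter of the guessed set.
  Since dropping obligations preserves runs, incrementing errors are harmless.  The encoding of this
  automaton is a nested enumeration of sets of states, each given by one bit per input cell, filtered by
  evaluations of formulae.  A linear-space machine performs it; it is obtained by compiling a
  structured program for heads on several marked copies of the input.\<close>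

text \<open>A counter automaton cannot see the datum of a position. The decrement chooses the class
  instead, and a fresh class is paid for by an incrementing error, so this construction relies on
  errors. Conversely, for soundness the counters need only bound the number of tracked classes from
  above. The output is exponentially long, but each item of it is determined by a letter and at most
  four subsets of the state set: the obligations of the current class before and after the step, a
  counter and its target. The printer never numbers the states. Only the bits at the first cells of
  state codes matter in a vector, so many vectors denote the same subset. This is harmless: an
  encoded set may list an element repeatedly, and duplicated control states do not change the
  language. It makes the automaton depend on the given encoding of the input, which is why its
  control states are indexed by an abstract set \<open>V\<close> with a surjection \<open>S\<close>
  onto the subsets. All storage consists of heads and marks on copies of the input with its two end
  markers, which gives the bound of \<open>length w + 2\<close> cells.\<close>

section \<open>The counter automaton and its language\<close>

text \<open>The dummy element \<open>0\<close> makes the empty set of obligations a counter.  Prefixing the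
  binary code of \<open>q\<close> by a one gives the code of \<open>2 * q + 1\<close>.\<close>

definition cnt :: "nat set \<Rightarrow> nat set" where
  "cnt c = insert 0 ((\<lambda>q. 2 * q + 1) ` c)"

lemma odd_in_cnt [simp]: "Suc (2 * q) \<in> cnt c \<longleftrightarrow> q \<in> c"
  by (auto simp: cnt_def)

lemma cnt_inj [simp]: "cnt c = cnt d \<longleftrightarrow> c = d"
proof
  assume "cnt c = cnt d"
  then have "q \<in> c \<longleftrightarrow> q \<in> d" for q using odd_in_cnt by metis
  then show "c = d" by blast
qed simp

lemma cnt_nonempty: "cnt c \<noteq> {}" by (simp add: cnt_def)

lemma cnt_mono: "c \<subseteq> d \<Longrightarrow> cnt c \<subseteq> cnt d" by (auto simp: cnt_def)

lemma finite_cnt: "finite c \<Longrightarrow> finite (cnt c)" by (simp add: cnt_def)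

lemma card_cnt: "finite c \<Longrightarrow> card (cnt c) = Suc (card c)"
  by (auto simp: cnt_def card_insert_if card_image inj_on_def)

section \<open>Monotonicity, enumerations and distributions of finite sets\<close>

lemma sat_mono: "sat P Pd \<phi> \<Longrightarrow> P \<subseteq> P' \<Longrightarrow> Pd \<subseteq> Pd' \<Longrightarrow> sat P' Pd' \<phi>"
  by (induction \<phi>) auto

text \<open>\<open>f n\<close> equals some \<open>g k\<close>, and \<open>k < n\<close> would give
  \<open>f k = g k = f n\<close>; so \<open>g n \<le> f n\<close>, and equality follows by symmetry.
  This recovers the positions of the letters in a run.\<close>

lemma strict_mono_range_unique:
  fixes f g :: "nat \<Rightarrow> nat"
  assumes f: "strict_mono f" and g: "strict_mono g" and r: "range f = range g"
  shows "f = g"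
proof
  fix n show "f n = g n"
  proof (induction n rule: less_induct)
    case (less n)
    have le: "g' n \<le> f' n" if "range f' \<subseteq> range g'" "\<And>i. i < n \<Longrightarrow> f' i = g' i" "strict_mono f'" "strict_mono g'"
      for f' g' :: "nat \<Rightarrow> nat"
    proof -
      have "f' n \<in> range g'" by (rule subsetD[OF that(1) rangeI])
      then obtain k where k: "f' n = g' k" by auto
      have "\<not> k < n"
      proof
        assume "k < n"
        then have "f' k = f' n" using that(2) k by simp
        with \<open>k < n\<close> that(3) show False by (metis nat_neq_iff strict_mono_less)
      qed
      then show ?thesis using k that(4) by (simp add: strict_mono_less_eq)
    qed
    show ?case using le[of f g] le[of g f] less f g r by (simp add: order_antisym)
  qed
qed

lemma thirds: "\<exists>k. i = 3 * k \<or> i = Suc (3 * k) \<or> i = Suc (Suc (3 * k))" for i :: nat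
proof -
  have "i mod 3 = 0 \<or> i mod 3 = 1 \<or> i mod 3 = 2" by auto
  moreover have "i = 3 * (i div 3) + i mod 3" by simp
  ultimately have "i = 3 * (i div 3) \<or> i = Suc (3 * (i div 3)) \<or> i = Suc (Suc (3 * (i div 3)))" by linarith
  then show ?thesis by blast
qed

text \<open>Inject \<open>J\<close> into the disjoint union of blocks of sizes \<open>k b\<close>;
  the block that receives an element is its image under \<open>g\<close>.\<close>

lemma distribute_fibres:
  assumes "finite J" "finite B" "card J \<le> (\<Sum>b\<in>B. k b)"
  shows "\<exists>g. (\<forall>j\<in>J. g j \<in> B) \<and> (\<forall>b\<in>B. card {j \<in> J. g j = b} \<le> k b)"
proof -
  have "card J \<le> card (SIGMA b:B. {..<k b})" using assms by (simp add: card_SigmaI)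
  then obtain f where f: "f ` J \<subseteq> (SIGMA b:B. {..<k b})" "inj_on f J"
    using card_le_inj[OF assms(1), of "SIGMA b:B. {..<k b}"] assms(2) by auto
  have "card {j \<in> J. fst (f j) = b} \<le> k b" if "b \<in> B" for b
  proof -
    have "card {j \<in> J. fst (f j) = b} = card (f ` {j \<in> J. fst (f j) = b})"
      using f(2) by (intro card_image[symmetric]) (auto simp: inj_on_def)
    also have "\<dots> \<le> card ({b} \<times> {..<k b})"
    proof (rule card_mono)
      have "f j \<in> {b} \<times> {..<k b}" if "j \<in> J" "fst (f j) = b" for j
        using f(1) that by (cases "f j") auto
      then show "f ` {j \<in> J. fst (f j) = b} \<subseteq> {b} \<times> {..<k b}"
        unfolding image_subset_iff by blast
    qed simp
    finally show ?thesis by simp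
  qed
  moreover have "fst (f j) \<in> B" if "j \<in> J" for j
    using f(1) that by (cases "f j") auto
  ultimately show ?thesis by (intro exI[of _ "\<lambda>j. fst (f j)"]) simp
qed

text \<open>Turns the numbers of a transfer back into individuals. There are at most as many objects
  labelled \<open>c\<close> as units leaving \<open>c\<close>, since errors only add units. So the
  objects can be distributed with the amounts \<open>K c c'\<close> as capacities, and summing over
  the sources bounds each new fibre.\<close>

lemma relabel:
  assumes fin: "finite C" "finite I" and lab: "\<forall>i\<in>I. lab i \<in> C" and f: "\<forall>c\<in>C. f c \<subseteq> C"
    and le: "\<forall>c\<in>C. card {i \<in> I. lab i = c} \<le> v c" and ex: "exec_incr C (Transf f) v v'"
  shows "\<exists>lab'. (\<forall>i\<in>I. lab' i \<in> f (lab i)) \<and> (\<forall>c'\<in>C. card {i \<in> I. lab' i = c'} \<le> v' c')"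
proof -
  obtain u u' K where u: "\<forall>c\<in>C. v c \<le> u c" "\<forall>c\<in>C. u' c \<le> v' c"
    and K: "\<forall>c\<in>C. u c = (\<Sum>c'\<in>f c. K c c')"
      "\<forall>c'\<in>C. u' c' = (\<Sum>c | c \<in> C \<and> c' \<in> f c. K c c')"
    using ex by (auto simp: exec_incr_def)
  define R where "R c g \<longleftrightarrow> (\<forall>j\<in>{i \<in> I. lab i = c}. g j \<in> f c) \<and>
      (\<forall>b\<in>f c. card {j \<in> {i \<in> I. lab i = c}. g j = b} \<le> K c b)" for c g
  have "\<exists>g. R c g" if c: "c \<in> C" for c
    unfolding R_def
  proof (rule distribute_fibres)
    show "finite (f c)" using f c fin(1) finite_subset by blast
    have "card {i \<in> I. lab i = c} \<le> v c" using le c by blast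
    also have "\<dots> \<le> u c" using u(1) c by blast
    also have "\<dots> = (\<Sum>b\<in>f c. K c b)" using K(1) c by blast
    finally show "card {i \<in> I. lab i = c} \<le> (\<Sum>b\<in>f c. K c b)" .
  qed (use fin(2) in simp)
  then obtain g where gR: "\<forall>c\<in>C. R c (g c)" using bchoice[of C R] by blast
  have g: "c \<in> C \<Longrightarrow> j \<in> I \<Longrightarrow> lab j = c \<Longrightarrow> g c j \<in> f c"
    "c \<in> C \<Longrightarrow> b \<in> f c \<Longrightarrow> card {j \<in> {i \<in> I. lab i = c}. g c j = b} \<le> K c b" for c j b
    using gR by (simp_all add: R_def)
  define lab' where "lab' = (\<lambda>i. g (lab i) i)"
  have "card {i \<in> I. lab' i = c'} \<le> v' c'" if c': "c' \<in> C" for c'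
  proof -
    let ?D = "{c. c \<in> C \<and> c' \<in> f c}"
    have "{i \<in> I. lab' i = c'} \<subseteq> (\<Union>c\<in>?D. {j \<in> {i \<in> I. lab i = c}. g c j = c'})"
      using lab g(1) by (auto simp: lab'_def)
    then have "card {i \<in> I. lab' i = c'} \<le> card (\<Union>c\<in>?D. {j \<in> {i \<in> I. lab i = c}. g c j = c'})"
      using fin by (intro card_mono) auto
    also have "\<dots> \<le> (\<Sum>c\<in>?D. card {j \<in> {i \<in> I. lab i = c}. g c j = c'})"
      using fin by (intro card_UN_le) auto
    also have "\<dots> \<le> (\<Sum>c\<in>?D. K c c')" using g(2) by (intro sum_mono) auto
    also have "\<dots> = u' c'" using K(2) c' by simp
    also have "\<dots> \<le> v' c'" using u(2) c' by blast
    finally show ?thesis .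
  qed
  moreover have "\<forall>i\<in>I. lab' i \<in> f (lab i)" using lab g(1) by (auto simp: lab'_def)
  ultimately show ?thesis by blast
qed

text \<open>A run may carry more obligations than a step produces, since dropping obligations
  preserves runs.\<close>

lemma ara_acceptsI:
  assumes init: "(ara_init A, cls \<sigma> 0) \<in> G 0"
    and step: "\<And>k q D. (q, D) \<in> G k \<Longrightarrow> \<exists>P Pd. P \<subseteq> ara_states A \<and> Pd \<subseteq> ara_states A \<and>
      sat P Pd (ara_delta A q (str \<sigma> k) (D = cls \<sigma> k)) \<and>
      (\<forall>p\<in>P. (p, D) \<in> G (Suc k)) \<and> (\<forall>p\<in>Pd. (p, cls \<sigma> k) \<in> G (Suc k))"
  shows "ara_accepts A \<sigma>"
proof -
  define R where "R k q D PP \<longleftrightarrow> (case PP of (P, Pd) \<Rightarrow> P \<subseteq> ara_states A \<and> Pd \<subseteq> ara_states A \<and>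
      sat P Pd (ara_delta A q (str \<sigma> k) (D = cls \<sigma> k)) \<and>
      (\<forall>p\<in>P. (p, D) \<in> G (Suc k)) \<and> (\<forall>p\<in>Pd. (p, cls \<sigma> k) \<in> G (Suc k)))" for k q D PP
  define W where "W k q D = (SOME PP. R k q D PP)" for k q D
  have W: "R k q D (W k q D)" if "(q, D) \<in> G k" for k q D
    unfolding W_def by (rule someI_ex) (use step[OF that] in \<open>auto simp: R_def\<close>)
  define P where "P k q D = fst (W k q D)" for k q D
  define Pd where "Pd k q D = snd (W k q D)" for k q D
  have P: "P k q D \<subseteq> ara_states A" "Pd k q D \<subseteq> ara_states A"
      "sat (P k q D) (Pd k q D) (ara_delta A q (str \<sigma> k) (D = cls \<sigma> k))"
      "p \<in> P k q D \<Longrightarrow> (p, D) \<in> G (Suc k)" "p \<in> Pd k q D \<Longrightarrow> (p, cls \<sigma> k) \<in> G (Suc k)"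
    if "(q, D) \<in> G k" for k q D p
    using W[OF that] by (auto simp: R_def P_def Pd_def split: prod.splits)
  \<comment> \<open>\<open>ara_step\<close> demands equality with the set generated by the
    witnesses, so the run is generated from the initial configuration; \<open>G\<close> only bounds
    it from above.\<close>
  define F where "F = rec_nat {(ara_init A, cls \<sigma> 0)} (\<lambda>k F.
      {(q', D) | q' q D. (q, D) \<in> F \<and> q' \<in> P k q D} \<union>
      {(q', cls \<sigma> k) | q' q D. (q, D) \<in> F \<and> q' \<in> Pd k q D})"
  have F0: "F 0 = {(ara_init A, cls \<sigma> 0)}" by (simp add: F_def)
  have FS: "F (Suc k) = {(q', D) | q' q D. (q, D) \<in> F k \<and> q' \<in> P k q D} \<union>
      {(q', cls \<sigma> k) | q' q D. (q, D) \<in> F k \<and> q' \<in> Pd k q D}" for k by (simp add: F_def)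
  have FG: "F k \<subseteq> G k" for k
  proof (induction k)
    case (Suc k)
    then show ?case using P(4,5) unfolding FS by blast
  qed (use init F0 in simp)
  have "ara_step A \<sigma> k (F k) (F (Suc k))" for k
  proof -
    have PF: "P k q D \<subseteq> ara_states A" "Pd k q D \<subseteq> ara_states A"
      "sat (P k q D) (Pd k q D) (ara_delta A q (str \<sigma> k) (D = cls \<sigma> k))" if "(q, D) \<in> F k" for q D
      using P(1-3)[of q D k] FG[of k] that by blast+
    show ?thesis
      unfolding ara_step_def FS
      by (rule exI[where x = "P k"], rule exI[where x = "Pd k"], rule conjI[OF _ refl], clarify, intro conjI PF)
  qed
  then show ?thesis unfolding ara_accepts_def using F0 by blast
qed

text \<open>\<open>S\<close> need not be injective: in the application \<open>V\<close> consists of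
  bit vectors of the input length, many of which represent the same set. \<open>rd v\<close>
  remembers the obligations taken from the current class, \<open>wr v\<close> those to be given back
  to it.\<close>

locale counter_simulation =
  fixes A :: "('a, nat) ara" and V :: "'v set" and S :: "'v \<Rightarrow> nat set"
    and st idl :: 's and rd wr :: "'v \<Rightarrow> 's"
  assumes safe: "safety_ara A" and finV: "finite V" and SV: "S ` V = Pow (ara_states A)"
    and inj: "inj_on rd V" "inj_on wr V"
    and distinct: "st \<noteq> idl" "\<And>v. v \<in> V \<Longrightarrow> rd v \<notin> {st, idl}" "\<And>v. v \<in> V \<Longrightarrow> wr v \<notin> {st, idl}"
      "\<And>v v'. v \<in> V \<Longrightarrow> v' \<in> V \<Longrightarrow> rd v \<noteq> wr v'"
begin

abbreviation "Q \<equiv> ara_states A"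
definition "counters = cnt ` Pow Q"

text \<open>All supersets of the obligations that a class may obtain are admitted as targets; by
  monotonicity of satisfaction this costs nothing and makes distributivity immediate.  The set \<open>D\<close>
  is the guessed set of obligations of the current class after the step, which also bounds the states
  stored by the other classes.\<close>

definition trf :: "'a \<Rightarrow> nat set \<Rightarrow> nat set \<Rightarrow> nat set set" where
  "trf a D c = (if c \<in> counters
     then cnt ` {c'. c' \<subseteq> Q \<and> (\<forall>q\<in>Q. Suc (2 * q) \<in> c \<longrightarrow> sat c' D (ara_delta A q a False))} else {})"

text \<open>The decrement retrieves the obligations of the current class.  Owing to incrementing errors
  it can always be executed, so a fresh class needs no special treatment; the initial class is a
  fresh class with obligations containing the initial state.\<close>

definition ipc_trans :: "('s \<times> 'a option \<times> nat instr \<times> 's) set" where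
  "ipc_trans = {(idl, None, Dec (cnt (S v)), rd v) | v. v \<in> V} \<union>
     {(wr v, None, Inc (cnt (S v)), idl) | v. v \<in> V} \<union>
     {(st, None, Dec (cnt (S v)), rd v) | v. v \<in> V \<and> ara_init A \<in> S v} \<union>
     {(rd v, Some a, Transf (trf a (S v')), wr v') | v a v'. v \<in> V \<and> v' \<in> V \<and> a \<in> ara_alph A \<and>
        (\<forall>q\<in>S v. sat (S v') (S v') (ara_delta A q a True))}"

definition ipc :: "('a, 's, nat) ipcant" where
  "ipc = \<lparr>ipc_alph = ara_alph A, ipc_states = {st, idl} \<union> rd ` V \<union> wr ` V, ipc_init = st,
     ipc_basis = cnt Q, ipc_counters = counters, ipc_delta = ipc_trans\<rparr>"

lemma ipc_alph_ipc: "ipc_alph ipc = ara_alph A"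
  by (simp add: ipc_def)

lemma finQ: "finite Q" and init_Q: "ara_init A \<in> Q"
  using safe by (auto simp: safety_ara_def)

lemma fin_counters: "finite counters"
  using finQ by (simp add: counters_def)

lemma S_sub: "v \<in> V \<Longrightarrow> S v \<subseteq> Q"
  using SV by blast

lemma S_ex: "c \<subseteq> Q \<Longrightarrow> \<exists>v\<in>V. S v = c"
  using SV by (metis Pow_iff imageE)

lemma trf_cnt: "c \<subseteq> Q \<Longrightarrow> trf a D (cnt c) = cnt ` {c'. c' \<subseteq> Q \<and> (\<forall>q\<in>c. sat c' D (ara_delta A q a False))}"
  by (auto simp: trf_def counters_def)

text \<open>If \<open>c\<close> is covered by the \<open>d i\<close>, the union of the obligations
  in the \<open>d' i\<close> serves as target: every obligation of \<open>c\<close> lies in some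
  \<open>d i\<close>, is satisfied by the corresponding target, and stays satisfied in the larger
  union.\<close>

lemma instr_ok_trf: "instr_ok counters (Transf (trf a D))"
proof -
  have "\<exists>c'\<in>trf a D c. c' \<subseteq> (\<Union>i<n. d' i)"
    if c: "c \<in> counters" and d: "\<And>i. i < n \<Longrightarrow> d i \<in> counters \<and> d' i \<in> trf a D (d i)" and sub: "c \<subseteq> (\<Union>i<n. d i)"
    for c and n :: nat and d d'
  proof -
    obtain c0 where c0: "c0 \<subseteq> Q" "c = cnt c0" using c by (auto simp: counters_def)
    have "\<exists>e e'. e \<subseteq> Q \<and> d i = cnt e \<and> e' \<subseteq> Q \<and> d' i = cnt e' \<and> (\<forall>q\<in>e. sat e' D (ara_delta A q a False))"
      if i: "i < n" for i
    proof -
      obtain e where e: "e \<subseteq> Q" "d i = cnt e" using d[OF i] by (auto simp: counters_def)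
      moreover have "d' i \<in> trf a D (cnt e)" using d[OF i] e by simp
      ultimately show ?thesis unfolding trf_cnt[OF e(1)] by blast
    qed
    then obtain e e' where e: "\<And>i. i < n \<Longrightarrow> e i \<subseteq> Q \<and> d i = cnt (e i) \<and> e' i \<subseteq> Q \<and> d' i = cnt (e' i) \<and>
        (\<forall>q\<in>e i. sat (e' i) D (ara_delta A q a False))" by metis
    let ?c' = "\<Union>i<n. e' i"
    have "sat ?c' D (ara_delta A q a False)" if "q \<in> c0" for q
    proof -
      have "Suc (2 * q) \<in> (\<Union>i<n. d i)" using subsetD[OF sub, of "Suc (2 * q)"] that c0(2) by simp
      then obtain i where i: "i < n" "q \<in> e i" using e by auto
      then have "sat (e' i) D (ara_delta A q a False)" using e by blast
      then show ?thesis using i(1) by (elim sat_mono) auto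
    qed
    then have "cnt ?c' \<in> trf a D c" using e unfolding c0(2) trf_cnt[OF c0(1)] by blast
    \<comment> \<open>The dummy element 0 of \<open>c\<close> rules out the empty cover, so 0 also
      lies in some \<open>d' i\<close>.\<close>
    moreover have "cnt ?c' \<subseteq> (\<Union>i<n. d' i)"
    proof -
      have "0 \<in> (\<Union>i<n. d i)" using sub c0 by (auto simp: cnt_def)
      then obtain i where "i < n" by blast
      then have "0 \<in> (\<Union>i<n. d' i)" using e by (auto simp: cnt_def)
      then show ?thesis using e by (auto simp: cnt_def)
    qed
    ultimately show ?thesis by blast
  qed
  then have "distributive counters (trf a D)" unfolding distributive_def by blast
  moreover have "trf a D c \<subseteq> counters" for c by (auto simp: trf_def counters_def)
  moreover have "c \<notin> counters \<Longrightarrow> trf a D c = {}" for c by (simp add: trf_def)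
  ultimately show ?thesis by simp
qed

lemma safety_ipc: "safety_ipcant ipc"
proof -
  have "cnt (S v) \<in> counters" if "v \<in> V" for v using S_sub[OF that] by (simp add: counters_def)
  then have "\<forall>(s, l, ins, s') \<in> ipc_trans. s \<in> ipc_states ipc \<and> s' \<in> ipc_states ipc \<and> set_option l \<subseteq> ipc_alph ipc \<and>
        instr_ok counters ins"
    using instr_ok_trf by (auto simp: ipc_trans_def ipc_def simp del: instr_ok.simps(3))
  moreover have "acyclic {(s, s'). \<exists>ins. (s, None, ins, s') \<in> ipc_trans}" (is "acyclic ?R")
  proof -
    \<comment> \<open>Silent transitions lead only from \<open>wr v\<close> to \<open>idl\<close>,
      and from \<open>idl\<close> or \<open>st\<close> to some \<open>rd v\<close>. This rank drops
      along them.\<close>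
    define rank :: "'s \<Rightarrow> nat" where "rank s = (if s \<in> wr ` V then 2 else if s \<in> {st, idl} then 1 else 0)" for s
    have r: "rank idl = 1" "rank st = 1" "v \<in> V \<Longrightarrow> rank (wr v) = 2" for v
      using distinct(1,3) by (auto simp: rank_def)
    have "rank (rd v) = 0" if "v \<in> V" for v
      using distinct(2)[OF that] distinct(4)[OF that] by (auto simp: rank_def)
    then have "?R\<inverse> \<subseteq> measure rank"
      using r by (auto simp: ipc_trans_def)
    then have "wf (?R\<inverse>)" using wf_subset by blast
    then show ?thesis using wf_acyclic acyclic_converse by blast
  qed
  moreover have "counters \<subseteq> Pow (cnt Q) - {{}}"
    using cnt_mono cnt_nonempty by (auto simp: counters_def)
  ultimately show ?thesis
    using safe finV finite_cnt[OF finQ] by (auto simp: safety_ipcant_def ipc_def safety_ara_def)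
qed

text \<open>The dummy element adds one to the number of states; since the state set is nonempty, the
  factor 2 absorbs it.\<close>

lemma card_basis: "card (ipc_basis ipc) \<le> 2 * card (ara_states A)"
proof -
  have "0 < card Q" using finQ init_Q by (auto simp: card_gt_0_iff)
  then show ?thesis by (simp add: ipc_def card_cnt[OF finQ])
qed

text \<open>The kinds of control states are disjoint and \<open>rd\<close>, \<open>wr\<close> are
  injective, so the source fixes the instruction up to the guesses: every run cycles through
  decrement, transfer and increment.\<close>

lemma trans_from:
  assumes "(s, l, ins, s') \<in> ipc_trans"
  shows "s = idl \<Longrightarrow> \<exists>v\<in>V. l = None \<and> ins = Dec (cnt (S v)) \<and> s' = rd v"
    and "s = st \<Longrightarrow> \<exists>v\<in>V. l = None \<and> ins = Dec (cnt (S v)) \<and> s' = rd v \<and> ara_init A \<in> S v"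
    and "s = rd v \<Longrightarrow> v \<in> V \<Longrightarrow> \<exists>a\<in>ara_alph A. \<exists>v'\<in>V. l = Some a \<and> ins = Transf (trf a (S v')) \<and> s' = wr v' \<and>
      (\<forall>q\<in>S v. sat (S v') (S v') (ara_delta A q a True))"
    and "s = wr v \<Longrightarrow> v \<in> V \<Longrightarrow> l = None \<and> ins = Inc (cnt (S v)) \<and> s' = idl"
proof -
  have rd: "rd v = rd v' \<Longrightarrow> v \<in> V \<Longrightarrow> v' \<in> V \<Longrightarrow> v = v'" and wr: "wr v = wr v' \<Longrightarrow> v \<in> V \<Longrightarrow> v' \<in> V \<Longrightarrow> v = v'"
    for v v' using inj by (auto dest: inj_onD)
  have ne: "st \<noteq> idl" "v \<in> V \<Longrightarrow> rd v \<noteq> st" "v \<in> V \<Longrightarrow> rd v \<noteq> idl" "v \<in> V \<Longrightarrow> wr v \<noteq> st" "v \<in> V \<Longrightarrow> wr v \<noteq> idl"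
    "v \<in> V \<Longrightarrow> v' \<in> V \<Longrightarrow> rd v \<noteq> wr v'" "v \<in> V \<Longrightarrow> v' \<in> V \<Longrightarrow> wr v' \<noteq> rd v" for v v'
    using distinct distinct(4)[symmetric] by auto
  have cases: "(\<exists>v\<in>V. s = idl \<and> l = None \<and> ins = Dec (cnt (S v)) \<and> s' = rd v) \<or>
     (\<exists>v\<in>V. s = wr v \<and> l = None \<and> ins = Inc (cnt (S v)) \<and> s' = idl) \<or>
     (\<exists>v\<in>V. s = st \<and> l = None \<and> ins = Dec (cnt (S v)) \<and> s' = rd v \<and> ara_init A \<in> S v) \<or>
     (\<exists>v\<in>V. \<exists>a\<in>ara_alph A. \<exists>v'\<in>V. s = rd v \<and> l = Some a \<and> ins = Transf (trf a (S v')) \<and> s' = wr v' \<and>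
        (\<forall>q\<in>S v. sat (S v') (S v') (ara_delta A q a True)))"
    using assms unfolding ipc_trans_def by blast
  show "\<exists>v\<in>V. l = None \<and> ins = Dec (cnt (S v)) \<and> s' = rd v" if "s = idl"
    using cases by (elim disjE bexE conjE) (use ne that in auto)
  show "\<exists>v\<in>V. l = None \<and> ins = Dec (cnt (S v)) \<and> s' = rd v \<and> ara_init A \<in> S v" if "s = st"
    using cases by (elim disjE bexE conjE) (use ne that in auto)
  show "\<exists>a\<in>ara_alph A. \<exists>v'\<in>V. l = Some a \<and> ins = Transf (trf a (S v')) \<and> s' = wr v' \<and>
      (\<forall>q\<in>S v. sat (S v') (S v') (ara_delta A q a True))" if sv: "s = rd v" "v \<in> V"
    using cases
  proof (elim disjE bexE conjE)
    fix u a v' assume u: "u \<in> V" "s = rd u" "a \<in> ara_alph A" "v' \<in> V" "l = Some a" "ins = Transf (trf a (S v'))" "s' = wr v'"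
      "\<forall>q\<in>S u. sat (S v') (S v') (ara_delta A q a True)"
    then have "u = v" using rd sv by simp
    then show ?thesis using u by blast
  qed (use ne sv in auto)
  show "l = None \<and> ins = Inc (cnt (S v)) \<and> s' = idl" if sv: "s = wr v" "v \<in> V"
    using cases
  proof (elim disjE bexE conjE)
    fix u assume u: "u \<in> V" "s = wr u" "l = None" "ins = Inc (cnt (S u))" "s' = idl"
    then have "u = v" using wr sv by simp
    then show ?thesis using u by blast
  qed (use ne sv in auto)
qed

section \<open>From counter runs to data words\<close>

definition labelled :: "(nat \<Rightarrow> nat set option) \<Rightarrow> nat set \<Rightarrow> nat set" where
  "labelled L c = {i. L i = Some c}"

text \<open>Classes are named by natural numbers; \<open>L\<close> maps the classes seen so far to supersets of their
  obligations.  Incrementing errors only make the counters larger than the number of classes.\<close>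

definition tracks :: "(nat set \<Rightarrow> nat) \<Rightarrow> (nat \<Rightarrow> nat set option) \<Rightarrow> bool" where
  "tracks v L \<longleftrightarrow> finite (dom L) \<and> ran L \<subseteq> Pow Q \<and> (\<forall>c\<subseteq>Q. card (labelled L c) \<le> v (cnt c))"

lemma finite_labelled: "finite (dom L) \<Longrightarrow> finite (labelled L c)"
  by (rule finite_subset[of _ "dom L"]) (auto simp: labelled_def)

text \<open>The current class is taken to be one labelled \<open>c\<close>. If there is none, the
  removed unit is surplus created by an error, and the position opens a new class under a free name
  \<open>d\<close>.\<close>

lemma inv_dec:
  assumes inv: "tracks v L" and c: "c \<subseteq> Q" and ex: "exec_incr counters (Dec (cnt c)) v v'"
  shows "\<exists>d. (L d = None \<or> L d = Some c) \<and> tracks v' (L(d := None))"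
proof -
  obtain u where u: "\<forall>c\<in>counters. v c \<le> u c" "\<forall>e\<in>counters. (u(cnt c := u (cnt c) - 1)) e \<le> v' e"
    using ex by (auto simp: exec_incr_def)
  have cn: "e \<subseteq> Q \<Longrightarrow> cnt e \<in> counters" for e by (simp add: counters_def)
  have fin: "finite (dom L)" and ran: "ran L \<subseteq> Pow Q" and le: "e \<subseteq> Q \<Longrightarrow> card (labelled L e) \<le> v (cnt e)" for e
    using inv by (auto simp: tracks_def)
  obtain d where d: "L d = None \<or> L d = Some c" "L d = None \<Longrightarrow> labelled L c = {}"
  proof (cases "labelled L c = {}")
    case True
    obtain d where "d \<notin> dom L" using fin ex_new_if_finite infinite_UNIV_nat by blast
    with True show ?thesis by (intro that[of d]) (auto simp: domIff)
  next
    case False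
    then obtain d where "L d = Some c" by (auto simp: labelled_def)
    then show ?thesis by (intro that[of d]) auto
  qed
  have lab: "labelled (L(d := None)) e = labelled L e - {d}" for e
    by (auto simp: labelled_def)
  have "card (labelled (L(d := None)) e) \<le> v' (cnt e)" if e: "e \<subseteq> Q" for e
  proof (cases "e = c")
    case True
    have "card (labelled L c - {d}) \<le> card (labelled L c) - 1"
    proof (cases "L d = None")
      case False
      then have "d \<in> labelled L c" using d(1) by (auto simp: labelled_def)
      then show ?thesis using finite_labelled[OF fin] by simp
    qed (use d(2) in simp)
    also have "\<dots> \<le> u (cnt c) - 1" using le[OF c] u(1) cn[OF c] by (meson diff_le_mono le_trans)
    also have "\<dots> \<le> v' (cnt c)" using u(2) cn[OF c] by fastforce
    finally show ?thesis using True lab by simp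
  next
    case False
    have "card (labelled L e - {d}) \<le> card (labelled L e)" by (rule card_mono[OF finite_labelled[OF fin]]) blast
    also have "\<dots> \<le> u (cnt e)" using le[OF e] u(1) cn[OF e] le_trans by blast
    also have "\<dots> \<le> v' (cnt e)" using u(2) cn[OF e] False by (metis cnt_inj fun_upd_other)
    finally show ?thesis using lab by simp
  qed
  moreover have "ran (L(d := None)) \<subseteq> Pow Q" using ran by (auto simp: ran_def split: if_splits)
  moreover have "finite (dom (L(d := None)))" using fin by simp
  ultimately show ?thesis using d(1) unfolding tracks_def by blast
qed

text \<open>The tracked classes are the individuals moved by \<open>relabel\<close>; surplus units
  are ignored. Equality of the domains keeps a name that was removed before available.\<close>

lemma inv_transf:
  assumes inv: "tracks v L" and D: "D \<subseteq> Q" and ex: "exec_incr counters (Transf (trf a D)) v v'"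
  shows "\<exists>L'. tracks v' L' \<and> dom L' = dom L \<and>
    (\<forall>i c. L i = Some c \<longrightarrow> (\<exists>c'. L' i = Some c' \<and> c' \<subseteq> Q \<and> (\<forall>q\<in>c. sat c' D (ara_delta A q a False))))"
proof -
  have fin: "finite (dom L)" and ran: "ran L \<subseteq> Pow Q" and le: "e \<subseteq> Q \<Longrightarrow> card (labelled L e) \<le> v (cnt e)" for e
    using inv by (auto simp: tracks_def)
  have sub: "the (L i) \<subseteq> Q" if "i \<in> dom L" for i
  proof -
    from that obtain c where "L i = Some c" by auto
    then show ?thesis using ranI[of L i c] ran by auto
  qed
  have "\<exists>lab'. (\<forall>i\<in>dom L. lab' i \<in> trf a D (cnt (the (L i)))) \<and>
     (\<forall>c'\<in>counters. card {i \<in> dom L. lab' i = c'} \<le> v' c')"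
  proof (rule relabel[OF fin_counters fin _ _ _ ex])
    show "\<forall>i\<in>dom L. cnt (the (L i)) \<in> counters" using sub by (auto simp: counters_def)
    show "\<forall>c\<in>counters. trf a D c \<subseteq> counters" by (auto simp: trf_def counters_def)
    have "{i \<in> dom L. cnt (the (L i)) = cnt c} = labelled L c" for c by (auto simp: labelled_def)
    then show "\<forall>c\<in>counters. card {i \<in> dom L. cnt (the (L i)) = c} \<le> v c"
      using le by (auto simp: counters_def)
  qed
  then obtain lab' where lab': "\<And>i. i \<in> dom L \<Longrightarrow> lab' i \<in> trf a D (cnt (the (L i)))"
    "\<And>c'. c' \<in> counters \<Longrightarrow> card {i \<in> dom L. lab' i = c'} \<le> v' c'" by blast
  have "\<exists>c'. i \<in> dom L \<longrightarrow> lab' i = cnt c' \<and> c' \<subseteq> Q \<and> (\<forall>q\<in>the (L i). sat c' D (ara_delta A q a False))" for i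
    using lab'(1)[of i] sub[of i] by (cases "i \<in> dom L") (auto simp: trf_cnt)
  then obtain e where e: "\<And>i. i \<in> dom L \<Longrightarrow> lab' i = cnt (e i) \<and> e i \<subseteq> Q \<and> (\<forall>q\<in>the (L i). sat (e i) D (ara_delta A q a False))"
    by metis
  define L' where "L' i = (if i \<in> dom L then Some (e i) else None)" for i
  have dom: "dom L' = dom L" by (auto simp: L'_def dom_def)
  have eq: "i \<in> dom L \<Longrightarrow> (lab' i = cnt c) = (e i = c)" for i c using e[of i] by simp
  have "labelled L' c = {i \<in> dom L. lab' i = cnt c}" for c
  proof -
    have "labelled L' c = {i \<in> dom L. e i = c}" by (auto simp: labelled_def L'_def split: if_splits)
    also have "\<dots> = {i \<in> dom L. lab' i = cnt c}" using eq by blast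
    finally show ?thesis .
  qed
  then have "\<forall>c\<subseteq>Q. card (labelled L' c) \<le> v' (cnt c)" using lab'(2) by (auto simp: counters_def)
  moreover have "ran L' \<subseteq> Pow Q" using e by (auto simp: ran_def L'_def split: if_splits)
  ultimately have "tracks v' L'" using fin dom by (simp add: tracks_def)
  moreover have "\<exists>c'. L' i = Some c' \<and> c' \<subseteq> Q \<and> (\<forall>q\<in>c. sat c' D (ara_delta A q a False))" if "L i = Some c" for i c
    using e[of i] that by (auto simp: L'_def)
  ultimately show ?thesis using dom by blast
qed

lemma inv_inc:
  assumes inv: "tracks v L" and c: "c \<subseteq> Q" and d: "L d = None" and ex: "exec_incr counters (Inc (cnt c)) v v'"
  shows "tracks v' (L(d \<mapsto> c))"
proof -
  obtain u where u: "\<forall>c\<in>counters. v c \<le> u c" "\<forall>e\<in>counters. (u(cnt c := u (cnt c) + 1)) e \<le> v' e"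
    using ex by (auto simp: exec_incr_def)
  have fin: "finite (dom L)" and ran: "ran L \<subseteq> Pow Q" and le: "e \<subseteq> Q \<Longrightarrow> card (labelled L e) \<le> v (cnt e)" for e
    using inv by (auto simp: tracks_def)
  have "card (labelled (L(d \<mapsto> c)) e) \<le> v' (cnt e)" if e: "e \<subseteq> Q" for e
  proof -
    have cn: "cnt e \<in> counters" using e by (simp add: counters_def)
    have u1: "card (labelled L e) \<le> u (cnt e)" using le[OF e] u(1) cn le_trans by blast
    show ?thesis
    proof (cases "e = c")
      case True
      have "labelled (L(d \<mapsto> c)) c = insert d (labelled L c)" by (auto simp: labelled_def)
      moreover have "card (insert d (labelled L c)) \<le> Suc (card (labelled L c))"
        using card_insert_le_m1 finite_labelled[OF fin] by (simp add: card_insert_if)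
      moreover have "u (cnt c) + 1 \<le> v' (cnt c)" using u(2) cn True by fastforce
      ultimately show ?thesis using u1 True by simp
    next
      case False
      have "labelled (L(d \<mapsto> c)) e = labelled L e" using False d by (auto simp: labelled_def)
      moreover have "u (cnt e) \<le> v' (cnt e)" using u(2) cn False by (metis cnt_inj fun_upd_other)
      ultimately show ?thesis using u1 by simp
    qed
  qed
  then show ?thesis using fin ran c unfolding tracks_def by (auto simp: ran_def split: if_splits)
qed

text \<open>One position of the data word. The name taken out by the decrement is still free after
  the transfer, and the increment reinserts it with the guessed set \<open>D\<close>.\<close>

lemma macro_step:
  assumes inv: "tracks v0 L" and C: "C \<subseteq> Q" and D: "D \<subseteq> Q"
    and ex: "exec_incr counters (Dec (cnt C)) v0 v1" "exec_incr counters (Transf (trf a D)) v1 v2"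
      "exec_incr counters (Inc (cnt D)) v2 v3"
  shows "\<exists>L' d. tracks v3 L' \<and> (L d = None \<or> L d = Some C) \<and> L' d = Some D \<and>
    (\<forall>i c. i \<noteq> d \<longrightarrow> L i = Some c \<longrightarrow> (\<exists>c'. L' i = Some c' \<and> c' \<subseteq> Q \<and> (\<forall>q\<in>c. sat c' D (ara_delta A q a False))))"
proof -
  obtain d where d: "L d = None \<or> L d = Some C" and 1: "tracks v1 (L(d := None))"
    using inv_dec[OF inv C ex(1)] by blast
  obtain L2 where 2: "tracks v2 L2" "dom L2 = dom (L(d := None))"
    "\<And>i c. (L(d := None)) i = Some c \<Longrightarrow> \<exists>c'. L2 i = Some c' \<and> c' \<subseteq> Q \<and> (\<forall>q\<in>c. sat c' D (ara_delta A q a False))"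
    using inv_transf[OF 1 D ex(2)] by blast
  have L2d: "L2 d = None" using 2(2) by (metis domIff fun_upd_same)
  have "\<exists>c'. (L2(d \<mapsto> D)) i = Some c' \<and> c' \<subseteq> Q \<and> (\<forall>q\<in>c. sat c' D (ara_delta A q a False))"
    if "i \<noteq> d" "L i = Some c" for i c
    using 2(3)[of i c] that by simp
  then show ?thesis using inv_inc[OF 2(1) D L2d ex(3)] d by (intro exI[of _ "L2(d \<mapsto> D)"] exI[of _ d]) simp
qed

text \<open>The equivalence relation is reconstructed from the bookkeeping: a position belongs to
  the class whose name its decrement selects. The labels then provide an over-approximating run for
  \<open>ara_acceptsI\<close>.\<close>

lemma run_to_word:
  assumes "ipc_accepts ipc w"
  shows "\<exists>\<sigma>\<in>ara_lang A. str \<sigma> = w"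
proof -
  obtain s v l ins where s0: "s 0 = st" and v0: "\<And>c. c \<in> counters \<Longrightarrow> v 0 c = 0"
    and tr: "\<And>i. (s i, l i, ins i, s (Suc i)) \<in> ipc_trans"
    and ex: "\<And>i. exec_incr counters (ins i) (v i) (v (Suc i))" and lw: "labels_concat l w"
  proof -
    obtain s v l ins where *: "s 0 = ipc_init ipc" "\<forall>c \<in> ipc_counters ipc. v 0 c = 0"
      "\<forall>i. (s i, l i, ins i, s (Suc i)) \<in> ipc_delta ipc \<and> exec_incr (ipc_counters ipc) (ins i) (v i) (v (Suc i))"
      "labels_concat l w"
      using assms unfolding ipc_accepts_def by blast
    show ?thesis by (rule that[of s v l ins]) (use * in \<open>simp_all add: ipc_def\<close>)
  qed
  \<comment> \<open>Transitions \<open>3 * k\<close> to \<open>3 * k + 2\<close> form round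
    \<open>k\<close>: decrement with guess \<open>x\<close>, transfer reading \<open>a\<close> with
    guess \<open>y\<close>, increment.\<close>
  define R where "R k x y a \<longleftrightarrow> x \<in> V \<and> y \<in> V \<and> a \<in> ara_alph A \<and> s (Suc (Suc (Suc (3 * k)))) = idl \<and>
     l (3 * k) = None \<and> l (Suc (3 * k)) = Some a \<and> l (Suc (Suc (3 * k))) = None \<and>
     ins (3 * k) = Dec (cnt (S x)) \<and> ins (Suc (3 * k)) = Transf (trf a (S y)) \<and> ins (Suc (Suc (3 * k))) = Inc (cnt (S y)) \<and>
     (\<forall>q\<in>S x. sat (S y) (S y) (ara_delta A q a True)) \<and> (s (3 * k) = st \<longrightarrow> ara_init A \<in> S x)" for k x y a
  have R: "\<exists>x y a. R k x y a" if sk: "s (3 * k) = st \<or> s (3 * k) = idl" for k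
  proof -
    obtain x where x: "x \<in> V" "l (3 * k) = None" "ins (3 * k) = Dec (cnt (S x))" "s (Suc (3 * k)) = rd x"
      "s (3 * k) = st \<longrightarrow> ara_init A \<in> S x"
      using sk
    proof
      assume "s (3 * k) = st"
      from trans_from(2)[OF tr this] show ?thesis using that by blast
    next
      assume idle: "s (3 * k) = idl"
      from trans_from(1)[OF tr idle] show ?thesis using that distinct(1) idle by force
    qed
    from trans_from(3)[OF tr x(4,1)] obtain y a where y: "y \<in> V" "a \<in> ara_alph A" "l (Suc (3 * k)) = Some a"
      "ins (Suc (3 * k)) = Transf (trf a (S y))" "s (Suc (Suc (3 * k))) = wr y"
      "\<forall>q\<in>S x. sat (S y) (S y) (ara_delta A q a True)" by blast
    from trans_from(4)[OF tr y(5,1)] x y show ?thesis unfolding R_def by blast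
  qed
  have sk: "s (3 * k) = st \<or> s (3 * k) = idl" for k
  proof (induction k)
    case (Suc k)
    from R[OF this] obtain x y a where "R k x y a" by blast
    moreover have "3 * Suc k = Suc (Suc (Suc (3 * k)))" by simp
    ultimately show ?case by (simp only: R_def simp_thms)
  qed (simp add: s0)
  define x where "x k = (SOME x. \<exists>y a. R k x y a)" for k
  define y where "y k = (SOME y. \<exists>a. R k (x k) y a)" for k
  define a where "a k = (SOME a. R k (x k) (y k) a)" for k
  have Rk: "R k (x k) (y k) (a k)" for k
  proof -
    have "\<exists>y a. R k (x k) y a" unfolding x_def by (rule someI_ex) (rule R[OF sk])
    then have "\<exists>a. R k (x k) (y k) a" unfolding y_def by (rule someI_ex)
    then show ?thesis unfolding a_def by (rule someI_ex)
  qed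
  have inV: "x k \<in> V" "y k \<in> V" "a k \<in> ara_alph A" for k using Rk[of k] by (auto simp: R_def)
  have w: "w k = a k" for k
  proof -
    obtain g where g: "strict_mono g" "range g = {i. l i \<noteq> None}" "\<And>n. l (g n) = Some (w n)"
      using lw by (auto simp: labels_concat_def)
    \<comment> \<open>Each round reads exactly one letter, at its middle transition.\<close>
    have "{i. l i \<noteq> None} = range (\<lambda>k. Suc (3 * k))"
    proof (intro set_eqI iffI)
      fix i assume i: "i \<in> {i. l i \<noteq> None}"
      obtain k where "i = 3 * k \<or> i = Suc (3 * k) \<or> i = Suc (Suc (3 * k))" using thirds by blast
      then show "i \<in> range (\<lambda>k. Suc (3 * k))" using i Rk[of k] by (auto simp: R_def)
    qed (use Rk in \<open>auto simp: R_def\<close>)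
    then have "g = (\<lambda>k. Suc (3 * k))"
      using g by (intro strict_mono_range_unique) (auto simp: strict_mono_def)
    then show ?thesis using g(3)[of k] Rk[of k] by (simp add: R_def)
  qed
  have step: "exec_incr counters (Dec (cnt (S (x k)))) (v (3 * k)) (v (Suc (3 * k)))"
    "exec_incr counters (Transf (trf (a k) (S (y k)))) (v (Suc (3 * k))) (v (Suc (Suc (3 * k))))"
    "exec_incr counters (Inc (cnt (S (y k)))) (v (Suc (Suc (3 * k)))) (v (3 * Suc k))" for k
  proof -
    have e: "3 * Suc k = Suc (Suc (Suc (3 * k)))" by simp
    show "exec_incr counters (Dec (cnt (S (x k)))) (v (3 * k)) (v (Suc (3 * k)))"
      "exec_incr counters (Transf (trf (a k) (S (y k)))) (v (Suc (3 * k))) (v (Suc (Suc (3 * k))))"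
      "exec_incr counters (Inc (cnt (S (y k)))) (v (Suc (Suc (3 * k)))) (v (3 * Suc k))"
      using ex[of "3 * k"] ex[of "Suc (3 * k)"] ex[of "Suc (Suc (3 * k))"] Rk[of k]
      unfolding R_def e by metis+
  qed
  define T where "T k L L' d \<longleftrightarrow> (L d = None \<or> L d = Some (S (x k))) \<and> L' d = Some (S (y k)) \<and>
    (\<forall>i c. i \<noteq> d \<longrightarrow> L i = Some c \<longrightarrow>
      (\<exists>c'. L' i = Some c' \<and> c' \<subseteq> Q \<and> (\<forall>q\<in>c. sat c' (S (y k)) (ara_delta A q (a k) False))))" for k and L L' :: "nat \<Rightarrow> nat set option" and d
  have "\<exists>L. \<forall>k. tracks (v (3 * k)) (L k) \<and> (\<exists>d. T k (L k) (L (Suc k)) d)"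
  proof (rule dependent_nat_choice)
    show "\<exists>L. tracks (v (3 * 0)) L"
      by (rule exI[of _ Map.empty]) (simp add: tracks_def labelled_def)
    show "\<exists>L'. tracks (v (3 * Suc k)) L' \<and> (\<exists>d. T k L L' d)" if "tracks (v (3 * k)) L" for k L
      using macro_step[OF that S_sub[OF inV(1)] S_sub[OF inV(2)] step] unfolding T_def by blast
  qed
  then obtain L d where T: "\<And>k. T k (L k) (L (Suc k)) (d k)" by metis
  \<comment> \<open>A class that is fresh at position \<open>k\<close> has no label in
    \<open>L k\<close>. \<open>M k\<close> gives it the set guessed by the decrement; for the first
    position this set contains the initial state.\<close>
  define M where "M k = (L k)(d k \<mapsto> S (x k))" for k
  have LM: "M k i = Some c" if "L k i = Some c" for k i c
    using T[of k] that by (auto simp: M_def T_def)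
  define D where "D i = {j. d j = i}" for i :: nat
  define \<sigma> where "\<sigma> = \<lparr>str = w, sim = {(i, j). d i = d j}\<rparr>"
  have cls: "cls \<sigma> k = D (d k)" for k by (auto simp: cls_def \<sigma>_def D_def)
  have str: "str \<sigma> k = a k" for k by (simp add: \<sigma>_def w)
  define G where "G k = {(q, D i) | q i c. M k i = Some c \<and> q \<in> c}" for k
  have "ara_accepts A \<sigma>"
  proof (rule ara_acceptsI[of _ _ G])
    have "ara_init A \<in> S (x 0)" using Rk[of 0] s0 by (simp add: R_def)
    then show "(ara_init A, cls \<sigma> 0) \<in> G 0" by (auto simp: G_def cls M_def)
  next
    fix k q E assume "(q, E) \<in> G k"
    then obtain i c where i: "E = D i" "M k i = Some c" "q \<in> c" by (auto simp: G_def)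
    have cur: "(p, cls \<sigma> k) \<in> G (Suc k)" if "p \<in> S (y k)" for p
      using LM[of "Suc k" "d k" "S (y k)"] T[of k] that by (auto simp: G_def cls T_def)
    show "\<exists>P Pd. P \<subseteq> Q \<and> Pd \<subseteq> Q \<and> sat P Pd (ara_delta A q (str \<sigma> k) (E = cls \<sigma> k)) \<and>
        (\<forall>p\<in>P. (p, E) \<in> G (Suc k)) \<and> (\<forall>p\<in>Pd. (p, cls \<sigma> k) \<in> G (Suc k))"
    proof (cases "i = d k")
      case True
      then have "q \<in> S (x k)" using i by (simp add: M_def)
      then have "sat (S (y k)) (S (y k)) (ara_delta A q (str \<sigma> k) (E = cls \<sigma> k))"
        using Rk[of k] i True by (simp add: R_def cls str)
      then show ?thesis
        using cur S_sub[OF inV(2)[of k]] i True cls by (intro exI[of _ "S (y k)"]) auto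
    next
      case False
      then have "L k i = Some c" using i by (simp add: M_def)
      then obtain c' where c': "L (Suc k) i = Some c'" "c' \<subseteq> Q" "\<forall>q\<in>c. sat c' (S (y k)) (ara_delta A q (a k) False)"
        using T[of k] False unfolding T_def by blast
      \<comment> \<open>Position \<open>k\<close> itself belongs to the class named
        \<open>d k\<close> but not to the one named \<open>i\<close>.\<close>
      have "E \<noteq> cls \<sigma> k" using False i(1) by (auto simp: cls D_def)
      then have "sat c' (S (y k)) (ara_delta A q (str \<sigma> k) (E = cls \<sigma> k))"
        using c'(3) i(3) by (simp add: str)
      moreover have "(p, E) \<in> G (Suc k)" if "p \<in> c'" for p
        using LM[OF c'(1)] that i(1) by (auto simp: G_def)
      ultimately show ?thesis using c'(2) cur S_sub[OF inV(2)[of k]] by blast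
    qed
  qed
  moreover have "data_word_over (ara_alph A) \<sigma>"
    using inV(3) w by (auto simp: data_word_over_def \<sigma>_def equiv_def refl_on_def sym_def Relation.trans_def)
  ultimately show ?thesis by (auto simp: ara_lang_def \<sigma>_def)
qed

section \<open>From data words to counter runs\<close>

definition interleave :: "(nat \<Rightarrow> 'z) \<Rightarrow> (nat \<Rightarrow> 'z) \<Rightarrow> (nat \<Rightarrow> 'z) \<Rightarrow> nat \<Rightarrow> 'z" where
  "interleave f g h i = (if i mod 3 = 0 then f (i div 3) else if i mod 3 = 1 then g (i div 3) else h (i div 3))"

lemma interleave_simps:
  "interleave f g h (3 * k) = f k" "interleave f g h (Suc (3 * k)) = g k"
  "interleave f g h (Suc (Suc (3 * k))) = h k" "interleave f g h (Suc (Suc (Suc (3 * k)))) = f (Suc k)"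
proof -
  have e: "(3 * k) mod 3 = 0" "(3 * k) div 3 = k" "Suc (3 * k) mod 3 = 1" "Suc (3 * k) div 3 = k"
    "Suc (Suc (3 * k)) mod 3 = 2" "Suc (Suc (3 * k)) div 3 = k"
    "Suc (Suc (Suc (3 * k))) mod 3 = 0" "Suc (Suc (Suc (3 * k))) div 3 = Suc k"
    by presburger+
  show "interleave f g h (3 * k) = f k" "interleave f g h (Suc (3 * k)) = g k"
    "interleave f g h (Suc (Suc (3 * k))) = h k" "interleave f g h (Suc (Suc (Suc (3 * k)))) = f (Suc k)"
    unfolding interleave_def e by simp_all
qed

lemma card_fibres:
  assumes "finite X" "finite B" "\<And>x. x \<in> X \<Longrightarrow> g x \<in> B"
  shows "card X = (\<Sum>b\<in>B. card {x \<in> X. g x = b})"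
  using sum.group[OF assms(1,2), of g "\<lambda>_. 1 :: nat"] assms(3) by (simp add: image_subset_iff)

text \<open>Leaves only sets and valuations to be supplied: every set is represented by some index
  in \<open>V\<close>, and this determines the control states.\<close>

lemma macro_run:
  assumes x: "\<And>k. x k \<subseteq> Q" and y: "\<And>k. y k \<subseteq> Q" and w: "\<And>k. w k \<in> ara_alph A" and x0: "ara_init A \<in> x 0"
    and cur: "\<And>k q. q \<in> x k \<Longrightarrow> sat (y k) (y k) (ara_delta A q (w k) True)"
    and v0: "\<And>c. v0 0 c = 0"
    and ex: "\<And>k. exec_incr counters (Dec (cnt (x k))) (v0 k) (v1 k)"
      "\<And>k. exec_incr counters (Transf (trf (w k) (y k))) (v1 k) (v2 k)"
      "\<And>k. exec_incr counters (Inc (cnt (y k))) (v2 k) (v0 (Suc k))"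
  shows "ipc_accepts ipc w"
proof -
  obtain X where X: "\<And>k. X k \<in> V" "\<And>k. S (X k) = x k" using S_ex[OF x] by metis
  obtain Y where Y: "\<And>k. Y k \<in> V" "\<And>k. S (Y k) = y k" using S_ex[OF y] by metis
  define s where "s = interleave (\<lambda>k. if k = 0 then st else idl) (\<lambda>k. rd (X k)) (\<lambda>k. wr (Y k))"
  define l where "l = interleave (\<lambda>_. None) (\<lambda>k. Some (w k)) (\<lambda>_. None)"
  define ins where "ins = interleave (\<lambda>k. Dec (cnt (x k))) (\<lambda>k. Transf (trf (w k) (y k))) (\<lambda>k. Inc (cnt (y k)))"
  define v where "v = interleave v0 v1 v2"
  note il = interleave_simps
  have tr: "(if k = 0 then st else idl, None, Dec (cnt (x k)), rd (X k)) \<in> ipc_trans"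
    "(rd (X k), Some (w k), Transf (trf (w k) (y k)), wr (Y k)) \<in> ipc_trans"
    "(wr (Y k), None, Inc (cnt (y k)), idl) \<in> ipc_trans" for k
  proof -
    have "(idl, None, Dec (cnt (S (X k))), rd (X k)) \<in> ipc_trans"
      using X(1) unfolding ipc_trans_def by blast
    moreover have "(st, None, Dec (cnt (S (X 0))), rd (X 0)) \<in> ipc_trans"
      using X x0 unfolding ipc_trans_def by blast
    ultimately show "(if k = 0 then st else idl, None, Dec (cnt (x k)), rd (X k)) \<in> ipc_trans"
      by (simp add: X(2))
    have "(rd (X k), Some (w k), Transf (trf (w k) (S (Y k))), wr (Y k)) \<in> ipc_trans"
    proof -
      have "\<forall>q\<in>S (X k). sat (S (Y k)) (S (Y k)) (ara_delta A q (w k) True)"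
        using cur unfolding X(2) Y(2) by blast
      then show ?thesis using X(1) Y(1) w unfolding ipc_trans_def by blast
    qed
    then show "(rd (X k), Some (w k), Transf (trf (w k) (y k)), wr (Y k)) \<in> ipc_trans" by (simp add: Y(2))
    have "(wr (Y k), None, Inc (cnt (S (Y k))), idl) \<in> ipc_trans"
      using Y(1) unfolding ipc_trans_def by blast
    then show "(wr (Y k), None, Inc (cnt (y k)), idl) \<in> ipc_trans" by (simp add: Y(2))
  qed
  have "(s i, l i, ins i, s (Suc i)) \<in> ipc_trans \<and> exec_incr counters (ins i) (v i) (v (Suc i))" for i
  proof -
    obtain k where "i = 3 * k \<or> i = Suc (3 * k) \<or> i = Suc (Suc (3 * k))" using thirds by blast
    then show ?thesis
      using tr[of k] ex[of k] by (elim disjE) (simp_all add: s_def l_def ins_def v_def il)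
  qed
  moreover have "labels_concat l w"
    unfolding labels_concat_def
  proof (intro exI conjI allI)
    show "strict_mono (\<lambda>k :: nat. Suc (3 * k))" by (simp add: strict_mono_def)
    show "range (\<lambda>k. Suc (3 * k)) = {i. l i \<noteq> None}"
    proof (intro set_eqI iffI)
      fix i assume "i \<in> {i. l i \<noteq> None}"
      moreover obtain k where "i = 3 * k \<or> i = Suc (3 * k) \<or> i = Suc (Suc (3 * k))" using thirds by blast
      ultimately show "i \<in> range (\<lambda>k. Suc (3 * k))" by (auto simp: l_def il)
    qed (auto simp: l_def il)
    show "l (Suc (3 * n)) = Some (w n)" for n by (simp add: l_def il)
  qed
  moreover have "s 0 = st" "v 0 c = 0" for c
    using il(1)[where k = 0] v0 by (simp_all add: s_def v_def interleave_def)
  ultimately show ?thesis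
    unfolding ipc_accepts_def ipc_def by (intro exI[of _ s] exI[of _ v] exI[of _ l] exI[of _ ins]) simp
qed

text \<open>The counter of \<open>c\<close> holds the number of classes seen so far with obligations
  \<open>c\<close>. The guesses are read off the accepting run: the obligations of the current class
  before and after the step.\<close>

lemma word_to_run:
  assumes "\<sigma> \<in> ara_lang A"
  shows "ipc_accepts ipc (str \<sigma>)"
proof -
  obtain F where F0: "F 0 = {(ara_init A, cls \<sigma> 0)}" and F: "\<And>k. ara_step A \<sigma> k (F k) (F (Suc k))"
    using assms by (auto simp: ara_lang_def ara_accepts_def)
  define B where "B k E = {q. (q, E) \<in> F k}" for k E
  define cur where "cur = cls \<sigma>"
  \<comment> \<open>By monotonicity the witnesses of a step may be enlarged to all obligations
    present afterwards in the class itself and in the current class.\<close>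
  have step: "sat (B (Suc k) E) (B (Suc k) (cur k)) (ara_delta A q (str \<sigma> k) (E = cur k))" if q: "q \<in> B k E" for k q E
  proof -
    from F[of k] obtain P Pd where all: "\<forall>(q, D) \<in> F k. P q D \<subseteq> Q \<and> Pd q D \<subseteq> Q \<and>
           sat (P q D) (Pd q D) (ara_delta A q (str \<sigma> k) (D = cls \<sigma> k))"
      and F': "F (Suc k) = {(q', D) | q' q D. (q, D) \<in> F k \<and> q' \<in> P q D} \<union>
             {(q', cls \<sigma> k) | q' q D. (q, D) \<in> F k \<and> q' \<in> Pd q D}"
      unfolding ara_step_def by (elim exE conjE) (rule that)
    have qE: "(q, E) \<in> F k" using q by (simp add: B_def)
    have P: "sat (P q E) (Pd q E) (ara_delta A q (str \<sigma> k) (E = cls \<sigma> k))"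
      using bspec[OF all qE] by simp
    have "(p, E) \<in> F (Suc k)" if "p \<in> P q E" for p
      unfolding F' using qE that by blast
    moreover have "(p, cls \<sigma> k) \<in> F (Suc k)" if "p \<in> Pd q E" for p
      unfolding F' using qE that by blast
    ultimately have "P q E \<subseteq> B (Suc k) E" "Pd q E \<subseteq> B (Suc k) (cur k)"
      by (auto simp: B_def cur_def)
    then show ?thesis using sat_mono[OF P] by (simp add: cur_def)
  qed
  have B_sub: "B k E \<subseteq> Q" for k E
  proof (cases k)
    case 0
    then show ?thesis using init_Q by (auto simp: B_def F0)
  next
    case (Suc j)
    from F[of j] obtain P Pd where all: "\<forall>(q, D) \<in> F j. P q D \<subseteq> Q \<and> Pd q D \<subseteq> Q \<and>
           sat (P q D) (Pd q D) (ara_delta A q (str \<sigma> j) (D = cls \<sigma> j))"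
      and F': "F (Suc j) = {(q', D) | q' q D. (q, D) \<in> F j \<and> q' \<in> P q D} \<union>
             {(q', cls \<sigma> j) | q' q D. (q, D) \<in> F j \<and> q' \<in> Pd q D}"
      unfolding ara_step_def by (elim exE conjE) (rule that)
    have sub: "p \<in> Q" if "(q, D) \<in> F j" "p \<in> P q D \<or> p \<in> Pd q D" for p q D
      using bspec[OF all that(1)] that(2) by auto
    show ?thesis
    proof
      fix p assume "p \<in> B k E"
      then have "(p, E) \<in> F (Suc j)" by (simp add: B_def Suc)
      then show "p \<in> Q" unfolding F' using sub by blast
    qed
  qed
  define Cl where "Cl k = cur ` {..<k}" for k
  define old where "old k = Cl k - {cur k}" for k
  define v0 where "v0 k c = card {E \<in> Cl k. cnt (B k E) = c}" for k c
  define v1 where "v1 k c = card {E \<in> old k. cnt (B k E) = c}" for k c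
  define v2 where "v2 k c = card {E \<in> old k. cnt (B (Suc k) E) = c}" for k c
  have fin: "finite (Cl k)" "finite (old k)" for k by (simp_all add: Cl_def old_def)
  have Cl_Suc: "Cl (Suc k) = insert (cur k) (old k)" for k by (auto simp: Cl_def old_def lessThan_Suc)
  have new: "cur k \<notin> old k" for k by (simp add: old_def)
  show ?thesis
  proof (rule macro_run[where x = "\<lambda>k. B k (cur k)" and y = "\<lambda>k. B (Suc k) (cur k)" and ?v0.0 = v0 and ?v1.0 = v1 and ?v2.0 = v2])
    show "str \<sigma> k \<in> ara_alph A" for k using assms by (auto simp: ara_lang_def data_word_over_def)
    show "ara_init A \<in> B 0 (cur 0)" by (simp add: B_def F0 cur_def)
    show "sat (B (Suc k) (cur k)) (B (Suc k) (cur k)) (ara_delta A q (str \<sigma> k) True)" if "q \<in> B k (cur k)" for k q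
      using step[OF that] by simp
    show "v0 0 c = 0" for c by (simp add: v0_def Cl_def)
    show "exec_incr counters (Dec (cnt (B k (cur k)))) (v0 k) (v1 k)" for k
      unfolding exec_incr_def
    proof (intro exI conjI)
      let ?c = "cnt (B k (cur k))"
      \<comment> \<open>The valuation before the decrement is \<open>v1 k\<close> plus one unit at
        \<open>?c\<close>. It exceeds \<open>v0 k\<close> on the counters, that is, an error is
        needed, just when the current class is fresh.\<close>
      show "\<forall>c\<in>counters. v0 k c \<le> ((v1 k)(?c := v1 k ?c + 1)) c"
      proof
        fix c
        have "v0 k c \<le> card (if c = ?c then insert (cur k) {E \<in> old k. cnt (B k E) = c} else {E \<in> old k. cnt (B k E) = c})"
          unfolding v0_def by (rule card_mono) (use fin in \<open>auto simp: old_def\<close>)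
        also have "\<dots> \<le> ((v1 k)(?c := v1 k ?c + 1)) c"
          using new[of k] fin by (simp add: v1_def)
        finally show "v0 k c \<le> ((v1 k)(?c := v1 k ?c + 1)) c" .
      qed
      show "exec counters (Dec ?c) ((v1 k)(?c := v1 k ?c + 1)) (v1 k)" by simp
    qed simp
    show "exec_incr counters (Inc (cnt (B (Suc k) (cur k)))) (v2 k) (v0 (Suc k))" for k
      unfolding exec_incr_def
    proof (intro exI conjI)
      let ?c = "cnt (B (Suc k) (cur k))"
      show "exec counters (Inc ?c) (v2 k) ((v2 k)(?c := v2 k ?c + 1))" by simp
      show "\<forall>c\<in>counters. ((v2 k)(?c := v2 k ?c + 1)) c \<le> v0 (Suc k) c"
      proof
        fix c
        have "{E \<in> Cl (Suc k). cnt (B (Suc k) E) = c} =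
            (if c = ?c then insert (cur k) {E \<in> old k. cnt (B (Suc k) E) = c} else {E \<in> old k. cnt (B (Suc k) E) = c})"
          unfolding Cl_Suc by auto
        then show "((v2 k)(?c := v2 k ?c + 1)) c \<le> v0 (Suc k) c"
          using new[of k] fin by (simp add: v0_def v2_def)
      qed
    qed simp
    show "exec_incr counters (Transf (trf (str \<sigma> k) (B (Suc k) (cur k)))) (v1 k) (v2 k)" for k
      unfolding exec_incr_def
    proof (intro exI conjI)
      let ?f = "trf (str \<sigma> k) (B (Suc k) (cur k))"
      \<comment> \<open>Each class other than the current one moves individually; counting the moves
        by source and by target yields the two sums.\<close>
      define K where "K c c' = card {E \<in> {E \<in> old k. cnt (B k E) = c}. cnt (B (Suc k) E) = c'}" for c c'
      have f: "cnt (B (Suc k) E) \<in> ?f (cnt (B k E))" if "E \<in> old k" for E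
      proof -
        have "E \<noteq> cur k" using that by (simp add: old_def)
        then have "sat (B (Suc k) E) (B (Suc k) (cur k)) (ara_delta A q (str \<sigma> k) False)" if "q \<in> B k E" for q
          using step[OF that] by simp
        then show ?thesis unfolding trf_cnt[OF B_sub] using B_sub by blast
      qed
      have f_sub: "?f c \<subseteq> counters" for c by (auto simp: trf_def counters_def)
      have 1: "v1 k c = (\<Sum>c'\<in>?f c. K c c')" for c
        unfolding v1_def K_def
        by (rule card_fibres) (use fin f finite_subset[OF f_sub fin_counters] in auto)
      have 2: "v2 k c' = (\<Sum>c | c \<in> counters \<and> c' \<in> ?f c. K c c')" for c'
      proof -
        have "v2 k c' = (\<Sum>c | c \<in> counters \<and> c' \<in> ?f c.
            card {E \<in> {E \<in> old k. cnt (B (Suc k) E) = c'}. cnt (B k E) = c})"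
          unfolding v2_def
        proof (rule card_fibres)
          fix E assume "E \<in> {E \<in> old k. cnt (B (Suc k) E) = c'}"
          then show "cnt (B k E) \<in> {c. c \<in> counters \<and> c' \<in> ?f c}"
            using f B_sub by (auto simp: counters_def)
        qed (use fin fin_counters in auto)
        also have "\<dots> = (\<Sum>c | c \<in> counters \<and> c' \<in> ?f c. K c c')"
          unfolding K_def by (intro sum.cong refl arg_cong[where f = card]) auto
        finally show ?thesis .
      qed
      show "exec counters (Transf ?f) (v1 k) (v2 k)"
        using 1 2 by auto
    qed simp_all
  qed (use B_sub in auto)
qed

lemma ipc_lang_eq: "ipc_lang ipc = str ` ara_lang A"
  using run_to_word word_to_run by (auto simp: ipc_lang_def image_iff)

end

section \<open>Compiling structured programs to Turing machines\<close>

type_synonym view = "nat \<Rightarrow> tok input_cell \<times> nat"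
type_synonym store = "(nat \<Rightarrow> nat) \<times> (nat \<Rightarrow> nat \<Rightarrow> nat) \<times> tok list"

datatype com =
    Fwd nat | Bwd nat | Put nat nat | Out "view \<Rightarrow> tok option"
  | Sq com com (infixr ";;" 60) | Cond "view \<Rightarrow> bool" com com | Loop "view \<Rightarrow> bool" com

text \<open>Every tape holds a copy of the input whose cells carry an additional mark below 6, so that a
  head is a pointer into the input and the marks form an array indexed by input positions.  A store
  consists of the head positions, the marks and the output.\<close>

definition view :: "tok list \<Rightarrow> (nat \<Rightarrow> nat) \<Rightarrow> (nat \<Rightarrow> nat \<Rightarrow> nat) \<Rightarrow> view" where
  "view w h m j = (read_input w (h j), m j (h j))"

definition out_opt :: "tok option \<Rightarrow> tok list" where
  "out_opt z = (case z of None \<Rightarrow> [] | Some a \<Rightarrow> [a])"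

inductive runs :: "tok list \<Rightarrow> com \<Rightarrow> store \<Rightarrow> store \<Rightarrow> bool" for w where
  Fwd: "h j \<le> length w \<Longrightarrow> runs w (Fwd j) (h, m, r) (h(j := Suc (h j)), m, r)"
| Bwd: "runs w (Bwd j) (h, m, r) (h(j := h j - 1), m, r)"
| Put: "runs w (Put j b) (h, m, r) (h, m(j := (m j)(h j := b)), r)"
| Out: "runs w (Out f) (h, m, r) (h, m, r @ out_opt (f (view w h m)))"
| Sq: "runs w a s s' \<Longrightarrow> runs w b s' s'' \<Longrightarrow> runs w (a ;; b) s s''"
| CondT: "t (view w h m) \<Longrightarrow> runs w a (h, m, r) s' \<Longrightarrow> runs w (Cond t a b) (h, m, r) s'"
| CondF: "\<not> t (view w h m) \<Longrightarrow> runs w b (h, m, r) s' \<Longrightarrow> runs w (Cond t a b) (h, m, r) s'"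
| LoopT: "t (view w h m) \<Longrightarrow> runs w a (h, m, r) s' \<Longrightarrow> runs w (Loop t a) s' s''
    \<Longrightarrow> runs w (Loop t a) (h, m, r) s''"
| LoopF: "\<not> t (view w h m) \<Longrightarrow> runs w (Loop t a) (h, m, r) (h, m, r)"

text \<open>A \<open>view\<close> is defined for all tape numbers, whereas a machine with
  \<open>K\<close> tapes sees only the first \<open>K\<close>.\<close>

definition local_on :: "nat \<Rightarrow> (view \<Rightarrow> 'b) \<Rightarrow> bool" where
  "local_on K t \<longleftrightarrow> (\<forall>o1 o2. (\<forall>j<K. o1 j = o2 j) \<longrightarrow> t o1 = t o2)"

fun com_ok :: "nat \<Rightarrow> com \<Rightarrow> bool" where
  "com_ok K (Fwd j) \<longleftrightarrow> j < K"
| "com_ok K (Bwd j) \<longleftrightarrow> j < K"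
| "com_ok K (Put j b) \<longleftrightarrow> j < K \<and> b < 6"
| "com_ok K (Out f) \<longleftrightarrow> local_on K f"
| "com_ok K (a ;; b) \<longleftrightarrow> com_ok K a \<and> com_ok K b"
| "com_ok K (Cond t a b) \<longleftrightarrow> local_on K t \<and> com_ok K a \<and> com_ok K b"
| "com_ok K (Loop t a) \<longleftrightarrow> local_on K t \<and> com_ok K a"

fun succs :: "com \<Rightarrow> com list \<Rightarrow> view \<Rightarrow> com list" where
  "succs (a ;; b) k v = a # b # k"
| "succs (Cond t a b) k v = (if t v then a # k else b # k)"
| "succs (Loop t a) k v = (if t v then a # Loop t a # k else k)"
| "succs _ k v = k"

fun dirs :: "com \<Rightarrow> nat \<Rightarrow> dir" where
  "dirs (Fwd i) j = (if i = j then MoveR else Stay)"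
| "dirs (Bwd i) j = (if i = j then MoveL else Stay)"
| "dirs _ j = Stay"

fun marks :: "com \<Rightarrow> view \<Rightarrow> nat \<Rightarrow> nat" where
  "marks (Put i b) v j = (if i = j then b else snd (v j))"
| "marks _ v j = snd (v j)"

fun prints :: "com \<Rightarrow> view \<Rightarrow> tok option" where
  "prints (Out f) v = f v"
| "prints _ v = None"

text \<open>The control states of the compiled machine are the continuations that can occur during a run;
  there are finitely many because a loop body is always continued by the loop itself.\<close>

fun points :: "com \<Rightarrow> com list \<Rightarrow> com list set" where
  "points (a ;; b) k = insert ((a ;; b) # k) (points a (b # k) \<union> points b k)"
| "points (Cond t a b) k = insert (Cond t a b # k) (points a k \<union> points b k)"
| "points (Loop t a) k = insert (Loop t a # k) (points a (Loop t a # k))"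
| "points c k = {c # k}"

lemma finite_points: "finite (points c k)"
  by (induction c arbitrary: k) auto

lemma points_self: "c # k \<in> points c k"
  by (cases c) auto

lemma points_cons: "x \<in> points c k \<Longrightarrow> com_ok K c \<Longrightarrow> \<exists>d k'. x = d # k' \<and> com_ok K d"
  by (induction c arbitrary: k) auto

lemma points_closed: "d # k' \<in> points c k \<Longrightarrow> succs d k' v \<in> insert k (points c k)"
proof (induction c arbitrary: k)
  case (Sq a b)
  then show ?case using points_self[of b k] points_self[of a "b # k"] by fastforce
next
  case (Cond t a b)
  then show ?case using points_self[of b k] points_self[of a k] by (fastforce split: if_splits)
next
  case (Loop t a)
  then show ?case using points_self[of a "Loop t a # k"] by (fastforce split: if_splits)
qed auto

section \<open>Symbols and control states of the compiled machine\<close>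

fun cell_index :: "tok input_cell \<Rightarrow> nat" where
  "cell_index LeftEnd = 0"
| "cell_index RightEnd = 1"
| "cell_index (Cell (Bit b)) = (if b then 2 else 3)"
| "cell_index (Cell Stop) = 4"
| "cell_index (Cell Open) = 5"
| "cell_index (Cell Close) = 6"

text \<open>Seven kinds of input cells and six marks give 42 codes, shifted by one because 0 is the
  blank symbol; hence the 43 symbols of the machine. The \<open>mod\<close> keeps every value in
  range.\<close>

definition enc :: "tok input_cell \<times> nat \<Rightarrow> nat" where
  "enc x = 1 + (6 * cell_index (fst x) + snd x mod 6)"

definition dec :: "nat \<Rightarrow> tok input_cell \<times> nat" where
  "dec = inv_into (UNIV \<times> {..<6}) enc"

lemma cell_index_less: "cell_index x < 7"
  by (cases x rule: cell_index.cases) auto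

lemma cell_index_inj: "cell_index x = cell_index y \<Longrightarrow> x = y"
  by (cases x rule: cell_index.cases; cases y rule: cell_index.cases) (auto split: if_splits)

lemma enc_less: "enc x < 43"
  using cell_index_less[of "fst x"] mod_less_divisor[of 6 "snd x"] by (simp add: enc_def)

lemma dec_enc: assumes "k < 6" shows "dec (enc (x, k)) = (x, k)"
proof -
  have "inj_on enc (UNIV \<times> {..<6})"
  proof (rule inj_onI)
    fix a b assume "a \<in> (UNIV \<times> {..<6} :: (tok input_cell \<times> nat) set)" "b \<in> UNIV \<times> {..<6}" "enc a = enc b"
    then obtain x k y l where eq: "a = (x, k)" "b = (y, l)" "k < 6" "l < 6"
      "6 * cell_index x + k = 6 * cell_index y + l"
      by (cases a; cases b) (auto simp: enc_def)
    then have "cell_index x = cell_index y" by presburger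
    with eq show "a = b" using cell_index_inj by auto
  qed
  then show ?thesis
    unfolding dec_def by (rule inv_into_f_f) (use assms in auto)
qed

text \<open>\<open>Copy\<close> writes the input with both end markers onto all work tapes, with
  marks 0, and \<open>Rew\<close> returns the work heads; the input head then rests on the right end
  marker while \<open>Run\<close> executes continuations.\<close>

datatype ctl = Copy | Rew | Run "com list"

locale compile =
  fixes K :: nat and prog :: com and pts :: "ctl list"
  assumes K_pos: "0 < K"
    and ok: "com_ok K prog"
    and pts0: "pts ! 0 = Copy" and pts_pos: "pts \<noteq> []"
    and set_pts: "set pts = {Copy, Rew} \<union> Run ` insert [] (points prog [])"
begin

text \<open>The list \<open>pts\<close> may contain repetitions, so an index has to be chosen. For
  \<open>Copy\<close> it must be 0, the initial state of every machine.\<close>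

definition num :: "ctl \<Rightarrow> nat" where
  "num c = (if c = Copy then 0 else SOME i. i < length pts \<and> pts ! i = c)"

lemma num:
  assumes "c \<in> set pts"
  shows "num c < length pts \<and> pts ! num c = c"
proof (cases "c = Copy")
  case False
  then have "num c = (SOME i. i < length pts \<and> pts ! i = c)" by (simp add: num_def)
  then show ?thesis
    using assms someI_ex[of "\<lambda>i. i < length pts \<and> pts ! i = c"] by (auto simp: in_set_conv_nth)
qed (use pts0 pts_pos in \<open>auto simp: num_def\<close>)

text \<open>During \<open>Rew\<close> all work heads stand on cells with the same number, so tape 0
  decides for all of them.\<close>

definition go :: "tok input_cell \<Rightarrow> nat list \<Rightarrow> ctl \<Rightarrow> (nat \<times> dir \<times> (nat \<times> dir) list \<times> tok option) option" where
  "go x ys c = (case c of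
     Copy \<Rightarrow> Some (num (if x = RightEnd then Rew else Copy), MoveR,
               map (\<lambda>j. (enc (x, 0), if x = RightEnd then Stay else MoveR)) [0..<K], None)
   | Rew \<Rightarrow> (if fst (dec (ys ! 0)) = LeftEnd
              then Some (num (Run [prog]), Stay, map (\<lambda>j. (ys ! j, Stay)) [0..<K], None)
              else Some (num Rew, Stay, map (\<lambda>j. (ys ! j, MoveL)) [0..<K], None))
   | Run [] \<Rightarrow> None
   | Run (c # k) \<Rightarrow> (let v = (\<lambda>j. dec (ys ! j)) in
       Some (num (Run (succs c k v)), Stay,
         map (\<lambda>j. (enc (fst (v j), marks c v j), dirs c j)) [0..<K], prints c v)))"

definition T :: "tok tm" where
  "T = \<lparr>tm_states = length pts, tm_symbols = 43, tm_tapes = K,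
        tm_trans = (\<lambda>q x ys. go x ys (pts ! q))\<rparr>"

lemma T_sel [simp]:
  "tm_states T = length pts" "tm_symbols T = 43" "tm_tapes T = K"
  "tm_trans T q x ys = go x ys (pts ! q)"
  by (simp_all add: T_def)

lemma pts_closed: "Run (c # k) \<in> set pts \<Longrightarrow> Run (succs c k v) \<in> set pts"
  using points_closed[of c k prog "[]" v] by (auto simp: set_pts)

lemma turing_T: "turing_machine T"
proof -
  have "case go x ys (pts ! q) of
           None \<Rightarrow> True
         | Some (q', d, acts, z) \<Rightarrow>
             q' < length pts \<and> length acts = K \<and> (\<forall>(y, e) \<in> set acts. y < 43)"
    if q: "q < length pts" and ys: "length ys = K" "\<forall>y \<in> set ys. y < 43" for q x ys
  proof (cases "pts ! q")
    case Copy
    moreover have "Rew \<in> set pts" "Copy \<in> set pts" by (auto simp: set_pts)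
    ultimately show ?thesis
      using num[of Rew] num[of Copy] by (auto simp: go_def enc_less)
  next
    case Rew
    moreover have "Rew \<in> set pts" "Run [prog] \<in> set pts" by (auto simp: set_pts points_self)
    ultimately show ?thesis
      using num[of Rew] num[of "Run [prog]"] ys by (auto simp: go_def)
  next
    case (Run l)
    then have "Run l \<in> set pts" using q by (metis nth_mem)
    then show ?thesis
      using Run num[OF pts_closed] by (cases l) (auto simp: go_def Let_def enc_less)
  qed
  then show ?thesis
    using pts_pos unfolding turing_machine_def T_sel by simp
qed

section \<open>Simulation of program runs by the machine\<close>

definition cfg :: "tok list \<Rightarrow> ctl \<Rightarrow> store \<Rightarrow> tok tm_config" where
  "cfg w c s = (case s of (h, m, r) \<Rightarrow>
     \<lparr>cf_state = num c, cf_input = Suc (length w),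
      cf_work = map (\<lambda>j. (\<lambda>p. if p \<le> Suc (length w) then enc (read_input w p, m j p) else 0, h j)) [0..<K],
      cf_output = r\<rparr>)"

definition good :: "tok list \<Rightarrow> store \<Rightarrow> bool" where
  "good w s = (case s of (h, m, r) \<Rightarrow> \<forall>j<K. h j \<le> Suc (length w) \<and> (\<forall>p. m j p < 6))"

definition eff :: "tok list \<Rightarrow> com \<Rightarrow> store \<Rightarrow> store" where
  "eff w c s = (case s of (h, m, r) \<Rightarrow>
     (\<lambda>j. move (dirs c j) (h j), \<lambda>j. (m j)(h j := marks c (view w h m) j),
      r @ out_opt (prints c (view w h m))))"

lemma map2_map_same: "map2 f (map g xs) (map k xs) = map (\<lambda>x. f (g x) (k x)) xs"
  by (induction xs) auto

lemma local_onD: "local_on K t \<Longrightarrow> (\<And>j. j < K \<Longrightarrow> o1 j = o2 j) \<Longrightarrow> t o1 = t o2"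
  unfolding local_on_def by blast

lemma succs_local:
  assumes "com_ok K c" "\<And>j. j < K \<Longrightarrow> o1 j = o2 j"
  shows "succs c k o1 = succs c k o2" "prints c o1 = prints c o2"
    "j < K \<Longrightarrow> marks c o1 j = marks c o2 j"
proof -
  have t: "local_on K f \<Longrightarrow> f o1 = f o2" for f :: "view \<Rightarrow> bool"
    using local_onD assms(2) by blast
  have p: "local_on K f \<Longrightarrow> f o1 = f o2" for f :: "view \<Rightarrow> tok option"
    using local_onD assms(2) by blast
  show "succs c k o1 = succs c k o2" "prints c o1 = prints c o2"
    "j < K \<Longrightarrow> marks c o1 j = marks c o2 j"
    using assms t p by (cases c; auto)+
qed

lemma next_run:
  assumes "Run (c # k) \<in> set pts" "good w (h, m, r)" "com_ok K c"
  shows "tm_next T w (cfg w (Run (c # k)) (h, m, r))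
    = Some (cfg w (Run (succs c k (view w h m))) (eff w c (h, m, r)))"
proof -
  let ?w = "\<lambda>j. (\<lambda>p. if p \<le> Suc (length w) then enc (read_input w p, m j p) else 0, h j)"
  define ys where "ys = map (\<lambda>(t, h). t h) (map ?w [0..<K])"
  have v: "dec (ys ! j) = view w h m j" if "j < K" for j
    using that assms(2) by (simp add: ys_def good_def view_def dec_enc)
  note l = succs_local[OF assms(3), of "\<lambda>j. dec (ys ! j)" "view w h m", OF v, simplified]
  have state: "pts ! num (Run (c # k)) = Run (c # k)" using num[OF assms(1)] by simp
  have "tm_trans T (num (Run (c # k))) (read_input w (Suc (length w))) ys
    = Some (num (Run (succs c k (view w h m))), Stay,
         map (\<lambda>j. (enc (fst (view w h m j), marks c (view w h m) j), dirs c j)) [0..<K],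
         prints c (view w h m))"
    by (simp add: T_def state go_def Let_def l v cong: map_cong)
  then show ?thesis
    using assms(2)
    by (auto simp: tm_next_def cfg_def ys_def map2_map_same eff_def out_opt_def fun_eq_iff view_def
        good_def split: option.split)
qed

text \<open>The visited cells are those of the copied input, \<open>0\<close> to
  \<open>length w + 1\<close>, end markers included.\<close>

definition steps :: "tok list \<Rightarrow> tok tm_config \<Rightarrow> tok tm_config \<Rightarrow> bool" where
  "steps w = (\<lambda>c c'. within_space (length w + 2) c \<and> tm_next T w c = Some c')\<^sup>*\<^sup>*"

lemma good_space: "good w s \<Longrightarrow> within_space (length w + 2) (cfg w c s)"
  by (fastforce simp: good_def within_space_def cfg_def)

lemma step_run:
  assumes "Run (c # k) \<in> set pts" "good w (h, m, r)" "com_ok K c"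
    and "\<And>k'. cfg w k' (eff w c (h, m, r)) = cfg w k' s"
  shows "steps w (cfg w (Run (c # k)) (h, m, r)) (cfg w (Run (succs c k (view w h m))) s)"
  unfolding steps_def
  by (rule r_into_rtranclp) (use next_run[OF assms(1-3)] good_space[OF assms(2)] assms(4) in auto)

lemma steps_trans: "steps w a b \<Longrightarrow> steps w b c \<Longrightarrow> steps w a c"
  unfolding steps_def by (rule rtranclp_trans)

lemma com_ok_pts: "Run (c # k) \<in> set pts \<Longrightarrow> com_ok K c"
  using points_cons[OF _ ok, of "c # k" "[]"] by (auto simp: set_pts)

lemma silent:
  assumes "Run (c # k) \<in> set pts" "good w (h, m, r)" "\<And>v j. dirs c j = Stay \<and> marks c v j = snd (v j) \<and> prints c v = None"
  shows "steps w (cfg w (Run (c # k)) (h, m, r)) (cfg w (Run (succs c k (view w h m))) (h, m, r))"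
  by (rule step_run[OF assms(1,2) com_ok_pts[OF assms(1)]])
    (use assms(3) in \<open>simp add: eff_def out_opt_def view_def\<close>)

lemma points_tail: "a # l \<in> points c k \<Longrightarrow> l \<in> insert k (points c k)"
proof (induction c arbitrary: k)
  case (Sq a b)
  then show ?case using points_self[of b k] points_self[of a "b # k"] by fastforce
next
  case (Loop t a)
  then show ?case using points_self[of a "Loop t a # k"] by fastforce
qed auto

lemma pts_tail: "Run (c # k) \<in> set pts \<Longrightarrow> Run k \<in> set pts"
  using points_tail[of c k prog "[]"] by (auto simp: set_pts)

text \<open>The invariant \<open>good\<close> survives because \<open>Fwd\<close> is enabled only if
  the head is not on the right end marker and \<open>Put\<close> writes marks below 6. The
  continuation \<open>k\<close> is arbitrary, as the induction enters sequences and loop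
  bodies.\<close>

lemma runs_steps:
  "runs w c s s' \<Longrightarrow> Run (c # k) \<in> set pts \<Longrightarrow> good w s \<Longrightarrow>
   steps w (cfg w (Run (c # k)) s) (cfg w (Run k) s') \<and> good w s'"
proof (induction arbitrary: k rule: runs.induct)
  case (Fwd h j m r)
  have "eff w (Fwd j) (h, m, r) = (h(j := Suc (h j)), m, r)"
    by (auto simp: eff_def out_opt_def view_def)
  then show ?case
    using step_run[OF Fwd(2,3) com_ok_pts[OF Fwd(2)], of "(h(j := Suc (h j)), m, r)"] Fwd.prems com_ok_pts[OF Fwd.prems(1)]
    Fwd.hyps by (auto simp: good_def)
next
  case (Bwd j h m r)
  have "eff w (Bwd j) (h, m, r) = (h(j := h j - 1), m, r)"
    by (auto simp: eff_def out_opt_def view_def)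
  then show ?case
    using step_run[OF Bwd(1,2) com_ok_pts[OF Bwd(1)], of "(h(j := h j - 1), m, r)"] Bwd.prems com_ok_pts[OF Bwd.prems(1)]
    by (auto simp: good_def)
next
  case (Put j b h m r)
  have "eff w (Put j b) (h, m, r) = (h, m(j := (m j)(h j := b)), r)"
    by (auto simp: eff_def out_opt_def view_def)
  then show ?case
    using step_run[OF Put(1,2) com_ok_pts[OF Put(1)], of "(h, m(j := (m j)(h j := b)), r)"] Put.prems com_ok_pts[OF Put.prems(1)]
    by (auto simp: good_def)
next
  case (Out f h m r)
  have "eff w (Out f) (h, m, r) = (h, m, r @ out_opt (f (view w h m)))"
    by (auto simp: eff_def out_opt_def view_def)
  then show ?case
    using step_run[OF Out(1,2) com_ok_pts[OF Out(1)], of "(h, m, r @ out_opt (f (view w h m)))"] Out.prems com_ok_pts[OF Out.prems(1)]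
    by (auto simp: good_def)
next
  case (Sq a s s' b s'')
  obtain h m r where s: "s = (h, m, r)" by (cases s)
  have "steps w (cfg w (Run ((a ;; b) # k)) s) (cfg w (Run (a # b # k)) s)"
    using silent[of "a ;; b" k w h m r] Sq.prems by (simp add: s)
  moreover have "Run (a # b # k) \<in> set pts" using pts_closed[OF Sq.prems(1), of undefined] by simp
  moreover have "Run (b # k) \<in> set pts" by (rule pts_tail) fact
  ultimately show ?case using Sq.IH Sq.prems(2) steps_trans by blast
next
  case (CondT t h m a r s' b)
  then show ?case
    using silent[of "Cond t a b" k w h m r] pts_closed[OF CondT.prems(1), of "view w h m"]
    by (auto intro: steps_trans)
next
  case (CondF t h m b r s' a)
  then show ?case
    using silent[of "Cond t a b" k w h m r] pts_closed[OF CondF.prems(1), of "view w h m"]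
    by (auto intro: steps_trans)
next
  case (LoopT t h m a r s' s'')
  have "Run (a # Loop t a # k) \<in> set pts"
    using pts_closed[OF LoopT.prems(1), of "view w h m"] LoopT.hyps(1) by simp
  then show ?case
    using silent[of "Loop t a" k w h m r] LoopT
    by simp (blast intro: steps_trans)
next
  case (LoopF t h m a r)
  then show ?case
    using silent[of "Loop t a" k w h m r] by auto
qed

lemma steps_step:
  assumes "steps w x (cfg0 :: tok tm_config)" "within_space (length w + 2) cfg0" "tm_next T w cfg0 = Some y"
  shows "steps w x y"
  using assms unfolding steps_def by (auto intro: rtranclp.rtrancl_into_rtrancl)

definition copied :: "tok list \<Rightarrow> nat \<Rightarrow> tok tm_config" where
  "copied w i = \<lparr>cf_state = num Copy, cf_input = i,
     cf_work = map (\<lambda>j. (\<lambda>p. if p < i then enc (read_input w p, 0) else 0, i)) [0..<K], cf_output = []\<rparr>"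

lemma state_num: "c \<in> set pts \<Longrightarrow> pts ! num c = c"
  using num by blast

lemma copy_steps: "i \<le> Suc (length w) \<Longrightarrow> steps w (init_config T) (copied w i)"
proof (induction i)
  case 0
  have "init_config T = copied w 0"
    by (auto simp: init_config_def copied_def T_def num_def intro!: nth_equalityI)
  then show ?case by (simp add: steps_def)
next
  case (Suc i)
  have sp: "within_space (length w + 2) (copied w i)"
    using Suc.prems by (auto simp: within_space_def copied_def)
  have "read_input w i \<noteq> RightEnd"
    using Suc.prems by (auto simp: read_input_def)
  moreover have "pts ! num Copy = Copy" by (rule state_num) (simp add: set_pts)
  ultimately have "tm_next T w (copied w i) = Some (copied w (Suc i))"
    using Suc.prems
    by (auto simp: tm_next_def copied_def T_def go_def map2_map_same fun_eq_iff)
  with Suc sp show ?case using steps_step by simp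
qed

lemma rew_steps:
  "i \<le> Suc (length w) \<Longrightarrow>
   steps w (init_config T) (cfg w Rew (\<lambda>_. Suc (length w) - i, \<lambda>_ _. 0, []))"
proof (induction i)
  case 0
  have r: "read_input w (Suc (length w)) = RightEnd" by (simp add: read_input_def)
  have c: "pts ! num Copy = Copy" by (rule state_num) (simp add: set_pts)
  have "tm_next T w (copied w (Suc (length w))) = Some (cfg w Rew (\<lambda>_. Suc (length w), \<lambda>_ _. 0, []))"
    by (auto simp: tm_next_def copied_def T_def go_def map2_map_same fun_eq_iff r c cfg_def)
  then show ?case
    using steps_step[OF copy_steps[of "Suc (length w)" w]]
    by (simp add: within_space_def copied_def)
next
  case (Suc i)
  let ?h = "Suc (length w) - i"
  have sp: "within_space (length w + 2) (cfg w Rew (\<lambda>_. ?h, \<lambda>_ _. 0, []))"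
    by (rule good_space) (auto simp: good_def)
  have c: "pts ! num Rew = Rew" by (rule state_num) (simp add: set_pts)
  have "read_input w ?h \<noteq> LeftEnd"
    using Suc.prems by (auto simp: read_input_def)
  then have "tm_next T w (cfg w Rew (\<lambda>_. ?h, \<lambda>_ _. 0, []))
      = Some (cfg w Rew (\<lambda>_. Suc (length w) - Suc i, \<lambda>_ _. 0, []))"
    using K_pos
    by (auto simp: tm_next_def T_def go_def map2_map_same fun_eq_iff cfg_def c dec_enc)
  with Suc sp show ?case using steps_step by simp
qed

lemma run_steps: "steps w (init_config T) (cfg w (Run [prog]) (\<lambda>_. 0, \<lambda>_ _. 0, []))"
proof -
  have sp: "within_space (length w + 2) (cfg w Rew (\<lambda>_. 0, \<lambda>_ _. 0, []))"
    by (rule good_space) (auto simp: good_def)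
  have c: "pts ! num Rew = Rew" by (rule state_num) (simp add: set_pts)
  have "tm_next T w (cfg w Rew (\<lambda>_. 0, \<lambda>_ _. 0, []))
      = Some (cfg w (Run [prog]) (\<lambda>_. 0, \<lambda>_ _. 0, []))"
    using K_pos
    by (auto simp: tm_next_def T_def go_def map2_map_same fun_eq_iff cfg_def c dec_enc read_input_def)
  then show ?thesis using steps_step[OF _ sp] rew_steps[of "Suc (length w)" w] by simp
qed

lemma computes:
  assumes "runs w prog (\<lambda>_. 0, \<lambda>_ _. 0, []) (h, m, r)"
  shows "tm_computes_in_space T w r (length w + 2)"
proof -
  let ?s = "(\<lambda>_. 0, \<lambda>_ _. 0, []) :: store"
  have "Run [prog] \<in> set pts" by (simp add: set_pts points_self)
  moreover have "good w ?s" by (simp add: good_def)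
  ultimately have *: "steps w (cfg w (Run [prog]) ?s) (cfg w (Run []) (h, m, r))" "good w (h, m, r)"
    using runs_steps[OF assms] by blast+
  have "pts ! num (Run []) = Run []" by (rule state_num) (simp add: set_pts)
  then have "tm_next T w (cfg w (Run []) (h, m, r)) = None"
    by (simp add: tm_next_def cfg_def T_def go_def)
  then show ?thesis
    using steps_trans[OF run_steps *(1)] good_space[OF *(2)]
    unfolding tm_computes_in_space_def steps_def
    by (intro exI[of _ "cfg w (Run []) (h, m, r)"]) (auto simp: cfg_def)
qed

end

theorem program_to_tm:
  assumes "0 < K" "com_ok K prog"
  shows "\<exists>T. turing_machine T \<and>
    (\<forall>w h m r. runs w prog (\<lambda>_. 0, \<lambda>_ _. 0, []) (h, m, r) \<longrightarrow>
       tm_computes_in_space T w r (length w + 2))"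
proof -
  obtain xs where "set xs = insert Rew (Run ` insert [] (points prog []))"
    using finite_list finite_points by (metis finite_imageI finite_insert)
  then interpret compile K prog "Copy # xs"
    by unfold_locales (use assms in auto)
  show ?thesis using turing_T computes by blast
qed

text \<open>The machine is deterministic and a halting configuration has no successor. Hence a
  function defined by choosing an output agrees with the output of any known run.\<close>

lemma computes_unique:
  assumes "tm_computes_in_space T w y m" "tm_computes_in_space T w z m"
  shows "y = z"
proof -
  define R where "R = (\<lambda>c c'. within_space m c \<and> tm_next T w c = Some c')"
  have det: "R\<^sup>*\<^sup>* c d" if "R\<^sup>*\<^sup>* a c" "R\<^sup>*\<^sup>* a d" "tm_next T w d = None" for a c d
    using that
  proof (induction rule: rtranclp_induct)
    case (step c c')
    then have "R\<^sup>*\<^sup>* c d" by blast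
    then show ?case
      by (cases rule: converse_rtranclpE) (use step in \<open>auto simp: R_def\<close>)
  qed
  obtain c d where c: "R\<^sup>*\<^sup>* (init_config T) c" "tm_next T w c = None" "cf_output c = y"
    and d: "R\<^sup>*\<^sup>* (init_config T) d" "tm_next T w d = None" "cf_output d = z"
    using assms unfolding tm_computes_in_space_def R_def by blast
  from det[OF c(1) d(1,2)] have "c = d"
    by (cases rule: converse_rtranclpE) (use c in \<open>auto simp: R_def\<close>)
  then show ?thesis using c d by simp
qed

section \<open>Pointer programs on the input\<close>

lemma runs_iff:
  "runs w (Fwd j) (h, m, r) s \<longleftrightarrow> h j \<le> length w \<and> s = (h(j := Suc (h j)), m, r)"
  "runs w (Bwd j) (h, m, r) s \<longleftrightarrow> s = (h(j := h j - 1), m, r)"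
  "runs w (Put j x) (h, m, r) s \<longleftrightarrow> s = (h, m(j := (m j)(h j := x)), r)"
  "runs w (Out f) (h, m, r) s \<longleftrightarrow> s = (h, m, r @ out_opt (f (view w h m)))"
  "runs w (a ;; b) s0 s \<longleftrightarrow> (\<exists>s'. runs w a s0 s' \<and> runs w b s' s)"
  "runs w (Cond t a b) (h, m, r) s \<longleftrightarrow> runs w (if t (view w h m) then a else b) (h, m, r) s"
  by (subst runs.simps; auto)+

declare fun_upd_apply [simp del] fun_upd_same [simp] fun_upd_other [simp]

lemma loop_iff:
  "runs w (Loop t a) (h, m, r) s \<longleftrightarrow>
     (if t (view w h m) then runs w (a ;; Loop t a) (h, m, r) s else s = (h, m, r))"
  by (subst runs.simps) (auto simp: runs_iff(5))

lemma out_opt_simps [simp]: "out_opt None = []" "out_opt (Some t) = [t]"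
  by (simp_all add: out_opt_def)

text \<open>Tape 0 scans the transition table of the alternating automaton, tape 1 points to a letter,
  the marks of tapes 2 to 5 are bit vectors that represent sets of states, tape 6 is a stack, and the
  marks in cell 0 of tapes 7 to 11 are flags.\<close>

fun is_bit :: "tok input_cell \<Rightarrow> bool" where
  "is_bit (Cell (Bit b)) = True"
| "is_bit _ = False"

abbreviation "skip \<equiv> Out (\<lambda>_. None)"
abbreviation "say t \<equiv> Out (\<lambda>_. Some t)"

fun says :: "tok list \<Rightarrow> com" where
  "says [] = skip"
| "says (t # ts) = say t ;; says ts"

definition "rewind j = Loop (\<lambda>v. fst (v j) \<noteq> LeftEnd) (Bwd j)"
definition "seek j t = Loop (\<lambda>v. fst (v j) \<noteq> Cell t) (Fwd j)"
text \<open>Returns to the first digit of a number from any of its digits or from its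
  \<open>Stop\<close>, provided that the token before the number is not a digit.\<close>

definition "back j = Bwd j ;; Loop (\<lambda>v. is_bit (fst (v j))) (Bwd j) ;; Fwd j"
definition "next_num j = seek j Stop ;; Fwd j"
definition "echo j = Out (\<lambda>v. case fst (v j) of Cell t \<Rightarrow> Some t | _ \<Rightarrow> None)"
definition "copy_until j t = Loop (\<lambda>v. fst (v j) \<noteq> Cell t) (echo j ;; Fwd j) ;; say t"

definition "compare i j =
  Loop (\<lambda>v. is_bit (fst (v i)) \<and> fst (v i) = fst (v j)) (Fwd i ;; Fwd j) ;;
  Cond (\<lambda>v. fst (v i) = fst (v j)) (Put 9 1) (Put 9 0) ;; back i ;; back j"

definition "goto_states j = Fwd j ;; seek j Close ;; Fwd j ;; Fwd j"

definition "member i j = goto_states j ;;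
  Loop (\<lambda>v. fst (v j) \<noteq> Cell Close)
    (Cond (\<lambda>v. snd (v j) = 1) (compare i j ;; Cond (\<lambda>v. snd (v 9) = 1) (Put 9 0 ;; Put 8 1) skip) skip ;;
     next_num j) ;;
  rewind j"

text \<open>The printed set is a value of \<open>cnt\<close>: the initial \<open>Stop\<close> codes
  the dummy element 0.\<close>

definition "print_set P j = says [Open, Stop] ;; goto_states j ;;
  Loop (\<lambda>v. fst (v j) \<noteq> Cell Close)
    (Cond (\<lambda>v. P (snd (v j))) (say (Bit True) ;; copy_until j Stop ;; Fwd j) (next_num j)) ;;
  say Close ;; rewind j"

text \<open>Prints a control state as the number with lowest digit \<open>b\<close>, then the bits
  of the vector, then a highest digit one. That last digit makes the code canonical and preserves
  the length of the vector; such numbers are at least 2, so 0 and 1 remain for \<open>idl\<close>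
  and \<open>st\<close>.\<close>

definition "print_state b j = say (Bit b) ;; Fwd j ;;
  Loop (\<lambda>v. fst (v j) \<noteq> RightEnd) (Out (\<lambda>v. Some (Bit (snd (v j) = 1))) ;; Fwd j) ;;
  says [Bit True, Stop] ;; rewind j"

text \<open>The marks of tape \<open>j\<close> form a binary counter with lowest bit in cell 1. A
  carry that reaches the right end marker is an overflow and ends the enumeration.\<close>

definition "for_vec j body = Put j 1 ;;
  Loop (\<lambda>v. snd (v j) = 1)
    (body ;; Fwd j ;; Loop (\<lambda>v. snd (v j) = 1) (Put j 0 ;; Fwd j) ;;
     Cond (\<lambda>v. fst (v j) = RightEnd) (rewind j ;; Put j 0) (Put j 1 ;; rewind j))"

section \<open>Reading, copying and comparing numbers on the tapes\<close>

fun here :: "tok list \<Rightarrow> nat \<Rightarrow> tok list \<Rightarrow> bool" where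
  "here w p [] = True"
| "here w p (t # ts) = (read_input w p = Cell t \<and> here w (Suc p) ts)"

lemma here_append [simp]: "here w p (xs @ ys) \<longleftrightarrow> here w p xs \<and> here w (p + length xs) ys"
  by (induction xs arbitrary: p) auto

lemma here_self: "here (us @ w) (Suc (length us)) w"
proof (induction w arbitrary: us)
  case (Cons t w)
  show ?case using Cons[of "us @ [t]"] by (simp add: read_input_def)
qed simp

lemma read_LeftEnd [simp]: "read_input w p = LeftEnd \<longleftrightarrow> p = 0"
  by (simp add: read_input_def)

lemma read_RightEnd [simp]: "read_input w p = RightEnd \<longleftrightarrow> length w < p"
  by (auto simp: read_input_def)

lemma read_Cell_le: "read_input w p = Cell t \<Longrightarrow> 0 < p \<and> p \<le> length w"
  by (auto simp: read_input_def split: if_splits)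

lemma runs_says: "runs w (says ts) (h, m, r) (h, m, r @ ts)"
proof (induction ts arbitrary: r)
  case (Cons t ts)
  show ?case using Cons[of "r @ [t]"] by (simp add: runs_iff)
qed (simp add: runs_iff)

lemma runs_rewind: "runs w (rewind j) (h, m, r) (h(j := 0), m, r)"
proof (induction "h j" arbitrary: h)
  case 0
  then show ?case unfolding rewind_def by (subst loop_iff) (simp add: view_def fun_upd_idem)
next
  case (Suc x)
  show ?case
    using Suc(1)[of "h(j := x)"] Suc(2)[symmetric] unfolding rewind_def
    by (subst loop_iff) (simp add: view_def runs_iff)
qed

lemma runs_seek:
  assumes "here w (h j) xs" "t \<notin> set xs" "read_input w (h j + length xs) = Cell t"
  shows "runs w (seek j t) (h, m, r) (h(j := h j + length xs), m, r)"
  using assms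
proof (induction xs arbitrary: h)
  case Nil
  then show ?case unfolding seek_def by (subst loop_iff) (simp add: view_def)
next
  case (Cons x xs)
  show ?case
    using Cons(1)[of "h(j := Suc (h j))"] Cons(2-) read_Cell_le[of w "h j"] unfolding seek_def
    by (subst loop_iff) (auto simp: view_def runs_iff)
qed

lemma nat_bits_Bit: "\<exists>bs. nat_bits n = map Bit bs"
proof (induction n rule: nat_bits.induct)
  case (1 n)
  show ?case
  proof (cases "n = 0")
    case False
    with 1 obtain bs where "nat_bits (n div 2) = map Bit bs" by blast
    then have "nat_bits n = map Bit (odd n # bs)" using False by (subst nat_bits.simps) simp
    then show ?thesis by blast
  qed (simp add: nat_bits.simps)
qed

lemma code_nat_props: "Open \<notin> set (nat_bits n)" "Close \<notin> set (nat_bits n)" "Stop \<notin> set (nat_bits n)"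
  using nat_bits_Bit[of n] by auto

lemma nat_bits_inj: "nat_bits a = nat_bits b \<Longrightarrow> a = b"
proof (induction a arbitrary: b rule: nat_bits.induct)
  case (1 a)
  show ?case
  proof (cases "a = 0 \<or> b = 0")
    case True
    then show ?thesis using 1(2) by (metis list.distinct(1) nat_bits.simps)
  next
    case False
    have ab: "nat_bits a = Bit (odd a) # nat_bits (a div 2)" "nat_bits b = Bit (odd b) # nat_bits (b div 2)"
      using False nat_bits.simps by auto
    then have *: "odd a = odd b" "nat_bits (a div 2) = nat_bits (b div 2)" using 1(2) by auto
    with 1(1) False have "a div 2 = b div 2" by blast
    with *(1) show ?thesis by (metis bit_eq_rec)
  qed
qed

lemma runs_next_num:
  assumes "here w (h j) (code_nat a)"
  shows "runs w (next_num j) (h, m, r) (h(j := h j + length (code_nat a)), m, r)"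
proof -
  have "runs w (seek j Stop) (h, m, r) (h(j := h j + length (nat_bits a)), m, r)"
    using assms code_nat_props by (intro runs_seek) (auto simp: code_nat_def)
  then show ?thesis
    using assms unfolding next_num_def
    by (fastforce simp: runs_iff code_nat_def dest: read_Cell_le)
qed

lemma runs_back:
  assumes "\<forall>k<i. is_bit (read_input w (p + k))" "\<not> is_bit (read_input w (p - 1))" "0 < p"
    "h j = p + i" "p \<le> length w"
  shows "runs w (back j) (h, m, r) (h(j := p), m, r)"
proof -
  have "runs w (Loop (\<lambda>v. is_bit (fst (v j))) (Bwd j)) (h(j := p + i - 1), m, r) (h(j := p - 1), m, r)"
    using assms(1)
  proof (induction i)
    case 0
    then show ?case using assms(2) by (subst loop_iff) (simp add: view_def)
  next
    case (Suc i)
    then show ?case using assms(3) by (subst loop_iff) (simp add: view_def runs_iff)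
  qed
  then show ?thesis unfolding back_def using assms(3-) by (auto simp: runs_iff)
qed

lemma runs_copy_until:
  assumes "here w (h j) xs" "t \<notin> set xs" "read_input w (h j + length xs) = Cell t"
  shows "runs w (copy_until j t) (h, m, r) (h(j := h j + length xs), m, r @ xs @ [t])"
proof -
  have "runs w (Loop (\<lambda>v. fst (v j) \<noteq> Cell t) (echo j ;; Fwd j)) (h, m, r) (h(j := h j + length xs), m, r @ xs)"
    using assms
  proof (induction xs arbitrary: h r)
    case Nil
    then show ?case by (subst loop_iff) (simp add: view_def)
  next
    case (Cons x xs)
    show ?case
      using Cons(1)[of "h(j := Suc (h j))" "r @ [x]"] Cons(2-) read_Cell_le[of w "h j"]
      by (subst loop_iff) (auto simp: view_def runs_iff echo_def)
  qed
  then show ?thesis unfolding copy_until_def by (auto simp: runs_iff)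
qed

text \<open>The condition on the preceding token is what makes \<open>back\<close> stop at
  \<open>p\<close>.\<close>

definition num_at :: "tok list \<Rightarrow> nat \<Rightarrow> nat \<Rightarrow> bool" where
  "num_at w p a \<longleftrightarrow> here w p (code_nat a) \<and> \<not> is_bit (read_input w (p - 1))"

lemma num_at_pos:
  assumes "num_at w p a" shows "0 < p \<and> p \<le> length w"
proof -
  obtain t where "read_input w p = Cell t"
    using assms unfolding num_at_def code_nat_def by (cases "nat_bits a") auto
  then show ?thesis by (rule read_Cell_le)
qed

lemma here_bit: "here w p (map Bit bs) \<Longrightarrow> k < length bs \<Longrightarrow> is_bit (read_input w (p + k))"
proof (induction bs arbitrary: p k)
  case (Cons b bs)
  then have "read_input w p = Cell (Bit b)" "here w (Suc p) (map Bit bs)" by simp_all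
  with Cons.IH[of "Suc p" "k - 1"] Cons.prems(2) show ?case by (cases k) simp_all
qed simp

text \<open>The loop stops at the first pair of tokens that are not equal digits. As both numbers
  end with \<open>Stop\<close>, these tokens coincide only if both are \<open>Stop\<close>, that is,
  if all digits agreed.\<close>

lemma runs_compare_loop:
  assumes "here w p (map Bit xs @ [Stop])" "here w q (map Bit ys @ [Stop])" "i \<noteq> j"
  shows "\<exists>k. runs w (Loop (\<lambda>v. is_bit (fst (v i)) \<and> fst (v i) = fst (v j)) (Fwd i ;; Fwd j))
        (h(i := p, j := q), m, r) (h(i := p + k, j := q + k), m, r) \<and>
      k \<le> length xs \<and> k \<le> length ys \<and>
      (read_input w (p + k) = read_input w (q + k) \<longleftrightarrow> xs = ys)"
  using assms(1,2)
proof (induction xs arbitrary: ys p q)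
  case Nil
  then show ?case
    using assms(3) by (intro exI[of _ 0], subst loop_iff) (cases ys; auto simp: view_def)
next
  case (Cons x xs)
  show ?case
  proof (cases "\<exists>ys'. ys = x # ys'")
    case True
    then obtain ys' where ys: "ys = x # ys'" by blast
    have rd: "read_input w p = Cell (Bit x)" "read_input w q = Cell (Bit x)"
      using Cons.prems(1,2) ys by auto
    obtain k where k: "runs w (Loop (\<lambda>v. is_bit (fst (v i)) \<and> fst (v i) = fst (v j)) (Fwd i ;; Fwd j))
        (h(i := Suc p, j := Suc q), m, r) (h(i := Suc p + k, j := Suc q + k), m, r)" "k \<le> length xs" "k \<le> length ys'"
      "read_input w (Suc p + k) = read_input w (Suc q + k) \<longleftrightarrow> xs = ys'"
      using Cons.IH[of "Suc p" "Suc q" ys'] Cons.prems ys by auto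
    have "h(i := p, j := q, i := Suc p, j := Suc q) = h(i := Suc p, j := Suc q)"
      using assms(3) by (auto simp: fun_eq_iff fun_upd_apply)
    then have "runs w (Loop (\<lambda>v. is_bit (fst (v i)) \<and> fst (v i) = fst (v j)) (Fwd i ;; Fwd j))
        (h(i := p, j := q), m, r) (h(i := p + Suc k, j := q + Suc k), m, r)"
      using rd k(1) assms(3) read_Cell_le[OF rd(1)] read_Cell_le[OF rd(2)]
      by (subst loop_iff) (simp add: view_def runs_iff)
    then show ?thesis
      using k(2-4) ys by (intro exI[of _ "Suc k"]) simp
  next
    case False
    then have "\<not> (is_bit (read_input w p) \<and> read_input w p = read_input w q)"
      using Cons.prems by (cases ys) auto
    then show ?thesis
      using Cons.prems False assms(3)
      by (intro exI[of _ 0], subst loop_iff) (cases ys; auto simp: view_def)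
  qed
qed

lemma runs_compare:
  assumes a: "num_at w (h i) a" and b: "num_at w (h j) b" and ij: "i \<noteq> j" "i \<noteq> 9" "j \<noteq> 9" and 9: "h 9 = 0"
  shows "runs w (compare i j) (h, m, r) (h, m(9 := (m 9)(0 := of_bool (a = b))), r)"
proof -
  obtain xs where xs: "nat_bits a = map Bit xs" using nat_bits_Bit by blast
  obtain ys where ys: "nat_bits b = map Bit ys" using nat_bits_Bit by blast
  have eq: "xs = ys \<longleftrightarrow> a = b"
  proof -
    have "xs = ys \<longleftrightarrow> map Bit xs = map Bit ys" by (simp add: inj_map_eq_map inj_def)
    then show ?thesis using xs ys nat_bits_inj by auto
  qed
  have ha: "here w (h i) (map Bit xs @ [Stop])" using a xs by (simp add: num_at_def code_nat_def)
  have hb: "here w (h j) (map Bit ys @ [Stop])" using b ys by (simp add: num_at_def code_nat_def)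
  from runs_compare_loop[OF ha hb ij(1), of h m r] obtain k where
    k: "runs w (Loop (\<lambda>v. is_bit (fst (v i)) \<and> fst (v i) = fst (v j)) (Fwd i ;; Fwd j))
        (h, m, r) (h(i := h i + k, j := h j + k), m, r)" "k \<le> length xs" "k \<le> length ys"
      "read_input w (h i + k) = read_input w (h j + k) \<longleftrightarrow> xs = ys"
    by auto
  let ?m = "m(9 := (m 9)(0 := of_bool (a = b)))"
  have bi: "runs w (back i) (h(i := h i + k, j := h j + k), ?m, r)
     ((h(i := h i + k, j := h j + k))(i := h i), ?m, r)"
    by (rule runs_back[of k]) (use k ha a ij here_bit[of w "h i" xs] num_at_pos[OF a] in \<open>auto simp: num_at_def\<close>)
  have bj: "runs w (back j) ((h(i := h i + k, j := h j + k))(i := h i), ?m, r)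
     ((h(i := h i + k, j := h j + k))(i := h i, j := h j), ?m, r)"
    by (rule runs_back[of k]) (use k hb b ij here_bit[of w "h j" ys] num_at_pos[OF b] in \<open>auto simp: num_at_def\<close>)
  have restored: "(h(i := h i + k, j := h j + k))(i := h i, j := h j) = h"
    using ij by (auto simp: fun_eq_iff fun_upd_apply)
  have flag: "runs w (Cond (\<lambda>v. fst (v i) = fst (v j)) (Put 9 1) (Put 9 0))
      (h(i := h i + k, j := h j + k), m, r) (h(i := h i + k, j := h j + k), ?m, r)"
    using k(4) eq ij 9 by (auto simp: runs_iff view_def)
  show ?thesis
    unfolding compare_def
    by (rule runs.Sq[OF k(1) runs.Sq[OF flag runs.Sq[OF bi bj[unfolded restored]]]])
qed

lemma runs_print_state:
  assumes "h j = 0"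
  shows "runs w (print_state b j) (h, m, r)
    (h, m, r @ Bit b # map (\<lambda>p. Bit (m j p = 1)) [1..<Suc (length w)] @ [Bit True, Stop])"
proof -
  have "runs w (Loop (\<lambda>v. fst (v j) \<noteq> RightEnd) (Out (\<lambda>v. Some (Bit (snd (v j) = 1))) ;; Fwd j))
    (h(j := p), m, r) (h(j := Suc (length w)), m, r @ map (\<lambda>p. Bit (m j p = 1)) [p..<Suc (length w)])"
    if "p \<le> Suc (length w)" for p r
    using that
  proof (induction "Suc (length w) - p" arbitrary: p r)
    case 0
    then show ?case by (subst loop_iff) (simp add: view_def)
  next
    case (Suc x)
    then have "p \<le> length w" by simp
    then show ?case
      using Suc(1)[of "Suc p" "r @ [Bit (m j p = 1)]"] Suc(2) upt_conv_Cons[of p "Suc (length w)"]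
      by (subst loop_iff) (simp add: view_def runs_iff del: upt_Suc)
  qed
  note loop = this[of 1 "r @ [Bit b]"]
  let ?r = "r @ Bit b # map (\<lambda>p. Bit (m j p = 1)) [1..<Suc (length w)]"
  have "runs w (rewind j) (h(j := Suc (length w)), m, ?r @ [Bit True, Stop]) (h, m, ?r @ [Bit True, Stop])"
    using runs_rewind[of w j "h(j := Suc (length w))" m] assms by (simp add: fun_upd_idem)
  moreover have "runs w (says [Bit True, Stop]) (h(j := Suc (length w)), m, ?r)
      (h(j := Suc (length w)), m, ?r @ [Bit True, Stop])"
    by (rule runs_says)
  ultimately have "runs w (print_state b j) (h, m, r) (h, m, ?r @ [Bit True, Stop])"
    using loop assms unfolding print_state_def
    by (intro runs.Sq) (auto simp: runs_iff(1-4) simp del: upt_Suc says.simps)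
  then show ?thesis by simp
qed

section \<open>Enumeration of all bit vectors by binary counting\<close>

text \<open>Bit \<open>i\<close> of a vector is the mark of cell \<open>Suc i\<close>; the mark of cell \<open>0\<close> is set while the
  enumeration of all vectors is in progress.\<close>

definition vm :: "bool list \<Rightarrow> nat \<Rightarrow> nat" where
  "vm v p = (case p of 0 \<Rightarrow> 1 | Suc i \<Rightarrow> of_bool (i < length v \<and> v ! i))"

fun carry :: "bool list \<Rightarrow> bool list" where
  "carry [] = []"
| "carry (True # v) = False # carry v"
| "carry (False # v) = True # v"

fun vecs :: "nat \<Rightarrow> bool list list" where
  "vecs 0 = [[]]"
| "vecs (Suc n) = concat (map (\<lambda>v. [False # v, True # v]) (vecs n))"

fun chain :: "bool list list \<Rightarrow> bool" where
  "chain [] = False"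
| "chain [v] = list_all id v"
| "chain (v # v' # L) = (\<not> list_all id v \<and> carry v = v' \<and> chain (v' # L))"

lemma set_vecs: "set (vecs n) = {v. length v = n}"
proof (induction n)
  case (Suc n)
  have "v \<in> set (vecs (Suc n)) \<longleftrightarrow> length v = Suc n" for v
    using Suc by (cases v) (auto split: if_splits)
  then show ?case by blast
qed simp

text \<open>From \<open>False # v\<close> to \<open>True # v\<close> only the lowest bit changes;
  from \<open>True # v\<close> the carry passes on to \<open>v\<close>, where the given chain
  continues.\<close>

lemma chain_double: "chain L \<Longrightarrow> chain (concat (map (\<lambda>v. [False # v, True # v]) L))"
  by (induction L rule: chain.induct) auto

lemma chain_vecs: "chain (vecs n) \<and> vecs n \<noteq> [] \<and> hd (vecs n) = replicate n False"
proof (induction n)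
  case (Suc n)
  then show ?case using chain_double[of "vecs n"] by (cases "vecs n") auto
qed simp

lemma vm_upd: "(vm (us @ x # vs))(Suc (length us) := of_bool y) = vm (us @ y # vs)"
proof
  fix p show "((vm (us @ x # vs))(Suc (length us) := of_bool y)) p = vm (us @ y # vs) p"
    by (cases p) (auto simp: vm_def fun_upd_apply nth_append nth_Cons split: nat.splits)
qed

lemma vm_upd0: "(vm (us @ x # vs))(Suc (length us) := 0) = vm (us @ False # vs)"
  and vm_upd1: "(vm (us @ x # vs))(Suc (length us) := Suc 0) = vm (us @ True # vs)"
  using vm_upd[of us x vs False] vm_upd[of us x vs True] by simp_all

lemma vm_at: "vm (us @ vs) (Suc (length us)) = of_bool (vs \<noteq> [] \<and> hd vs)"
  by (cases vs) (auto simp: vm_def)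

text \<open>\<open>us\<close> is the part already passed. The loop stops at the right end marker at
  the latest, because \<open>vm\<close> is 0 beyond the vector.\<close>

lemma carry_loop:
  "length us + length vs = length w \<Longrightarrow>
   runs w (Loop (\<lambda>x. snd (x j) = 1) (Put j 0 ;; Fwd j))
     (h(j := Suc (length us)), m(j := vm (us @ vs)), r)
     (h(j := Suc (length us + length (takeWhile (\<lambda>b. b) vs))),
      m(j := vm (us @ replicate (length (takeWhile (\<lambda>b. b) vs)) False @ drop (length (takeWhile (\<lambda>b. b) vs)) vs)), r)"
proof (induction vs arbitrary: us)
  case Nil
  then show ?case by (subst loop_iff) (simp add: view_def vm_def)
next
  case (Cons b vs)
  show ?case
  proof (cases b)
    case False
    then show ?thesis by (subst loop_iff) (simp add: view_def vm_at)
  next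
    case True
    then show ?thesis using Cons.prems Cons.IH[of "us @ [False]"]
      by (subst loop_iff) (simp add: view_def vm_at runs_iff vm_upd0)
  qed
qed

lemma carry_decomp:
  "\<not> list_all id v \<Longrightarrow> \<exists>vs. drop (length (takeWhile (\<lambda>b. b) v)) v = False # vs \<and>
     carry v = replicate (length (takeWhile (\<lambda>b. b) v)) False @ True # vs"
  by (induction v rule: carry.induct) auto

lemma vm_False: "(vm (replicate n False))(0 := 0) = (\<lambda>_. 0)"
proof
  fix p show "((vm (replicate n False))(0 := 0)) p = 0"
    by (cases p) (auto simp: vm_def fun_upd_apply)
qed

text \<open>On overflow cell 0 is cleared too. All marks of the tape are then 0 again, so the
  enumeration can be restarted inside an outer one.\<close>

lemma runs_carry:
  assumes h: "h j = 0" and v: "length v = length w"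
  shows "runs w (Fwd j ;; Loop (\<lambda>v. snd (v j) = 1) (Put j 0 ;; Fwd j) ;;
     Cond (\<lambda>v. fst (v j) = RightEnd) (rewind j ;; Put j 0) (Put j 1 ;; rewind j))
     (h, m(j := vm v), r) (h, m(j := (if list_all id v then (\<lambda>_. 0) else vm (carry v))), r)"
proof -
  let ?t = "length (takeWhile (\<lambda>b. b) v)"
  let ?m = "m(j := vm (replicate ?t False @ drop ?t v))"
  have 1: "runs w (Fwd j) (h, m(j := vm v), r) (h(j := Suc 0), m(j := vm v), r)"
    using h by (simp add: runs_iff)
  have 2: "runs w (Loop (\<lambda>x. snd (x j) = 1) (Put j 0 ;; Fwd j)) (h(j := Suc 0), m(j := vm v), r)
     (h(j := Suc ?t), ?m, r)"
    using carry_loop[of "[]" v w j h m r] v by simp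
  have rew: "runs w (rewind j) (h(j := Suc ?t), m', r) (h, m', r)" for m'
    using runs_rewind[of w j "h(j := Suc ?t)" m' r] h by (simp add: fun_upd_idem)
  have 3: "runs w (Cond (\<lambda>v. fst (v j) = RightEnd) (rewind j ;; Put j 0) (Put j 1 ;; rewind j))
     (h(j := Suc ?t), ?m, r) (h, m(j := (if list_all id v then (\<lambda>_. 0) else vm (carry v))), r)"
  proof (cases "list_all id v")
    case True
    then have t: "takeWhile (\<lambda>b. b) v = v" by (auto simp: takeWhile_eq_all_conv list_all_iff)
    have "runs w (rewind j ;; Put j 0) (h(j := Suc ?t), ?m, r) (h, m(j := (\<lambda>_. 0)), r)"
      using h by (intro runs.Sq[OF rew]) (simp add: runs_iff t vm_False)
    moreover have "length w < Suc ?t" unfolding t v by simp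
    ultimately show ?thesis using True by (simp add: runs_iff(6) view_def)
  next
    case False
    from carry_decomp[OF this] obtain vs where vs: "drop ?t v = False # vs"
      "carry v = replicate ?t False @ True # vs" by blast
    have upd: "(vm (replicate ?t False @ False # vs))(Suc ?t := Suc 0) = vm (carry v)"
      using vm_upd1[of "replicate ?t False" False vs] vs(2) by simp
    have "?t < length v" using vs(1) by (metis drop_eq_Nil list.distinct(1) not_le)
    moreover have "runs w (Put j 1 ;; rewind j) (h(j := Suc ?t), ?m, r) (h, m(j := vm (carry v)), r)"
      using rew[of "m(j := vm (carry v))"]
      by (intro runs.Sq) (simp_all add: runs_iff vs(1) upd)
    ultimately show ?thesis using False v by (simp add: runs_iff(6) view_def)
  qed
  show ?thesis by (rule runs.Sq[OF 1 runs.Sq[OF 2 3]])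
qed

lemma runs_for_vec:
  assumes h: "h j = 0" and m: "m j = (\<lambda>_. 0)"
    and body: "\<And>v r. length v = length w \<Longrightarrow> runs w body (h, m(j := vm v), r) (h, m(j := vm v), r @ g v)"
  shows "runs w (for_vec j body) (h, m, r) (h, m, r @ concat (map g (vecs (length w))))"
proof -
  let ?body = "body ;; Fwd j ;; Loop (\<lambda>v. snd (v j) = 1) (Put j 0 ;; Fwd j) ;;
     Cond (\<lambda>v. fst (v j) = RightEnd) (rewind j ;; Put j 0) (Put j 1 ;; rewind j)"
  let ?loop = "Loop (\<lambda>v. snd (v j) = 1) ?body"
  have loop: "runs w ?loop (h, m(j := vm (hd L)), r) (h, m(j := (\<lambda>_. 0)), r @ concat (map g L))"
    if "chain L" "\<forall>v\<in>set L. length v = length w" for L r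
    using that
  proof (induction L arbitrary: r rule: chain.induct)
    case (2 v)
    have "\<not> snd (view w h (m(j := (\<lambda>_. 0))) j) = 1" by (simp add: view_def)
    then have e: "runs w ?loop (h, m(j := (\<lambda>_. 0)), r @ g v) (h, m(j := (\<lambda>_. 0)), r @ g v)"
      by (rule runs.LoopF)
    have t: "snd (view w h (m(j := vm v)) j) = 1" using h by (simp add: view_def vm_def)
    have "runs w ?loop (h, m(j := vm v), r) (h, m(j := (\<lambda>_. 0)), r @ g v)"
    proof (rule runs.LoopT)
      show "snd (view w h (m(j := vm v)) j) = 1" by (rule t)
      show "runs w ?body (h, m(j := vm v), r) (h, m(j := (\<lambda>_. 0)), r @ g v)"
        using 2 runs.Sq[OF body runs_carry[where h = h and j = j and m = m, OF h], of v r] by simp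
    qed (rule e)
    then show ?case by simp
  next
    case (3 v v' L)
    have t: "snd (view w h (m(j := vm v)) j) = 1" using h by (simp add: view_def vm_def)
    have "runs w ?loop (h, m(j := vm v'), r @ g v) (h, m(j := (\<lambda>_. 0)), (r @ g v) @ concat (map g (v' # L)))"
      using 3(1)[of "r @ g v"] 3(2,3) by simp
    then have "runs w ?loop (h, m(j := vm v), r) (h, m(j := (\<lambda>_. 0)), (r @ g v) @ concat (map g (v' # L)))"
      by (rule runs.LoopT[rotated 2]) (use t runs.Sq[OF body runs_carry[where h = h and j = j and m = m, OF h], of v r] 3(2,3) in simp_all)
    then show ?case by simp
  qed simp
  have len: "\<forall>v\<in>set (vecs (length w)). length v = length w" by (simp add: set_vecs)
  have "vm (replicate (length w) False) = (m j)(0 := Suc 0)"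
  proof
    fix p show "vm (replicate (length w) False) p = ((m j)(0 := Suc 0)) p"
      by (cases p) (auto simp: vm_def m fun_upd_apply)
  qed
  then have "runs w (Put j 1) (h, m, r) (h, m(j := vm (hd (vecs (length w)))), r)"
    using h chain_vecs by (simp add: runs_iff)
  moreover have "m(j := (\<lambda>_. 0)) = m" using m by (simp add: fun_upd_idem)
  ultimately show ?thesis
    unfolding for_vec_def using loop[OF conjunct1[OF chain_vecs] len] by (auto intro: runs.Sq)
qed

section \<open>Flags, the layout of the input, membership tests and printing of sets\<close>

definition fl :: "nat \<Rightarrow> nat \<Rightarrow> nat" where
  "fl x = (\<lambda>_. 0)(0 := x)"

lemma fl_simps [simp]: "fl x 0 = x" "(fl x)(0 := y) = fl y"
  by (simp_all add: fl_def)

lemma fl_0: "fl 0 = (\<lambda>_. 0)" by (auto simp: fl_def)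

text \<open>The invariant between subprograms: stack and flags are empty, while the heads of tapes 0
  and 1 and the vectors on tapes 2 to 5 are arbitrary.\<close>

definition clean :: "(nat \<Rightarrow> nat) \<Rightarrow> (nat \<Rightarrow> nat \<Rightarrow> nat) \<Rightarrow> bool" where
  "clean h m \<longleftrightarrow> (\<forall>j\<in>{2..11}. h j = 0) \<and> (\<forall>j\<in>{6..11}. m j = fl 0)"

lemma clean_upd [simp]: "i < 2 \<Longrightarrow> clean (h(i := p)) m = clean h m" "j < 6 \<Longrightarrow> clean h (m(j := t)) = clean h m"
  by (auto simp: clean_def fun_upd_apply)

lemma cleanD:
  assumes "clean h m"
  shows "h 2 = 0" "h 3 = 0" "h 4 = 0" "h 5 = 0" "h 6 = 0" "h 7 = 0" "h 8 = 0" "h 9 = 0" "h 10 = 0" "h 11 = 0"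
    "m 6 = fl 0" "m 7 = fl 0" "m 8 = fl 0" "m 9 = fl 0" "m 10 = fl 0" "m 11 = fl 0"
  using assms by (auto simp: clean_def)

abbreviation nums :: "nat list \<Rightarrow> tok list" where
  "nums xs \<equiv> concat (map code_nat xs)"

text \<open>A state is selected if the first cell of one of its occurrences in the list of states is
  marked.\<close>

fun sel :: "(nat \<Rightarrow> bool) \<Rightarrow> (nat \<Rightarrow> nat) \<Rightarrow> nat \<Rightarrow> nat list \<Rightarrow> nat list" where
  "sel P b p [] = []"
| "sel P b p (q # qs) = (if P (b p) then [q] else []) @ sel P b (p + length (code_nat q)) qs"

lemma nums_props: "Close \<notin> set (nums xs)" "Open \<notin> set (nums xs)"
  using code_nat_props by (auto simp: code_nat_def)

lemma read_code_nat: "here w p (code_nat a) \<Longrightarrow> read_input w p \<noteq> Cell Close \<and> read_input w p \<noteq> Cell Open"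
  using code_nat_props[of a] by (cases "nat_bits a") (auto simp: code_nat_def)

lemma here_last: "here w p xs \<Longrightarrow> xs \<noteq> [] \<Longrightarrow> read_input w (p + length xs - 1) = Cell (last xs)"
proof (induction xs arbitrary: p)
  case (Cons x xs)
  then show ?case using Cons.IH[of "Suc p"] by (cases xs) auto
qed simp

lemma code_nat_last: "code_nat a \<noteq> []" "last (code_nat a) = Stop"
  by (simp_all add: code_nat_def)

lemma num_at_next: "here w p (code_nat a) \<Longrightarrow> here w (p + length (code_nat a)) (code_nat b)
    \<Longrightarrow> num_at w (p + length (code_nat a)) b"
  using here_last[of w p "code_nat a"] by (simp add: num_at_def code_nat_last)

text \<open>The lists reflect the order and the repetitions in the given encoding; \<open>ds\<close>
  enumerates the arguments of the transition table.\<close>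

locale input_text =
  fixes w als qs qi and ds :: "(nat \<times> nat \<times> bool) list" and dl :: "nat \<Rightarrow> nat \<Rightarrow> bool \<Rightarrow> nat pbf" and ent
  defines "ent \<equiv> \<lambda>(q, a, b). code_nat q @ code_nat a @ code_nat (of_bool b) @ code_pbf (dl q a b)"
  assumes w: "w = Open # nums als @ Close # Open # nums qs @ Close # code_nat qi @ Open # concat (map ent ds) @ [Close]"
begin

text \<open>Before the first state code there are the left end marker, both brackets of the alphabet
  and the opening bracket of the states.\<close>

definition "sp = 4 + length (nums als)"

abbreviation "marked b \<equiv> sel (\<lambda>x. x = 1) b sp qs"

lemma here_w:
  "read_input w 1 = Cell Open" "here w 2 (nums als)" "read_input w (2 + length (nums als)) = Cell Close"
  "read_input w (3 + length (nums als)) = Cell Open"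
  "here w sp (nums qs)" "read_input w (sp + length (nums qs)) = Cell Close"
  "here w (1 + sp + length (nums qs)) (code_nat qi)"
  "read_input w (1 + sp + length (nums qs) + length (code_nat qi)) = Cell Open"
  "here w (2 + sp + length (nums qs) + length (code_nat qi)) (concat (map ent ds))"
  "read_input w (2 + sp + length (nums qs) + length (code_nat qi) + length (concat (map ent ds))) = Cell Close"
proof -
  have *: "here w 1 xs" if "w = xs" for xs
    using here_self[of "[]" w] unfolding that[symmetric] by simp
  have "here w 1 (Open # nums als @ Close # Open # nums qs @ Close # code_nat qi @ Open # concat (map ent ds) @ [Close])"
    by (rule *[OF w])
  then show "read_input w 1 = Cell Open" "here w 2 (nums als)" "read_input w (2 + length (nums als)) = Cell Close"
    "read_input w (3 + length (nums als)) = Cell Open"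
    "here w sp (nums qs)" "read_input w (sp + length (nums qs)) = Cell Close"
    "here w (1 + sp + length (nums qs)) (code_nat qi)"
    "read_input w (1 + sp + length (nums qs) + length (code_nat qi)) = Cell Open"
    "here w (2 + sp + length (nums qs) + length (code_nat qi)) (concat (map ent ds))"
    "read_input w (2 + sp + length (nums qs) + length (code_nat qi) + length (concat (map ent ds))) = Cell Close"
    unfolding sp_def by (simp_all del: length_concat add: eval_nat_numeral add.assoc)
qed

lemma read_sp: "\<not> is_bit (read_input w (sp - 1))"
  using here_w(4) by (simp add: sp_def)

lemma runs_goto_states:
  assumes "h j = 0"
  shows "runs w (goto_states j) (h, m, r) (h(j := sp), m, r)"
proof -
  have le: "3 + length (nums als) \<le> length w" by (rule read_Cell_le[OF here_w(4), THEN conjunct2])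
  have le1: "2 + length (nums als) \<le> length w" using le by simp
  have "runs w (seek j Close) (h(j := Suc 0), m, r) (h(j := 2 + length (nums als)), m, r)"
    using runs_seek[of w "h(j := Suc 0)" j "Open # nums als" Close m r] here_w(1-3) nums_props(1)[of als]
    by (simp add: numeral_2_eq_2 del: set_concat length_concat)
  with assms le le1 show ?thesis
    unfolding goto_states_def
    by (intro runs.Sq) (auto simp: runs_iff sp_def eval_nat_numeral simp del: length_concat)
qed

lemma runs_member:
  assumes i: "i < 2" and j: "2 \<le> j" "j \<le> 5" and hj: "h j = 0"
    and cl: "h 8 = 0" "h 9 = 0" "m 8 = fl 0" "m 9 = fl 0" and q: "num_at w (h i) q"
  shows "runs w (member i j) (h, m, r) (h, m(8 := fl (of_bool (q \<in> set (marked (m j))))), r)"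
proof -
  let ?test = "Cond (\<lambda>v. snd (v 9) = 1) (Put 9 0 ;; Put 8 1) skip"
  let ?body = "Cond (\<lambda>v. snd (v j) = 1) (compare i j ;; ?test) skip ;; next_num j"
  let ?loop = "Loop (\<lambda>v. fst (v j) \<noteq> Cell Close) ?body"
  \<comment> \<open>\<open>f\<close> tells whether an earlier marked state already matched; flag 8
    accumulates the disjunction.\<close>
  have loop: "runs w ?loop (h(j := p), m(8 := fl (of_bool f)), r)
      (h(j := p + length (nums xs)), m(8 := fl (of_bool (f \<or> q \<in> set (sel (\<lambda>x. x = 1) (m j) p xs)))), r)"
    if "here w p (nums xs)" "read_input w (p + length (nums xs)) = Cell Close" "\<not> is_bit (read_input w (p - 1))"
    for p xs f
    using that
  proof (induction xs arbitrary: p f)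
    case Nil
    then show ?case by (subst loop_iff) (simp add: view_def)
  next
    case (Cons x xs)
    let ?p = "p + length (code_nat x)"
    let ?c = "m j p = 1 \<and> q = x"
    have x: "num_at w p x" using Cons.prems by (simp add: num_at_def)
    have nx: "\<not> is_bit (read_input w (?p - 1))"
      using here_last[of w p "code_nat x"] Cons.prems by (simp add: code_nat_last)
    have cond: "runs w (Cond (\<lambda>v. snd (v j) = 1) (compare i j ;; ?test) skip)
       (h(j := p), m(8 := fl (of_bool f)), r) (h(j := p), m(8 := fl (of_bool (f \<or> ?c))), r)"
    proof (cases "m j p = 1")
      case True
      have "runs w (compare i j) (h(j := p), m(8 := fl (of_bool f)), r)
         (h(j := p), m(8 := fl (of_bool f), 9 := fl (of_bool (q = x))), r)"
        using runs_compare[of w "h(j := p)" i q j x "m(8 := fl (of_bool f))" r] i j q x cl by simp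
      moreover have "runs w ?test (h(j := p), m(8 := fl (of_bool f), 9 := fl (of_bool (q = x))), r)
         (h(j := p), m(8 := fl (of_bool (f \<or> q = x))), r)"
        using i j cl by (auto simp: runs_iff view_def fun_eq_iff fun_upd_apply)
      ultimately show ?thesis using True j by (auto simp: runs_iff(6) view_def intro: runs.Sq)
    next
      case False
      then show ?thesis using j by (simp add: runs_iff view_def)
    qed
    have next_num: "runs w (next_num j) (h(j := p), m(8 := fl (of_bool (f \<or> ?c))), r)
       (h(j := ?p), m(8 := fl (of_bool (f \<or> ?c))), r)"
      using runs_next_num[of w "h(j := p)" j x] Cons.prems by simp
    have t: "fst (view w (h(j := p)) (m(8 := fl (of_bool f))) j) \<noteq> Cell Close"
      using read_code_nat[of w p x] Cons.prems by (simp add: view_def)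
    have "runs w ?loop (h(j := ?p), m(8 := fl (of_bool (f \<or> ?c))), r)
       (h(j := ?p + length (nums xs)), m(8 := fl (of_bool ((f \<or> ?c) \<or> q \<in> set (sel (\<lambda>x. x = 1) (m j) ?p xs)))), r)"
      using Cons.prems nx by (intro Cons.IH) (simp_all add: add.assoc)
    moreover have "((f \<or> ?c) \<or> q \<in> set (sel (\<lambda>x. x = 1) (m j) ?p xs))
       \<longleftrightarrow> (f \<or> q \<in> set (sel (\<lambda>x. x = 1) (m j) p (x # xs)))" by auto
    moreover have "?p + length (nums xs) = p + length (nums (x # xs))" by simp
    ultimately have rest: "runs w ?loop (h(j := ?p), m(8 := fl (of_bool (f \<or> ?c))), r)
       (h(j := p + length (nums (x # xs))), m(8 := fl (of_bool (f \<or> q \<in> set (sel (\<lambda>x. x = 1) (m j) p (x # xs))))), r)"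
      by (simp only:)
    show ?case by (rule runs.LoopT[OF _ runs.Sq[OF cond next_num] rest], rule t)
  qed
  have 0: "m(8 := fl (of_bool False)) = m" using cl by (simp add: fun_upd_idem)
  have l: "runs w ?loop (h(j := sp), m, r)
    (h(j := sp + length (nums qs)), m(8 := fl (of_bool (q \<in> set (marked (m j))))), r)"
    using loop[OF here_w(5,6) read_sp, of False] unfolding 0 by simp
  have rew: "runs w (rewind j) (h(j := sp + length (nums qs)), m(8 := fl (of_bool (q \<in> set (marked (m j))))), r)
      (h, m(8 := fl (of_bool (q \<in> set (marked (m j))))), r)"
    using runs_rewind[of w j "h(j := sp + length (nums qs))"] hj by (simp add: fun_upd_idem)
  show ?thesis
    unfolding member_def by (rule runs.Sq[OF runs_goto_states[where h = h and j = j, OF hj] runs.Sq[OF l rew]])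
qed

definition "pset P b = [Open, Stop] @ concat (map (\<lambda>q. Bit True # code_nat q) (sel P b sp qs)) @ [Close]"

lemma runs_copy_num:
  assumes "here w (h j) (code_nat a)"
  shows "runs w (copy_until j Stop ;; Fwd j) (h, m, r) (h(j := h j + length (code_nat a)), m, r @ code_nat a)"
proof -
  have "runs w (copy_until j Stop) (h, m, r) (h(j := h j + length (nat_bits a)), m, r @ nat_bits a @ [Stop])"
    using assms code_nat_props by (intro runs_copy_until) (auto simp: code_nat_def)
  moreover have "read_input w (h j + length (nat_bits a)) = Cell Stop" using assms by (simp add: code_nat_def)
  then have "h j + length (nat_bits a) \<le> length w" by (rule read_Cell_le[THEN conjunct2])
  ultimately show ?thesis
    by (intro runs.Sq) (auto simp: runs_iff code_nat_def)
qed

lemma runs_print_set: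
  assumes hj: "h j = 0"
  shows "runs w (print_set P j) (h, m, r) (h, m, r @ pset P (m j))"
proof -
  let ?body = "Cond (\<lambda>v. P (snd (v j))) (say (Bit True) ;; copy_until j Stop ;; Fwd j) (next_num j)"
  let ?loop = "Loop (\<lambda>v. fst (v j) \<noteq> Cell Close) ?body"
  have loop: "runs w ?loop (h(j := p), m, r)
      (h(j := p + length (nums xs)), m, r @ concat (map (\<lambda>q. Bit True # code_nat q) (sel P (m j) p xs)))"
    if "here w p (nums xs)" "read_input w (p + length (nums xs)) = Cell Close"
    for p xs r
    using that
  proof (induction xs arbitrary: p r)
    case Nil
    then show ?case by (subst loop_iff) (simp add: view_def)
  next
    case (Cons x xs)
    let ?p = "p + length (code_nat x)"
    let ?o = "if P (m j p) then Bit True # code_nat x else []"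
    have t: "fst (view w (h(j := p)) m j) \<noteq> Cell Close"
      using read_code_nat[of w p x] Cons.prems by (simp add: view_def)
    have "runs w (say (Bit True) ;; copy_until j Stop ;; Fwd j) (h(j := p), m, r) (h(j := ?p), m, r @ Bit True # code_nat x)"
      using runs_copy_num[of "h(j := p)" j x m "r @ [Bit True]"] Cons.prems
      by (intro runs.Sq[of w "say (Bit True)"]) (auto simp: runs_iff(4))
    moreover have "runs w (next_num j) (h(j := p), m, r) (h(j := ?p), m, r)"
      using runs_next_num[of w "h(j := p)" j x] Cons.prems by simp
    ultimately have b: "runs w ?body (h(j := p), m, r) (h(j := ?p), m, r @ ?o)"
      by (simp add: runs_iff(6) view_def)
    have "runs w ?loop (h(j := ?p), m, r @ ?o)
      (h(j := ?p + length (nums xs)), m, (r @ ?o) @ concat (map (\<lambda>q. Bit True # code_nat q) (sel P (m j) ?p xs)))"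
      using Cons.prems by (intro Cons.IH) (simp_all add: add.assoc)
    from runs.LoopT[OF _ b this]
    have "runs w ?loop (h(j := p), m, r)
      (h(j := ?p + length (nums xs)), m, (r @ ?o) @ concat (map (\<lambda>q. Bit True # code_nat q) (sel P (m j) ?p xs)))"
      using t by blast
    then show ?case by (cases "P (m j p)") (simp_all add: add.assoc)
  qed
  have rew: "runs w (rewind j) (h(j := sp + length (nums qs)), m, r) (h, m, r)" for r
    using runs_rewind[of w j "h(j := sp + length (nums qs))"] hj by (simp add: fun_upd_idem)
  let ?r = "(r @ [Open, Stop]) @ concat (map (\<lambda>q. Bit True # code_nat q) (sel P (m j) sp qs))"
  have say: "runs w (say Close) (h(j := sp + length (nums qs)), m, ?r) (h(j := sp + length (nums qs)), m, ?r @ [Close])"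
    by (simp add: runs_iff)
  have "runs w (print_set P j) (h, m, r) (h, m, ?r @ [Close])"
    unfolding print_set_def
    by (rule runs.Sq[OF runs_says runs.Sq[OF runs_goto_states[where h = h and j = j, OF hj] runs.Sq[OF loop[OF here_w(5,6)] runs.Sq[OF say rew]]]])
  then show ?thesis by (simp add: pset_def)
qed

end

section \<open>Evaluating formulae and printing the automaton\<close>

abbreviation sees :: "tok \<Rightarrow> view \<Rightarrow> bool" where "sees t v \<equiv> fst (v 0) = Cell t"

definition "atom j = member 0 j ;;
  Cond (\<lambda>v. snd (v 8) = 1) (Put 8 0 ;; Put 7 2) (Put 7 1) ;; next_num 0"

definition "push x = Fwd 6 ;; Put 6 x"
definition "pop = Put 6 0 ;; Bwd 6"

text \<open>A decision tree for the binary codes of 0 to 5, lowest digit first. Atoms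
  \<open>Keep\<close> are looked up in the vector on tape \<open>k\<close>, atoms
  \<open>Store\<close> in the one on tape \<open>s\<close>.\<close>

definition "read_tag k s =
  Cond (sees Stop) (Fwd 0 ;; Put 7 2)
    (Cond (sees (Bit True))
      (Fwd 0 ;; Cond (sees Stop) (Fwd 0 ;; Put 7 1)
        (Cond (sees (Bit True)) (Fwd 0 ;; Fwd 0 ;; atom s) (Fwd 0 ;; Fwd 0 ;; Fwd 0 ;; push 2)))
      (Fwd 0 ;; Cond (sees (Bit True)) (Fwd 0 ;; Fwd 0 ;; atom k) (Fwd 0 ;; Fwd 0 ;; Fwd 0 ;; push 1)))"

text \<open>Formulae are evaluated from left to right.  The stack symbols 1 and 2 stand for a conjunction
  and a disjunction whose left operand is being evaluated.  After that they are replaced by 3 if the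
  result is the value of the right operand, and by 4 or 5 if it is already known to be false or
  true.  Flag 7 is 0 while no value is available, 1 for false and 2 for true.\<close>

definition "feed =
  Cond (\<lambda>v. snd (v 6) = 1) (Cond (\<lambda>v. snd (v 7) = 2) (Put 6 3) (Put 6 4) ;; Put 7 0)
  (Cond (\<lambda>v. snd (v 6) = 2) (Cond (\<lambda>v. snd (v 7) = 2) (Put 6 5) (Put 6 3) ;; Put 7 0)
  (Cond (\<lambda>v. snd (v 6) = 3) pop
  (Cond (\<lambda>v. snd (v 6) = 4) (Put 7 1 ;; pop) (Put 7 2 ;; pop))))"

definition "eval_loop k s = Loop (\<lambda>v. snd (v 7) = 0 \<or> fst (v 6) \<noteq> LeftEnd)
  (Cond (\<lambda>v. snd (v 7) = 0) (read_tag k s) feed)"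

text \<open>Flag 10 is set if the table entry does not apply: its state is not in the vector on tape
  \<open>c\<close>, its letter differs, or its Boolean is not \<open>b\<close>. The formula is
  evaluated in any case, which also moves head 0 past it. Flag 11 records that an applicable formula
  was false.\<close>

definition "entry b c k s =
  member 0 c ;; Cond (\<lambda>v. snd (v 8) = 1) (Put 8 0) (Put 10 1) ;; next_num 0 ;;
  compare 0 1 ;; Cond (\<lambda>v. snd (v 9) = 1) (Put 9 0) (Put 10 1) ;; next_num 0 ;;
  Cond (sees Stop) (if b then Put 10 1 else skip) (Fwd 0 ;; (if b then skip else Put 10 1)) ;; Fwd 0 ;;
  eval_loop k s ;; Cond (\<lambda>v. snd (v 10) = 0 \<and> snd (v 7) = 1) (Put 11 1) skip ;; Put 10 0 ;; Put 7 0"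

definition "goto_init j = goto_states j ;; seek j Close ;; Fwd j"

text \<open>The bottom of the stack is in cell 1, so that the stack is empty exactly when head 6 is
  on the left end marker.\<close>

fun stk :: "nat list \<Rightarrow> nat \<Rightarrow> nat" where
  "stk st 0 = 0"
| "stk st (Suc i) = (if i < length st then st ! i else 0)"

lemma stk_simps [simp]:
  "stk (st @ [x]) (Suc (length st)) = x"
  "(stk st)(Suc (length st) := x) = stk (st @ [x])"
  "(stk (st @ [x]))(Suc (length st) := y) = stk (st @ [y])"
proof -
  show "stk (st @ [x]) (Suc (length st)) = x" by simp
  show "(stk st)(Suc (length st) := x) = stk (st @ [x])"
  proof
    fix p show "((stk st)(Suc (length st) := x)) p = stk (st @ [x]) p"
      by (cases p) (auto simp: fun_upd_apply nth_append)
  qed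
  show "(stk (st @ [x]))(Suc (length st) := y) = stk (st @ [y])"
  proof
    fix p show "((stk (st @ [x]))(Suc (length st) := y)) p = stk (st @ [y]) p"
      by (cases p) (auto simp: fun_upd_apply nth_append)
  qed
qed

lemma stk_zero: "stk (st @ [0]) = stk st"
proof
  fix p show "stk (st @ [0]) p = stk st p" by (cases p) (auto simp: nth_append)
qed

lemma stk_Nil: "stk [] = fl 0"
proof
  fix p show "stk [] p = fl 0 p" by (cases p) (auto simp: fl_0)
qed

lemma twist:
  fixes h :: "nat \<Rightarrow> nat" and m :: "nat \<Rightarrow> nat \<Rightarrow> nat"
  shows "h(0 := p, 6 := l, 0 := p') = h(0 := p', 6 := l)"
  "m(6 := a, 7 := b, 6 := c) = m(6 := c, 7 := b)"
  by (auto simp: fun_eq_iff fun_upd_apply)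

lemma code_nats:
  "code_nat 0 = [Stop]" "code_nat (Suc 0) = [Bit True, Stop]" "code_nat 2 = [Bit False, Bit True, Stop]"
  "code_nat 3 = [Bit True, Bit True, Stop]" "code_nat 4 = [Bit False, Bit False, Bit True, Stop]"
  "code_nat 5 = [Bit True, Bit False, Bit True, Stop]"
proof -
  have z: "nat_bits 0 = []" by (subst nat_bits.simps) simp
  have s: "nat_bits (Suc n) = Bit (odd (Suc n)) # nat_bits (Suc n div 2)" for n by (subst nat_bits.simps) simp
  have 1: "nat_bits (Suc 0) = [Bit True]" by (subst s) (simp add: z)
  have 2: "nat_bits 2 = [Bit False, Bit True]" using s[of 1] by (simp add: 1 numeral_2_eq_2)
  have 3: "nat_bits 3 = [Bit True, Bit True]" using s[of 2] by (simp add: 1 numeral_3_eq_3)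
  have 4: "nat_bits 4 = [Bit False, Bit False, Bit True]" using s[of 3] 2 by simp
  have 5: "nat_bits 5 = [Bit True, Bit False, Bit True]" using s[of 4] 2 by simp
  show "code_nat 0 = [Stop]" "code_nat (Suc 0) = [Bit True, Stop]" "code_nat 2 = [Bit False, Bit True, Stop]"
  "code_nat 3 = [Bit True, Bit True, Stop]" "code_nat 4 = [Bit False, Bit False, Bit True, Stop]"
  "code_nat 5 = [Bit True, Bit False, Bit True, Stop]"
    by (simp_all add: code_nat_def z 1 2 3 4 5)
qed

lemma code_pbf_last: "code_pbf \<phi> \<noteq> [] \<and> last (code_pbf \<phi>) = Stop"
  by (induction \<phi>) (auto simp: code_nats code_nat_last)

lemma plus34:
  "3 + p = Suc (Suc (Suc p))" "4 + p = Suc (Suc (Suc (Suc p)))" "p + 3 = Suc (Suc (Suc p))" "p + 4 = Suc (Suc (Suc (Suc p)))"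
  by simp_all

section \<open>Correctness of the evaluation of formulae\<close>

context input_text
begin

definition "S b = set (marked b)"

context
  fixes h :: "nat \<Rightarrow> nat" and m :: "nat \<Rightarrow> nat \<Rightarrow> nat" and r :: "tok list" and k s :: nat
  assumes cl: "h 6 = 0" "h 7 = 0" "h 8 = 0" "h 9 = 0" "m 6 = fl 0" "m 7 = fl 0" "m 8 = fl 0" "m 9 = fl 0"
    and ks: "2 \<le> k" "k \<le> 5" "2 \<le> s" "s \<le> 5" "h k = 0" "h s = 0"
begin

definition "est p st v = (h(0 := p, 6 := length st), m(6 := stk st, 7 := fl v), r)"

abbreviation "truth b \<equiv> if b then 2 else (1 :: nat)"

lemma runs_atom:
  assumes q: "num_at w p q" and j: "2 \<le> j" "j \<le> 5" "h j = 0"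
  shows "runs w (atom j) (est p st 0) (est (p + length (code_nat q)) st (truth (q \<in> S (m j))))"
proof -
  let ?h = "h(0 := p, 6 := length st)" and ?m = "m(6 := stk st, 7 := fl 0)"
  have 1: "runs w (member 0 j) (?h, ?m, r) (?h, ?m(8 := fl (of_bool (q \<in> S (m j)))), r)"
    using runs_member[of 0 j ?h ?m q r] q j cl by (simp add: S_def)
  have 2: "runs w (Cond (\<lambda>v. snd (v 8) = 1) (Put 8 0 ;; Put 7 2) (Put 7 1))
     (?h, ?m(8 := fl (of_bool (q \<in> S (m j)))), r) (est p st (truth (q \<in> S (m j))))"
  proof -
    have "?m(8 := fl x, 8 := fl 0, 7 := fl y) = m(6 := stk st, 7 := fl y)"
      "?m(8 := fl 0, 7 := fl y) = m(6 := stk st, 7 := fl y)" for x y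
      using cl by (auto simp: fun_eq_iff fun_upd_apply)
    then show ?thesis using cl by (simp add: runs_iff view_def est_def)
  qed
  have 3: "runs w (next_num 0) (est p st v) (est (p + length (code_nat q)) st v)" for v
    using runs_next_num[of w ?h 0 q] q by (simp add: est_def num_at_def twist)
  show ?thesis unfolding atom_def using runs.Sq[OF 1 runs.Sq[OF 2 3]] by (simp add: est_def)
qed

text \<open>\<open>length st < p\<close> ensures that a push stays within the tape: the stack is
  never higher than the number of tokens scanned so far.\<close>

lemma runs_tags:
  "here w p [Stop] \<Longrightarrow> runs w (read_tag k s) (est p st 0) (est (p + 1) st 2)"
  "here w p [Bit True, Stop] \<Longrightarrow> runs w (read_tag k s) (est p st 0) (est (p + 2) st 1)"
  "here w p [Bit False, Bit False, Bit True, Stop] \<Longrightarrow> length st < p \<Longrightarrow>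
     runs w (read_tag k s) (est p st 0) (est (p + 4) (st @ [1]) 0)"
  "here w p [Bit True, Bit False, Bit True, Stop] \<Longrightarrow> length st < p \<Longrightarrow>
     runs w (read_tag k s) (est p st 0) (est (p + 4) (st @ [2]) 0)"
  "here w p ([Bit False, Bit True, Stop] @ code_nat q) \<Longrightarrow>
     runs w (read_tag k s) (est p st 0) (est (p + 3 + length (code_nat q)) st (truth (q \<in> S (m k))))"
  "here w p ([Bit True, Bit True, Stop] @ code_nat q) \<Longrightarrow>
     runs w (read_tag k s) (est p st 0) (est (p + 3 + length (code_nat q)) st (truth (q \<in> S (m s))))"
proof -
  note le = read_Cell_le[THEN conjunct2]
  note ex = read_tag_def push_def runs_iff view_def est_def twist cl
  { assume "here w p [Stop]"
    then have rd: "read_input w p = Cell Stop" by simp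
    show "runs w (read_tag k s) (est p st 0) (est (p + 1) st 2)"
      using rd le[OF rd] by (simp add: ex) }
  { assume "here w p [Bit True, Stop]"
    then have rd: "read_input w p = Cell (Bit True)" "read_input w (Suc p) = Cell Stop" by simp_all
    show "runs w (read_tag k s) (est p st 0) (est (p + 2) st 1)"
      using rd le[OF rd(1)] le[OF rd(2)] by (simp add: ex) }
  { assume "here w p [Bit False, Bit False, Bit True, Stop]" and st: "length st < p"
    then have rd: "read_input w p = Cell (Bit False)" "read_input w (Suc p) = Cell (Bit False)"
       "read_input w (Suc (Suc p)) = Cell (Bit True)" "read_input w (Suc (Suc (Suc p))) = Cell Stop" by simp_all
    show "runs w (read_tag k s) (est p st 0) (est (p + 4) (st @ [1]) 0)"
      using rd le[OF rd(4)] st by (simp add: ex plus34) }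
  { assume "here w p [Bit True, Bit False, Bit True, Stop]" and st: "length st < p"
    then have rd: "read_input w p = Cell (Bit True)" "read_input w (Suc p) = Cell (Bit False)"
       "read_input w (Suc (Suc p)) = Cell (Bit True)" "read_input w (Suc (Suc (Suc p))) = Cell Stop" by simp_all
    show "runs w (read_tag k s) (est p st 0) (est (p + 4) (st @ [2]) 0)"
      using rd le[OF rd(4)] st by (simp add: ex plus34) }
  { assume "here w p ([Bit False, Bit True, Stop] @ code_nat q)"
    then have rd: "read_input w p = Cell (Bit False)" "read_input w (Suc p) = Cell (Bit True)"
       "read_input w (Suc (Suc p)) = Cell Stop" "here w (p + 3) (code_nat q)" by (simp_all add: plus34)
    then have "num_at w (p + 3) q" by (simp add: num_at_def plus34)
    from runs_atom[OF this ks(1,2,5), of st]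
    show "runs w (read_tag k s) (est p st 0) (est (p + 3 + length (code_nat q)) st (truth (q \<in> S (m k))))"
      using rd(1-3) le[OF rd(3)] by (simp add: ex plus34) }
  { assume "here w p ([Bit True, Bit True, Stop] @ code_nat q)"
    then have rd: "read_input w p = Cell (Bit True)" "read_input w (Suc p) = Cell (Bit True)"
       "read_input w (Suc (Suc p)) = Cell Stop" "here w (p + 3) (code_nat q)" by (simp_all add: plus34)
    then have "num_at w (p + 3) q" by (simp add: num_at_def plus34)
    from runs_atom[OF this ks(3,4,6), of st]
    show "runs w (read_tag k s) (est p st 0) (est (p + 3 + length (code_nat q)) st (truth (q \<in> S (m s))))"
      using rd(1-3) le[OF rd(3)] by (simp add: ex plus34) }
qed

lemma runs_feed:
  "runs w feed (est p (st @ [1]) (truth b)) (est p (st @ [if b then 3 else 4]) 0)"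
  "runs w feed (est p (st @ [2]) (truth b)) (est p (st @ [if b then 5 else 3]) 0)"
  "runs w feed (est p (st @ [3]) v) (est p st v)"
  "runs w feed (est p (st @ [4]) v) (est p st 1)"
  "runs w feed (est p (st @ [5]) v) (est p st 2)"
  by (simp_all add: feed_def pop_def runs_iff view_def est_def twist cl stk_zero)

lemma eval_read:
  assumes "runs w (read_tag k s) (est p st 0) x" "runs w (eval_loop k s) x y"
  shows "runs w (eval_loop k s) (est p st 0) y"
proof -
  have "runs w (Cond (\<lambda>v. snd (v 7) = 0) (read_tag k s) feed) (est p st 0) x"
    using assms(1) cl by (simp add: est_def runs_iff(6) view_def)
  then show ?thesis
    using assms(2) unfolding eval_loop_def est_def
    by (rule runs.LoopT[rotated]) (use cl in \<open>simp add: view_def\<close>)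
qed

lemma eval_feed:
  assumes "runs w feed (est p st v) x" "runs w (eval_loop k s) x y" "st \<noteq> []" "v \<noteq> 0"
  shows "runs w (eval_loop k s) (est p st v) y"
proof -
  have "runs w (Cond (\<lambda>v. snd (v 7) = 0) (read_tag k s) feed) (est p st v) x"
    using assms cl by (simp add: est_def runs_iff(6) view_def)
  then show ?thesis
    using assms(2) unfolding eval_loop_def est_def
    by (rule runs.LoopT[rotated]) (use assms(3) cl in \<open>simp add: view_def\<close>)
qed

text \<open>Subformulae are not handled by separate loops, so the claim is in continuation form: the
  single loop can be resumed after \<open>\<phi>\<close> with its truth value at hand. A connective
  occupies four tokens and adds one stack symbol, so the bound on the stack is inherited.\<close>

lemma runs_eval_pbf:
  "here w p (code_pbf \<phi>) \<Longrightarrow> length st < p \<Longrightarrow>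
   runs w (eval_loop k s) (est (p + length (code_pbf \<phi>)) st (truth (sat (S (m k)) (S (m s)) \<phi>))) y \<Longrightarrow>
   runs w (eval_loop k s) (est p st 0) y"
proof (induction \<phi> arbitrary: p st)
  case Tt
  then show ?case using eval_read[OF runs_tags(1)] by (simp add: code_nats)
next
  case Ff
  then show ?case using eval_read[OF runs_tags(2)] by (simp add: code_nats)
next
  case (Keep q)
  then show ?case using eval_read[OF runs_tags(5)[of p q]] by (simp add: code_nats plus34)
next
  case (Store q)
  then show ?case using eval_read[OF runs_tags(6)[of p q]] by (simp add: code_nats plus34)
next
  case (And \<phi> \<psi>)
  let ?b = "sat (S (m k)) (S (m s)) \<phi>" and ?c = "sat (S (m k)) (S (m s)) \<psi>"
  let ?p1 = "p + 4 + length (code_pbf \<phi>)" and ?p2 = "p + 4 + length (code_pbf \<phi>) + length (code_pbf \<psi>)"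
  have here: "here w p [Bit False, Bit False, Bit True, Stop]" "here w (p + 4) (code_pbf \<phi>)" "here w ?p1 (code_pbf \<psi>)"
    using And.prems(1) by (simp_all add: code_nats plus34)
  have "runs w (eval_loop k s) (est ?p2 st (truth (?b \<and> ?c))) y"
    using And.prems(3) by (simp add: code_nats add.assoc plus34)
  then have "runs w (eval_loop k s) (est ?p2 (st @ [if ?b then 3 else 4]) (truth ?c)) y"
    using eval_feed[OF runs_feed(3)[of ?p2 st "truth ?c"]] eval_feed[OF runs_feed(4)[of ?p2 st "truth ?c"]]
    by (cases ?b) auto
  then have "runs w (eval_loop k s) (est ?p1 (st @ [if ?b then 3 else 4]) 0) y"
    using And.IH(2)[OF here(3)] And.prems(2) by simp
  then have "runs w (eval_loop k s) (est ?p1 (st @ [1]) (truth ?b)) y"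
    by (rule eval_feed[OF runs_feed(1)]) auto
  then have "runs w (eval_loop k s) (est (p + 4) (st @ [1]) 0) y"
    using And.IH(1)[OF here(2)] And.prems(2) by simp
  then show ?case by (rule eval_read[OF runs_tags(3)[OF here(1) And.prems(2)]])
next
  case (Or \<phi> \<psi>)
  let ?b = "sat (S (m k)) (S (m s)) \<phi>" and ?c = "sat (S (m k)) (S (m s)) \<psi>"
  let ?p1 = "p + 4 + length (code_pbf \<phi>)" and ?p2 = "p + 4 + length (code_pbf \<phi>) + length (code_pbf \<psi>)"
  have here: "here w p [Bit True, Bit False, Bit True, Stop]" "here w (p + 4) (code_pbf \<phi>)" "here w ?p1 (code_pbf \<psi>)"
    using Or.prems(1) by (simp_all add: code_nats plus34)
  have "runs w (eval_loop k s) (est ?p2 st (truth (?b \<or> ?c))) y"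
    using Or.prems(3) by (simp add: code_nats add.assoc plus34)
  then have "runs w (eval_loop k s) (est ?p2 (st @ [if ?b then 5 else 3]) (truth ?c)) y"
    using eval_feed[OF runs_feed(3)[of ?p2 st "truth ?c"]] eval_feed[OF runs_feed(5)[of ?p2 st "truth ?c"]]
    by (cases ?b) auto
  then have "runs w (eval_loop k s) (est ?p1 (st @ [if ?b then 5 else 3]) 0) y"
    using Or.IH(2)[OF here(3)] Or.prems(2) by simp
  then have "runs w (eval_loop k s) (est ?p1 (st @ [2]) (truth ?b)) y"
    by (rule eval_feed[OF runs_feed(2)]) auto
  then have "runs w (eval_loop k s) (est (p + 4) (st @ [2]) 0) y"
    using Or.IH(1)[OF here(2)] Or.prems(2) by simp
  then show ?case by (rule eval_read[OF runs_tags(4)[OF here(1) Or.prems(2)]])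
qed

lemma runs_eval:
  assumes "here w (h 0) (code_pbf \<phi>)" "0 < h 0"
  shows "runs w (eval_loop k s) (h, m, r)
    (h(0 := h 0 + length (code_pbf \<phi>)), m(7 := fl (truth (sat (S (m k)) (S (m s)) \<phi>))), r)"
proof -
  have est: "est p [] v = (h(0 := p), m(7 := fl v), r)" for p v
    using cl by (simp add: est_def stk_Nil fun_eq_iff fun_upd_apply)
  have "runs w (eval_loop k s) (est p [] (truth b)) (est p [] (truth b))" for p b
    unfolding est eval_loop_def using cl by (intro runs.LoopF) (simp add: view_def)
  then have "runs w (eval_loop k s) (est (h 0) [] 0)
    (est (h 0 + length (code_pbf \<phi>)) [] (truth (sat (S (m k)) (S (m s)) \<phi>)))"
    using runs_eval_pbf[OF assms(1)] assms(2) by simp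
  then show ?thesis using cl unfolding est by (simp add: fun_upd_idem)
qed

end

end

section \<open>Checks against the transition table and printing commands\<close>

definition "check_all b c k s = goto_init 0 ;; next_num 0 ;; Fwd 0 ;;
  Loop (\<lambda>v. fst (v 0) \<noteq> Cell Close) (entry b c k s) ;; rewind 0"

definition "flags m a b c x f = (m :: nat \<Rightarrow> nat \<Rightarrow> nat)
  (7 := fl a, 8 := fl b, 9 := fl c, 10 := fl x, 11 := fl f)"

lemma flags_upd:
  "(flags m a b c x f)(7 := fl y) = flags m y b c x f"
  "(flags m a b c x f)(8 := fl y) = flags m a y c x f"
  "(flags m a b c x f)(9 := fl y) = flags m a b y x f"
  "(flags m a b c x f)(10 := fl y) = flags m a b c y f"
  "(flags m a b c x f)(11 := fl y) = flags m a b c x y"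
  by (auto simp: flags_def fun_eq_iff fun_upd_apply)

lemma flags_at:
  "flags m a b c x f 7 = fl a" "flags m a b c x f 8 = fl b" "flags m a b c x f 9 = fl c"
  "flags m a b c x f 10 = fl x" "flags m a b c x f 11 = fl f"
  "j < 7 \<Longrightarrow> flags m a b c x f j = m j"
  by (auto simp: flags_def fun_eq_iff fun_upd_apply)

lemma flags_clean: "clean h m \<Longrightarrow> flags m 0 0 0 0 0 = m"
  by (auto simp: clean_def flags_def fun_eq_iff fun_upd_apply)

text \<open>Restoring heads and marks makes such commands composable: sequencing becomes
  concatenation of the printed texts.\<close>

definition emits :: "tok list \<Rightarrow> com \<Rightarrow> (nat \<Rightarrow> nat) \<Rightarrow> (nat \<Rightarrow> nat \<Rightarrow> nat) \<Rightarrow> tok list \<Rightarrow> bool" where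
  "emits w c h m g \<longleftrightarrow> (\<forall>r. runs w c (h, m, r) (h, m, r @ g))"

lemma emits_Sq: "emits w a h m x \<Longrightarrow> emits w b h m y \<Longrightarrow> emits w (a ;; b) h m (x @ y)"
  unfolding emits_def by (metis append.assoc runs.Sq)

lemma emits_says: "emits w (says ts) h m ts"
  by (simp add: emits_def runs_says)

lemma emits_for_vec:
  assumes "h j = 0" "m j = (\<lambda>_. 0)"
    and "\<And>v. length v = length w \<Longrightarrow> emits w body h (m(j := vm v)) (g v)"
  shows "emits w (for_vec j body) h m (concat (map g (vecs (length w))))"
  using assms unfolding emits_def by (blast intro: runs_for_vec)

lemma emits_print_state:
  assumes "h j = 0" "m j = vm v" "length v = length w"
  shows "emits w (print_state b j) h m (Bit b # map Bit v @ [Bit True, Stop])"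
proof -
  have "map (\<lambda>p. Bit (m j p = 1)) [1..<Suc (length w)] = map Bit v"
    using assms(2,3) by (intro nth_equalityI) (auto simp: vm_def simp del: upt_Suc)
  then show ?thesis
    using runs_print_state[where h = h and j = j, OF assms(1), of w b m] by (simp add: emits_def)
qed

definition "print_letter = copy_until 1 Stop ;; back 1"

lemma emits_print_letter:
  assumes "num_at w (h 1) a"
  shows "emits w print_letter h m (code_nat a)"
  unfolding emits_def
proof
  fix r
  obtain xs where xs: "nat_bits a = map Bit xs" using nat_bits_Bit by blast
  have ha: "here w (h 1) (map Bit xs @ [Stop])" using assms xs by (simp add: num_at_def code_nat_def)
  have 1: "runs w (copy_until 1 Stop) (h, m, r) (h(1 := h 1 + length xs), m, r @ code_nat a)"
    using runs_copy_until[of w h 1 "map Bit xs" Stop m r] ha xs by (auto simp: code_nat_def)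
  have "runs w (back 1) (h(1 := h 1 + length xs), m, r @ code_nat a)
      ((h(1 := h 1 + length xs))(1 := h 1), m, r @ code_nat a)"
    by (rule runs_back[of "length xs"])
      (use ha assms here_bit[of w "h 1" xs] num_at_pos[OF assms] in \<open>auto simp: num_at_def\<close>)
  then show "runs w print_letter (h, m, r) (h, m, r @ code_nat a)"
    unfolding print_letter_def by (intro runs.Sq[OF 1]) (simp add: fun_upd_idem)
qed

definition "for_letters body = Fwd 1 ;; Fwd 1 ;;
  Loop (\<lambda>v. fst (v 1) \<noteq> Cell Close) (body ;; next_num 1) ;; rewind 1"

definition "print_alphabet = says [Open] ;; Fwd 1 ;; Fwd 1 ;; copy_until 1 Close ;; rewind 1"

definition "if_init A = (goto_init 0 ;; member 0 2 ;; rewind 0) ;;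
  Cond (\<lambda>v. snd (v 8) = 1) (Put 8 0 ;; A) skip"

definition "unless_fails b c k s A = check_all b c k s ;; Cond (\<lambda>v. snd (v 11) = 1) (Put 11 0) A"

context input_text
begin

lemma emits_print_set: "h j = 0 \<Longrightarrow> emits w (print_set P j) h m (pset P (m j))"
  by (simp add: emits_def runs_print_set)

lemma runs_goto_init:
  assumes "h j = 0"
  shows "runs w (goto_init j) (h, m, r) (h(j := 1 + sp + length (nums qs)), m, r)"
proof -
  have "runs w (seek j Close) (h(j := sp), m, r) (h(j := sp + length (nums qs)), m, r)"
    using runs_seek[of w "h(j := sp)" j "nums qs" Close] here_w(5,6) nums_props(1) by simp
  moreover have "sp + length (nums qs) \<le> length w" by (rule read_Cell_le[OF here_w(6), THEN conjunct2])
  ultimately show ?thesis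
    unfolding goto_init_def using runs_goto_states[where h = h and j = j, OF assms]
    by (intro runs.Sq) (auto simp: runs_iff(1))
qed

lemma num_at_init: "num_at w (1 + sp + length (nums qs)) qi"
  using here_w(6,7) by (simp add: num_at_def)

definition fails :: "bool \<Rightarrow> nat \<Rightarrow> nat set \<Rightarrow> nat set \<Rightarrow> nat set \<Rightarrow> bool" where
  "fails b a C P Pd \<longleftrightarrow> (\<exists>(q, a', b') \<in> set ds. q \<in> C \<and> a' = a \<and> b' = b \<and> \<not> sat P Pd (dl q a' b'))"

lemma ent_nonempty: "ent d \<noteq> []" "last (ent d) = Stop"
  using code_pbf_last by (auto simp: ent_def last_append split: prod.splits)

context
  fixes h :: "nat \<Rightarrow> nat" and m :: "nat \<Rightarrow> nat \<Rightarrow> nat" and r :: "tok list" and a c k s :: nat and b :: bool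
  assumes cl: "clean h m" and letter: "num_at w (h 1) a"
    and cks: "2 \<le> c" "c \<le> 5" "2 \<le> k" "k \<le> 5" "2 \<le> s" "s \<le> 5"
begin

definition "gst p v b1 b2 x f = (h(0 := p), flags m v b1 b2 x f, r)"

lemma runs_entry:
  assumes here: "here w p (ent (q, a', b'))" and prev: "\<not> is_bit (read_input w (p - 1))"
  shows "runs w (entry b c k s) (gst p 0 0 0 0 (of_bool f))
    (gst (p + length (ent (q, a', b'))) 0 0 0 0
      (of_bool (f \<or> q \<in> S (m c) \<and> a' = a \<and> b' = b \<and> \<not> sat (S (m k)) (S (m s)) (dl q a' b'))))"
proof -
  let ?p1 = "p + length (code_nat q)"
  let ?p2 = "?p1 + length (code_nat a')"
  let ?p3 = "?p2 + length (code_nat (of_bool b'))"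
  let ?\<phi> = "dl q a' b'"
  let ?p4 = "?p3 + length (code_pbf ?\<phi>)"
  let ?in = "q \<in> S (m c)" and ?sat = "sat (S (m k)) (S (m s)) ?\<phi>"
  let ?x1 = "\<not> ?in" let ?x2 = "?x1 \<or> a' \<noteq> a" let ?x3 = "?x2 \<or> b' \<noteq> b"
  let ?f = "of_bool f :: nat"
  note c = cleanD[OF cl]
  have hz: "h c = 0" "h k = 0" "h s = 0" using cl cks by (auto simp: clean_def)
  have mz: "flags m v1 v2 v3 v4 v5 c = m c" "flags m v1 v2 v3 v4 v5 k = m k" "flags m v1 v2 v3 v4 v5 s = m s"
    for v1 v2 v3 v4 v5 using cks by (auto simp: flags_at)
  have hr: "here w p (code_nat q)" "here w ?p1 (code_nat a')" "here w ?p2 (code_nat (of_bool b'))"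
    "here w ?p3 (code_pbf ?\<phi>)"
    using here by (simp_all add: ent_def add.assoc)
  have q: "num_at w p q" using hr(1) prev by (simp add: num_at_def)
  have a': "num_at w ?p1 a'" by (rule num_at_next) fact+
  have 1: "runs w (member 0 c) (gst p 0 0 0 0 ?f) (gst p 0 (of_bool ?in) 0 0 ?f)"
    using runs_member[of 0 c "h(0 := p)" "flags m 0 0 0 0 ?f" q r] q cks hz c
    by (simp add: gst_def flags_at flags_upd mz S_def)
  have 2: "runs w (Cond (\<lambda>v. snd (v 8) = 1) (Put 8 0) (Put 10 1)) (gst p 0 (of_bool ?in) 0 0 ?f) (gst p 0 0 0 (of_bool ?x1) ?f)"
    using c by (simp add: gst_def runs_iff view_def flags_at flags_upd)
  have next_num: "runs w (next_num 0) (gst p' v1 v2 v3 v4 v5) (gst (p' + length (code_nat n)) v1 v2 v3 v4 v5)"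
    if "here w p' (code_nat n)" for p' n v1 v2 v3 v4 v5
    using runs_next_num[of w "h(0 := p')" 0 n] that by (simp add: gst_def)
  have 4: "runs w (compare 0 1) (gst ?p1 0 0 0 (of_bool ?x1) ?f) (gst ?p1 0 0 (of_bool (a' = a)) (of_bool ?x1) ?f)"
    using runs_compare[of w "h(0 := ?p1)" 0 a' 1 a "flags m 0 0 0 (of_bool ?x1) ?f" r] a' letter c
    by (simp add: gst_def flags_at flags_upd)
  have 5: "runs w (Cond (\<lambda>v. snd (v 9) = 1) (Put 9 0) (Put 10 1)) (gst ?p1 0 0 (of_bool (a' = a)) (of_bool ?x1) ?f)
      (gst ?p1 0 0 0 (of_bool ?x2) ?f)"
    using c by (simp add: gst_def runs_iff view_def flags_at flags_upd)
  \<comment> \<open>The code of the Boolean is \<open>[Stop]\<close> or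
    \<open>[Bit True, Stop]\<close>; \<open>?p2'\<close> is the position of its
    \<open>Stop\<close>.\<close>
  let ?p2' = "?p2 + (if b' then 1 else 0)"
  have 7: "runs w (Cond (sees Stop) (if b then Put 10 1 else skip) (Fwd 0 ;; (if b then skip else Put 10 1)))
      (gst ?p2 0 0 0 (of_bool ?x2) ?f) (gst ?p2' 0 0 0 (of_bool ?x3) ?f)"
  proof (cases b')
    case True
    then have rd: "read_input w ?p2 = Cell (Bit True)" using hr(3) by (simp add: code_nats)
    then show ?thesis using True c read_Cell_le[OF rd] by (cases b) (simp_all add: gst_def runs_iff view_def flags_at flags_upd)
  next
    case False
    then have "read_input w ?p2 = Cell Stop" using hr(3) by (simp add: code_nats)
    then show ?thesis using False c by (cases b) (simp_all add: gst_def runs_iff view_def flags_at flags_upd)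
  qed
  have rd2: "read_input w ?p2' = Cell Stop" using hr(3) by (cases b') (simp_all add: code_nats)
  have p3: "?p3 = Suc ?p2'" by (cases b') (simp_all add: code_nats)
  have 8: "runs w (Fwd 0) (gst ?p2' v1 v2 v3 v4 v5) (gst ?p3 v1 v2 v3 v4 v5)" for v1 v2 v3 v4 v5
    unfolding p3 using read_Cell_le[OF rd2] by (simp add: gst_def runs_iff)
  have 9: "runs w (eval_loop k s) (gst ?p3 0 0 0 (of_bool ?x3) ?f) (gst ?p4 (if ?sat then 2 else 1) 0 0 (of_bool ?x3) ?f)"
    using runs_eval[of "h(0 := ?p3)" "flags m 0 0 0 (of_bool ?x3) ?f" k s ?\<phi> r] hr(4) p3 c cks hz
    by (simp add: gst_def flags_at flags_upd mz)
  have 10: "runs w (Cond (\<lambda>v. snd (v 10) = 0 \<and> snd (v 7) = 1) (Put 11 1) skip ;; Put 10 0 ;; Put 7 0)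
      (gst ?p4 (if ?sat then 2 else 1) 0 0 (of_bool ?x3) ?f)
      (gst ?p4 0 0 0 0 (of_bool (f \<or> ?in \<and> a' = a \<and> b' = b \<and> \<not> ?sat)))"
    using c by (cases f; cases ?sat) (auto simp: gst_def runs_iff view_def flags_at flags_upd)
  have p4: "p + length (ent (q, a', b')) = ?p4" by (simp add: ent_def)
  show ?thesis
    unfolding entry_def p4
    by (rule runs.Sq[OF 1 runs.Sq[OF 2 runs.Sq[OF next_num[OF hr(1)] runs.Sq[OF 4 runs.Sq[OF 5
      runs.Sq[OF next_num[OF hr(2)] runs.Sq[OF 7 runs.Sq[OF 8 runs.Sq[OF 9 10]]]]]]]]])
qed

lemma runs_entries:
  "here w p (concat (map ent es)) \<Longrightarrow> read_input w (p + length (concat (map ent es))) = Cell Close \<Longrightarrow>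
   \<not> is_bit (read_input w (p - 1)) \<Longrightarrow>
   runs w (Loop (\<lambda>v. fst (v 0) \<noteq> Cell Close) (entry b c k s)) (gst p 0 0 0 0 (of_bool f))
    (gst (p + length (concat (map ent es))) 0 0 0 0 (of_bool (f \<or>
       (\<exists>(q, a', b') \<in> set es. q \<in> S (m c) \<and> a' = a \<and> b' = b \<and> \<not> sat (S (m k)) (S (m s)) (dl q a' b')))))"
proof (induction es arbitrary: p f)
  case Nil
  then show ?case by (auto simp: gst_def view_def intro!: runs.LoopF)
next
  case (Cons e es)
  obtain q a' b' where e: "e = (q, a', b')" by (cases e)
  let ?c = "q \<in> S (m c) \<and> a' = a \<and> b' = b \<and> \<not> sat (S (m k)) (S (m s)) (dl q a' b')"
  let ?p = "p + length (ent e)"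
  let ?E = "\<lambda>es. \<exists>(q, a', b') \<in> set es. q \<in> S (m c) \<and> a' = a \<and> b' = b \<and> \<not> sat (S (m k)) (S (m s)) (dl q a' b')"
  have here: "here w p (ent e)" using Cons.prems by simp
  have 1: "runs w (entry b c k s) (gst p 0 0 0 0 (of_bool f)) (gst ?p 0 0 0 0 (of_bool (f \<or> ?c)))"
    using runs_entry[of p q a' b' f] here Cons.prems(3) by (simp add: e)
  have "\<not> is_bit (read_input w (?p - 1))"
    using here_last[OF here ent_nonempty(1)] by (simp add: ent_nonempty)
  then have 2: "runs w (Loop (\<lambda>v. fst (v 0) \<noteq> Cell Close) (entry b c k s)) (gst ?p 0 0 0 0 (of_bool (f \<or> ?c)))
     (gst (?p + length (concat (map ent es))) 0 0 0 0 (of_bool ((f \<or> ?c) \<or> ?E es)))"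
    using Cons.prems by (intro Cons.IH) (simp_all add: add.assoc)
  have "here w p (code_nat q)" using here by (simp add: e ent_def)
  from read_code_nat[OF this] have t: "read_input w p \<noteq> Cell Close" by simp
  have "runs w (Loop (\<lambda>v. fst (v 0) \<noteq> Cell Close) (entry b c k s)) (gst p 0 0 0 0 (of_bool f))
     (gst (?p + length (concat (map ent es))) 0 0 0 0 (of_bool ((f \<or> ?c) \<or> ?E es)))"
    using 1 2 unfolding gst_def by (rule runs.LoopT[rotated]) (use t in \<open>simp add: view_def\<close>)
  moreover have "(f \<or> ?c) \<or> ?E es \<longleftrightarrow> f \<or> ?E (e # es)" by (simp add: e)
  moreover have "?p + length (concat (map ent es)) = p + length (concat (map ent (e # es)))" by simp
  ultimately show ?case by (simp only:)
qed

lemma runs_check_all: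
  assumes h0: "h 0 = 0"
  shows "runs w (check_all b c k s) (h, m, r) (h, m(11 := fl (of_bool (fails b a (S (m c)) (S (m k)) (S (m s))))), r)"
proof -
  let ?pi = "1 + sp + length (nums qs)"
  let ?pd = "1 + ?pi + length (code_nat qi)"
  have start: "gst p 0 0 0 0 (of_bool False) = (h(0 := p), m, r)" for p
    using flags_clean[OF cl] by (simp add: gst_def)
  have 2: "runs w (next_num 0) (h(0 := ?pi), m, r) (h(0 := ?pi + length (code_nat qi)), m, r)"
    using runs_next_num[of w "h(0 := ?pi)" 0 qi] here_w(7) by simp
  have 3: "runs w (Fwd 0) (h(0 := ?pi + length (code_nat qi)), m, r) (gst ?pd 0 0 0 0 (of_bool False))"
    using read_Cell_le[OF here_w(8)] unfolding start by (simp add: runs_iff)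
  have pd: "?pd = 2 + sp + length (nums qs) + length (code_nat qi)" by simp
  have nb: "\<not> is_bit (read_input w (?pd - 1))" using here_w(8) by simp
  note 4 = runs_entries[OF here_w(9,10), folded pd, OF nb, of False]
  let ?e = "?pd + length (concat (map ent ds))"
  have fin: "gst ?e 0 0 0 0 (of_bool z) = (h(0 := ?e), m(11 := fl (of_bool z)), r)" for z
    using flags_clean[OF cl] flags_upd(5)[of m 0 0 0 0 0 "of_bool z"] by (simp add: gst_def)
  have 5: "runs w (rewind 0) (h(0 := p), m', r) (h, m', r)" for p m'
    using runs_rewind[of w 0 "h(0 := p)"] h0 by (simp add: fun_upd_idem)
  have 6: "runs w (Loop (\<lambda>v. fst (v 0) \<noteq> Cell Close) (entry b c k s)) (gst ?pd 0 0 0 0 (of_bool False))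
     (h(0 := ?e), m(11 := fl (of_bool (fails b a (S (m c)) (S (m k)) (S (m s))))), r)"
    using 4 unfolding fin fails_def by (simp only: simp_thms)
  show ?thesis
    unfolding check_all_def
    by (rule runs.Sq[OF runs_goto_init[where h = h and j = 0, OF h0] runs.Sq[OF 2 runs.Sq[OF 3 runs.Sq[OF 6 5]]]])
qed

end

lemma emits_unless_fails:
  assumes cl: "clean h m" "num_at w (h 1) a" "2 \<le> c" "c \<le> 5" "2 \<le> k" "k \<le> 5" "2 \<le> s" "s \<le> 5" "h 0 = 0"
    and A: "emits w A h m g"
  shows "emits w (unless_fails b c k s A) h m (if fails b a (S (m c)) (S (m k)) (S (m s)) then [] else g)"
  unfolding emits_def
proof
  fix r
  let ?F = "fails b a (S (m c)) (S (m k)) (S (m s))"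
  have e: "m(11 := fl 0) = m" using cleanD(16)[OF cl(1)] by (simp add: fun_upd_idem)
  have "runs w (Cond (\<lambda>v. snd (v 11) = 1) (Put 11 0) A) (h, m(11 := fl (of_bool ?F)), r)
     (h, m, r @ (if ?F then [] else g))"
    using A cleanD(10)[OF cl(1)] by (simp add: runs_iff view_def e emits_def)
  then show "runs w (unless_fails b c k s A) (h, m, r) (h, m, r @ (if ?F then [] else g))"
    unfolding unless_fails_def using runs_check_all[OF cl] by (rule runs.Sq[rotated])
qed

lemma emits_if_init:
  assumes cl: "clean h m" "h 0 = 0" and A: "emits w A h m g"
  shows "emits w (if_init A) h m (if qi \<in> S (m 2) then g else [])"
  unfolding emits_def
proof
  fix r
  note c = cleanD[OF cl(1)]
  let ?h = "h(0 := 1 + sp + length (nums qs))"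
  let ?m = "m(8 := fl (of_bool (qi \<in> S (m 2))))"
  have e: "m(8 := fl 0) = m" using c by (simp add: fun_upd_idem)
  have 1: "runs w (goto_init 0) (h, m, r) (?h, m, r)" by (rule runs_goto_init) fact
  have 2: "runs w (member 0 2) (?h, m, r) (?h, ?m, r)"
    using runs_member[of 0 2 ?h m qi r] num_at_init c by (simp add: S_def)
  have 3: "runs w (rewind 0) (?h, ?m, r) (h, ?m, r)"
    using runs_rewind[of w 0 ?h] cl(2) by (simp add: fun_upd_idem)
  have "runs w (Cond (\<lambda>v. snd (v 8) = 1) (Put 8 0 ;; A) skip) (h, ?m, r) (h, m, r @ (if qi \<in> S (m 2) then g else []))"
    using A c by (simp add: runs_iff view_def e emits_def)
  with runs.Sq[OF 1 runs.Sq[OF 2 3]]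
  show "runs w (if_init A) (h, m, r) (h, m, r @ (if qi \<in> S (m 2) then g else []))"
    unfolding if_init_def by (rule runs.Sq)
qed

lemma emits_for_letters:
  assumes h: "h 1 = 0"
    and body: "\<And>p a. num_at w p a \<Longrightarrow> emits w body (h(1 := p)) m (g a)"
  shows "emits w (for_letters body) h m (concat (map g als))"
  unfolding emits_def
proof
  fix r
  let ?loop = "Loop (\<lambda>v. fst (v 1) \<noteq> Cell Close) (body ;; next_num 1)"
  have loop: "runs w ?loop (h(1 := p), m, r) (h(1 := p + length (nums xs)), m, r @ concat (map g xs))"
    if "here w p (nums xs)" "read_input w (p + length (nums xs)) = Cell Close" "\<not> is_bit (read_input w (p - 1))" for p xs r
    using that
  proof (induction xs arbitrary: p r)
    case Nil
    then show ?case by (auto simp: view_def intro!: runs.LoopF)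
  next
    case (Cons x xs)
    let ?p = "p + length (code_nat x)"
    have x: "num_at w p x" using Cons.prems by (simp add: num_at_def)
    have 1: "runs w body (h(1 := p), m, r) (h(1 := p), m, r @ g x)"
      using body[OF x] by (simp add: emits_def)
    have 2: "runs w (next_num 1) (h(1 := p), m, r @ g x) (h(1 := ?p), m, r @ g x)"
      using runs_next_num[of w "h(1 := p)" 1 x] Cons.prems by simp
    have "\<not> is_bit (read_input w (?p - 1))"
      using here_last[of w p "code_nat x"] Cons.prems by (simp add: code_nat_last)
    then have 3: "runs w ?loop (h(1 := ?p), m, r @ g x) (h(1 := ?p + length (nums xs)), m, (r @ g x) @ concat (map g xs))"
      using Cons.prems by (intro Cons.IH) (simp_all add: add.assoc)
    have t: "read_input w p \<noteq> Cell Close" using read_code_nat[of w p x] Cons.prems by simp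
    have "runs w ?loop (h(1 := p), m, r) (h(1 := ?p + length (nums xs)), m, (r @ g x) @ concat (map g xs))"
      using runs.Sq[OF 1 2] 3 by (rule runs.LoopT[rotated]) (use t in \<open>simp add: view_def\<close>)
    then show ?case by (simp add: add.assoc)
  qed
  have 1: "runs w (Fwd 1) (h, m, r) (h(1 := 1), m, r)" using h by (simp add: runs_iff)
  have 2: "runs w (Fwd 1) (h(1 := 1), m, r) (h(1 := 2), m, r)"
    using read_Cell_le[OF here_w(1)] by (simp add: runs_iff numeral_2_eq_2)
  have 3: "runs w (rewind 1) (h(1 := p), m, r) (h, m, r)" for p r
    using runs_rewind[of w 1 "h(1 := p)"] h by (simp add: fun_upd_idem)
  have "\<not> is_bit (read_input w (2 - 1))" using here_w(1) by simp
  from runs.Sq[OF 1 runs.Sq[OF 2 runs.Sq[OF loop[OF here_w(2,3) this] 3]]]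
  show "runs w (for_letters body) (h, m, r) (h, m, r @ concat (map g als))"
    unfolding for_letters_def .
qed

lemma emits_print_alphabet:
  assumes h: "h 1 = 0"
  shows "emits w print_alphabet h m (Open # nums als @ [Close])"
  unfolding emits_def
proof
  fix r
  have 0: "runs w (says [Open]) (h, m, r) (h, m, r @ [Open])" by (rule runs_says)
  have 1: "runs w (Fwd 1) (h, m, r') (h(1 := 1), m, r')" for r' using h by (simp add: runs_iff)
  have 2: "runs w (Fwd 1) (h(1 := 1), m, r') (h(1 := 2), m, r')" for r'
    using read_Cell_le[OF here_w(1)] by (simp add: runs_iff numeral_2_eq_2)
  have 3: "runs w (copy_until 1 Close) (h(1 := 2), m, r') (h(1 := 2 + length (nums als)), m, r' @ nums als @ [Close])" for r'
    using runs_copy_until[of w "h(1 := 2)" 1 "nums als" Close] here_w(2,3) nums_props by simp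
  have 4: "runs w (rewind 1) (h(1 := p), m, r) (h, m, r)" for p r
    using runs_rewind[of w 1 "h(1 := p)"] h by (simp add: fun_upd_idem)
  show "runs w print_alphabet (h, m, r) (h, m, r @ Open # nums als @ [Close])"
    using runs.Sq[OF 0 runs.Sq[OF 1 runs.Sq[OF 2 runs.Sq[OF 3 4]]]]
    unfolding print_alphabet_def by simp
qed

end

section \<open>The printing program and the text that it prints\<close>

abbreviation "print_marked \<equiv> print_set (\<lambda>x. x = 1)"

text \<open>Tape 4 ranges over the counters and tape 5 over their possible targets; tape 3 holds the
  guessed set of the current class, in which stored states are looked up.\<close>

definition "print_table = says [Open] ;;
  for_vec 4 (print_marked 4 ;; says [Open] ;;
    for_vec 5 (unless_fails False 4 5 3 (print_marked 5)) ;; says [Close]) ;;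
  says [Close]"

text \<open>\<open>[Bit True, Stop]\<close> is the tag 1 of a label that is a letter,
  \<open>[Bit False, Bit True, Stop]\<close> the tag 2 of a transfer.\<close>

definition "print_transition = print_state True 2 ;; says [Bit True, Stop] ;; print_letter ;;
  says [Bit False, Bit True, Stop] ;; print_table ;; print_state False 3"

text \<open>The literal tokens are, in this order: state 0, label 0 for silence and tag 1 of a
  decrement; label 0 and tag 0 of an increment, then target state 0; state 1, label 0 and tag 1. For
  the current class kept and stored states go to the same set, hence tape 3 in both roles.\<close>

definition "print_transitions =
  (says [Stop, Stop, Bit True, Stop] ;; print_marked 2 ;; print_state True 2) ;;
  (print_state False 2 ;; says [Stop, Stop] ;; print_marked 2 ;; says [Stop]) ;;
  if_init (says [Bit True, Stop, Stop, Bit True, Stop] ;; print_marked 2 ;; print_state True 2) ;;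
  for_letters (for_vec 3 (unless_fails True 2 3 3 print_transition))"

text \<open>The literals around the list of states are its members 1 and 0, and after the closing
  bracket the initial state 1.\<close>

definition "print_ipcant = print_alphabet ;;
  (says [Open, Bit True, Stop, Stop] ;; for_vec 2 (print_state True 2 ;; print_state False 2) ;;
   says [Close, Bit True, Stop]) ;;
  print_set (\<lambda>_. True) 2 ;;
  (says [Open] ;; for_vec 2 (print_marked 2) ;; says [Close]) ;;
  says [Open] ;; for_vec 2 print_transitions ;; says [Close]"

lemma com_ok_simps [simp]:
  "com_ok 12 (says ts)"
  "j < 12 \<Longrightarrow> com_ok 12 (rewind j)"
  "j < 12 \<Longrightarrow> com_ok 12 (seek j t)"
  "j < 12 \<Longrightarrow> com_ok 12 (back j)"
  "j < 12 \<Longrightarrow> com_ok 12 (copy_until j t)"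
  "j < 12 \<Longrightarrow> com_ok 12 (print_state b j)"
  "j < 12 \<Longrightarrow> com_ok 12 (for_vec j c) = com_ok 12 c"
  "i < 12 \<Longrightarrow> j < 12 \<Longrightarrow> com_ok 12 (compare i j)"
proof -
  show s: "com_ok 12 (says ts)" for ts by (induction ts) (auto simp: local_on_def)
  show r: "j < 12 \<Longrightarrow> com_ok 12 (rewind j)" for j by (auto simp: rewind_def local_on_def)
  show "j < 12 \<Longrightarrow> com_ok 12 (seek j t)" by (auto simp: seek_def local_on_def)
  show b: "j < 12 \<Longrightarrow> com_ok 12 (back j)" for j by (auto simp: back_def local_on_def)
  show "j < 12 \<Longrightarrow> com_ok 12 (copy_until j t)" by (auto simp: copy_until_def echo_def local_on_def)
  show "j < 12 \<Longrightarrow> com_ok 12 (print_state b j)" using s r by (auto simp: print_state_def local_on_def simp del: says.simps)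
  show "j < 12 \<Longrightarrow> com_ok 12 (for_vec j c) = com_ok 12 c" using r by (auto simp: for_vec_def local_on_def)
  show "i < 12 \<Longrightarrow> j < 12 \<Longrightarrow> com_ok 12 (compare i j)" using b by (auto simp: compare_def local_on_def)
qed

lemma com_ok_simps2 [simp]:
  "j < 12 \<Longrightarrow> com_ok 12 (next_num j)"
  "j < 12 \<Longrightarrow> com_ok 12 (goto_states j)"
  "j < 12 \<Longrightarrow> com_ok 12 (goto_init j)"
  "i < 12 \<Longrightarrow> j < 12 \<Longrightarrow> com_ok 12 (member i j)"
  "j < 12 \<Longrightarrow> com_ok 12 (print_set P j)"
  by (auto simp: next_num_def goto_states_def goto_init_def member_def print_set_def local_on_def simp del: says.simps)

lemma com_ok_eval: "k < 12 \<Longrightarrow> s < 12 \<Longrightarrow> com_ok 12 (eval_loop k s)"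
  by (auto simp: eval_loop_def read_tag_def feed_def atom_def push_def pop_def local_on_def)

lemma com_ok_unless: "c < 12 \<Longrightarrow> k < 12 \<Longrightarrow> s < 12 \<Longrightarrow> com_ok 12 A \<Longrightarrow> com_ok 12 (unless_fails b c k s A)"
  by (auto simp: unless_fails_def check_all_def entry_def com_ok_eval local_on_def)

lemma com_ok_print_ipcant: "com_ok 12 print_ipcant"
  by (auto simp: print_ipcant_def print_transitions_def print_transition_def print_table_def com_ok_unless
      print_letter_def print_alphabet_def for_letters_def if_init_def local_on_def simp del: says.simps)

context input_text
begin

definition "marked_code v = pset (\<lambda>x. x = 1) (vm v)"
definition "state_code b v = Bit b # map Bit v @ [Bit True, Stop]"
definition "states v = S (vm v)"

abbreviation "for_all_vecs g \<equiv> concat (map g (vecs (length w)))"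

definition "table_code a v' = [Open] @
  for_all_vecs (\<lambda>u. marked_code u @ [Open] @
    for_all_vecs (\<lambda>u'. if fails False a (states u) (states u') (states v') then [] else marked_code u') @ [Close]) @
  [Close]"

definition "transition_code v a v' = state_code True v @ [Bit True, Stop] @ code_nat a @
  [Bit False, Bit True, Stop] @ table_code a v' @ state_code False v'"

definition "transitions_code v =
  ([Stop, Stop, Bit True, Stop] @ marked_code v @ state_code True v) @
  (state_code False v @ [Stop, Stop] @ marked_code v @ [Stop]) @
  (if qi \<in> states v then [Bit True, Stop, Stop, Bit True, Stop] @ marked_code v @ state_code True v else []) @
  concat (map (\<lambda>a. for_all_vecs (\<lambda>v'.
    if fails True a (states v) (states v') (states v') then [] else transition_code v a v')) als)"

definition "ipcant_code = (Open # nums als @ [Close]) @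
  ([Open, Bit True, Stop, Stop] @ for_all_vecs (\<lambda>v. state_code True v @ state_code False v) @
   [Close, Bit True, Stop]) @
  pset (\<lambda>_. True) (\<lambda>_. 0) @
  ([Open] @ for_all_vecs marked_code @ [Close]) @
  [Open] @ for_all_vecs transitions_code @ [Close]"

lemma emits_marked: "h j = 0 \<Longrightarrow> m j = vm v \<Longrightarrow> emits w (print_marked j) h m (marked_code v)"
  using emits_print_set[of h j "\<lambda>x. x = 1" m] by (simp add: marked_code_def)

lemma emits_state: "h j = 0 \<Longrightarrow> m j = vm v \<Longrightarrow> length v = length w \<Longrightarrow> emits w (print_state b j) h m (state_code b v)"
  using emits_print_state[of h j m v w b] by (simp add: state_code_def)

lemma emits_unless:
  assumes "clean h m" "num_at w (h 1) a" "h 0 = 0" "c \<in> {2..5}" "k \<in> {2..5}" "s \<in> {2..5}"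
    "m c = vm v" "m k = vm v'" "m s = vm v''" "emits w A h m g"
  shows "emits w (unless_fails b c k s A) h m (if fails b a (states v) (states v') (states v'') then [] else g)"
  using emits_unless_fails[of h m a c k s A g b] assms by (simp add: states_def)

lemma emits_table:
  assumes cl: "clean h m" "num_at w (h 1) a" "h 0 = 0" "m 3 = vm v'" "m 4 = (\<lambda>_. 0)" "m 5 = (\<lambda>_. 0)"
  shows "emits w print_table h m (table_code a v')"
  unfolding print_table_def table_code_def
  by (intro emits_Sq emits_says emits_for_vec emits_unless emits_marked)
    (use assms cleanD[OF cl(1)] in simp_all)

lemma emits_transition:
  assumes cl: "clean h m" "num_at w (h 1) a" "h 0 = 0" "m 2 = vm v" "m 3 = vm v'" "m 4 = (\<lambda>_. 0)" "m 5 = (\<lambda>_. 0)"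
    "length v = length w" "length v' = length w"
  shows "emits w print_transition h m (transition_code v a v')"
  unfolding print_transition_def transition_code_def
  by (intro emits_Sq emits_says emits_table emits_state emits_print_letter)
    (use assms cleanD[OF cl(1)] in simp_all)

lemma emits_transitions:
  assumes cl: "clean h m" "h 0 = 0" "h 1 = 0" "m 2 = vm v" "m 3 = (\<lambda>_. 0)" "m 4 = (\<lambda>_. 0)" "m 5 = (\<lambda>_. 0)"
    "length v = length w"
  shows "emits w print_transitions h m (transitions_code v)"
proof -
  note c = assms cleanD[OF cl(1)]
  have 1: "emits w (if_init (says [Bit True, Stop, Stop, Bit True, Stop] ;; print_marked 2 ;; print_state True 2)) h m
    (if qi \<in> states v then [Bit True, Stop, Stop, Bit True, Stop] @ marked_code v @ state_code True v else [])"
  proof -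
    have "emits w (says [Bit True, Stop, Stop, Bit True, Stop] ;; print_marked 2 ;; print_state True 2) h m
      ([Bit True, Stop, Stop, Bit True, Stop] @ marked_code v @ state_code True v)"
      by (intro emits_Sq emits_says emits_marked emits_state) (use c in simp_all)
    from emits_if_init[OF cl(1,2) this] show ?thesis unfolding c(4) states_def .
  qed
  have 2: "emits w (for_letters (for_vec 3 (unless_fails True 2 3 3 print_transition))) h m
    (concat (map (\<lambda>a. for_all_vecs (\<lambda>v'.
      if fails True a (states v) (states v') (states v') then [] else transition_code v a v')) als))"
    by (intro emits_for_letters emits_for_vec emits_unless emits_transition)
      (use c in simp_all)
  show ?thesis
    unfolding print_transitions_def transitions_code_def
    by (intro emits_Sq emits_says emits_state emits_marked 1 2) (use c in simp_all)
qed

lemma runs_print_ipcant: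
  "runs w print_ipcant (\<lambda>_. 0, \<lambda>_ _. 0, []) (\<lambda>_. 0, \<lambda>_ _. 0, ipcant_code)"
proof -
  let ?h = "(\<lambda>_. 0) :: nat \<Rightarrow> nat" and ?m = "(\<lambda>_ _. 0) :: nat \<Rightarrow> nat \<Rightarrow> nat"
  have cl: "clean ?h ?m" by (simp add: clean_def fl_0)
  have "emits w (print_set (\<lambda>_. True) 2) ?h ?m (pset (\<lambda>_. True) (\<lambda>_. 0))"
    using emits_print_set[of ?h 2 "\<lambda>_. True" ?m] by simp
  then have "emits w print_ipcant ?h ?m ipcant_code"
    unfolding print_ipcant_def ipcant_code_def
    by (intro emits_Sq emits_says emits_for_vec emits_state emits_marked emits_transitions emits_print_alphabet)
      (use cl in simp_all)
  from this[unfolded emits_def, rule_format, of "[]"] show ?thesis by simp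
qed

end

section \<open>The encoding of the output\<close>

text \<open>The inside of a bracketed list. Since repetitions are allowed, a union is coded by
  concatenation even if the sets overlap.\<close>

definition codes :: "('e \<Rightarrow> tok list \<Rightarrow> bool) \<Rightarrow> 'e set \<Rightarrow> tok list \<Rightarrow> bool" where
  "codes E X u \<longleftrightarrow> (\<exists>xs ws. set xs = X \<and> list_all2 E xs ws \<and> u = concat ws)"

lemma code_set_codes:
  assumes "codes E X u" shows "code_set E X (Open # u @ [Close])"
proof -
  obtain xs ws where "set xs = X" "list_all2 E xs ws" "u = concat ws"
    using assms unfolding codes_def by blast
  then show ?thesis
    unfolding code_set_def by (intro exI[where x = xs] exI[where x = ws]) simp
qed

lemma codes_empty: "codes E {} []"
  unfolding codes_def by (intro exI[of _ "[]"]) simp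

lemma codes_single: "E x u \<Longrightarrow> codes E {x} u"
  unfolding codes_def by (intro exI[of _ "[x]"] exI[of _ "[u]"]) simp

lemma codes_Un:
  assumes "codes E X u" "codes E Y v"
  shows "codes E (X \<union> Y) (u @ v)"
proof -
  obtain xs us ys vs where "set xs = X" "list_all2 E xs us" "u = concat us"
    "set ys = Y" "list_all2 E ys vs" "v = concat vs" using assms unfolding codes_def by blast
  then show ?thesis
    unfolding codes_def by (intro exI[of _ "xs @ ys"] exI[of _ "us @ vs"]) (simp add: list_all2_appendI)
qed

lemma codes_if:
  "codes E X u \<Longrightarrow> codes E (if b then X else {}) (if b then u else [])"
  "codes E X u \<Longrightarrow> codes E (if b then {} else X) (if b then [] else u)"
  by (simp_all add: codes_empty)

lemma codes_concat:
  "(\<And>x. x \<in> set xs \<Longrightarrow> codes E (X x) (u x)) \<Longrightarrow> codes E (\<Union>x\<in>set xs. X x) (concat (map u xs))"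
proof (induction xs)
  case (Cons x xs)
  then show ?case using codes_Un[of E "X x" "u x"] by simp
qed (simp add: codes_empty)

lemma code_set_map:
  assumes "code_set (\<lambda>x u. u = g x) X w"
  obtains xs where "set xs = X" "w = Open # concat (map g xs) @ [Close]"
proof -
  have map: "list_all2 (\<lambda>x u. u = g x) xs ws \<Longrightarrow> ws = map g xs" for xs ws
    by (induction rule: list_all2_induct) auto
  obtain xs ws where x: "set xs = X" "list_all2 (\<lambda>x u. u = g x) xs ws" "w = Open # concat ws @ [Close]"
    using assms unfolding code_set_def by blast
  show ?thesis by (rule that[OF x(1)]) (simp add: x(3) map[OF x(2)])
qed

lemma nat_bits_double: "0 < n \<Longrightarrow> nat_bits (of_bool b + 2 * n) = Bit b # nat_bits n"
  by (subst nat_bits.simps) (cases b; simp)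

lemma code_nat_odd: "code_nat (Suc (2 * q)) = Bit True # code_nat q"
  unfolding code_nat_def by (subst nat_bits.simps) simp

lemma code_cnt: "code_nat_set (cnt (set xs)) ([Open, Stop] @ concat (map (\<lambda>q. Bit True # code_nat q) xs) @ [Close])"
proof -
  have 0: "codes (\<lambda>n w. w = code_nat n) {0} [Stop]" by (rule codes_single) (simp add: code_nats)
  have "codes (\<lambda>n w. w = code_nat n) (\<Union>q\<in>set xs. {Suc (2 * q)}) (concat (map (\<lambda>q. Bit True # code_nat q) xs))"
    by (intro codes_concat codes_single) (simp add: code_nat_odd)
  from code_set_codes[OF codes_Un[OF 0 this]]
  have "code_nat_set ({0} \<union> (\<Union>q\<in>set xs. {Suc (2 * q)})) ([Open, Stop] @ concat (map (\<lambda>q. Bit True # code_nat q) xs) @ [Close])"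
    by (simp add: code_nat_set_def)
  moreover have "{0} \<union> (\<Union>q\<in>set xs. {Suc (2 * q)}) = cnt (set xs)" by (auto simp: cnt_def)
  ultimately show ?thesis by simp
qed

text \<open>The highest digit one, contributed by the empty list, makes the coding injective on
  lists of all lengths.\<close>

fun bits_num :: "bool list \<Rightarrow> nat" where
  "bits_num [] = 1"
| "bits_num (b # bs) = of_bool b + 2 * bits_num bs"

lemma bits_num_pos: "0 < bits_num bs"
  by (induction bs) auto

lemma code_bits_num: "code_nat (bits_num bs) = map Bit bs @ [Bit True, Stop]"
proof (induction bs)
  case Nil
  then show ?case by (simp add: code_nats)
next
  case (Cons b bs)
  then show ?case using nat_bits_double[OF bits_num_pos, of b bs] by (simp add: code_nat_def)
qed

lemma bits_num_inj:
  assumes "bits_num bs = bits_num cs" shows "bs = cs"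
proof -
  have "map Bit bs @ [Bit True, Stop] = map Bit cs @ [Bit True, Stop]"
    unfolding code_bits_num[symmetric] assms ..
  then have "map Bit bs = map Bit cs" by simp
  moreover have "inj Bit" by (simp add: inj_def)
  ultimately show ?thesis by (simp add: inj_map_eq_map)
qed

lemma sel_cong:
  "(\<And>r. p \<le> r \<Longrightarrow> r < p + length (nums qs) \<Longrightarrow> P (b r) = P (b' r)) \<Longrightarrow> sel P b p qs = sel P b' p qs"
proof (induction qs arbitrary: p)
  case (Cons q qs)
  have "sel P b (p + length (code_nat q)) qs = sel P b' (p + length (code_nat q)) qs"
    by (rule Cons.IH) (use Cons.prems in auto)
  moreover have "P (b p) = P (b' p)" by (rule Cons.prems) (auto simp: code_nat_def)
  ultimately show ?case by simp
qed simp

text \<open>Mark the first cell of each selected occurrence. Codes are nonempty, so distinct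
  occurrences start in distinct cells and can be marked independently.\<close>

lemma sel_filter: "\<exists>b. sel (\<lambda>x. x = 1) b p qs = filter (\<lambda>q. q \<in> c) qs"
proof (induction qs arbitrary: p)
  case (Cons q qs)
  let ?p = "p + length (code_nat q)"
  obtain b where b: "sel (\<lambda>x. x = 1) b ?p qs = filter (\<lambda>q. q \<in> c) qs" using Cons by blast
  let ?b = "b(p := of_bool (q \<in> c))"
  have "sel (\<lambda>x. x = 1) ?b ?p qs = sel (\<lambda>x. x = 1) b ?p qs"
    by (rule sel_cong) (auto simp: fun_upd_apply code_nat_def)
  then have "sel (\<lambda>x. x = 1) ?b p (q # qs) = filter (\<lambda>q. q \<in> c) (q # qs)" using b by simp
  then show ?case by blast
qed simp

lemma sel_all: "sel (\<lambda>_. True) b p qs = qs"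
  by (induction qs arbitrary: p) auto

lemma sel_subset: "set (sel P b p qs) \<subseteq> set qs"
  by (induction qs arbitrary: p) auto

context input_text
begin

lemma states_sub: "states v \<subseteq> set qs"
  using sel_subset unfolding states_def S_def .

lemma states_ex: "c \<subseteq> set qs \<Longrightarrow> \<exists>v. length v = length w \<and> states v = c"
proof -
  assume c: "c \<subseteq> set qs"
  obtain b where b: "sel (\<lambda>x. x = 1) b sp qs = filter (\<lambda>q. q \<in> c) qs" using sel_filter by blast
  let ?v = "map (\<lambda>i. b (Suc i) = 1) [0..<length w]"
  \<comment> \<open>The list of states lies within the input, so a vector with one bit per input
    cell reaches all of its first cells.\<close>
  have le: "sp + length (nums qs) \<le> length w" by (rule read_Cell_le[OF here_w(6), THEN conjunct2])
  have "sel (\<lambda>x. x = 1) (vm ?v) sp qs = sel (\<lambda>x. x = 1) b sp qs"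
  proof (rule sel_cong)
    fix r assume r: "sp \<le> r" "r < sp + length (nums qs)"
    then obtain i where "r = Suc i" by (cases r) (auto simp: sp_def)
    then show "(vm ?v r = 1) = (b r = 1)" using r le by (simp add: vm_def)
  qed
  then have "states ?v = c" using b c by (auto simp: states_def S_def)
  then show ?thesis by (intro exI[of _ ?v]) simp
qed

lemma code_marked: "code_nat_set (cnt (states v)) (marked_code v)"
  using code_cnt[of "marked (vm v)"] by (simp add: states_def S_def marked_code_def pset_def)

lemma code_state: "code_nat (bits_num (b # v)) = state_code b v"
  using code_bits_num[of "b # v"] by (simp add: state_code_def)

end

text \<open>The automaton is the locale construction with the bit vectors of length
  \<open>length w\<close> as indices; it varies with the encoding \<open>w\<close> of
  \<open>A\<close>. The printed text is matched with its encoding set by set.\<close>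

lemma code_of_output:
  assumes A: "safety_ara A" and code: "code_ara A w"
  shows "\<exists>(M :: (nat, nat, nat) ipcant) y.
    runs w print_ipcant (\<lambda>_. 0, \<lambda>_ _. 0, []) (\<lambda>_. 0, \<lambda>_ _. 0, y) \<and>
    safety_ipcant M \<and> code_ipcant M y \<and> ipc_alph M = ara_alph A \<and>
    card (ipc_basis M) \<le> 2 * card (ara_states A) \<and> ipc_lang M = str ` ara_lang A"
proof -
  let ?ent = "\<lambda>(q, a, b). code_nat q @ code_nat a @ code_nat (of_bool b) @ code_pbf (ara_delta A q a b)"
  obtain wa ws wd where ws: "code_nat_set (ara_alph A) wa" "code_nat_set (ara_states A) ws"
    "code_set (\<lambda>(q, a, b) u. u = code_nat q @ code_nat a @ code_nat (of_bool b) @ code_pbf (ara_delta A q a b))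
       (ara_states A \<times> ara_alph A \<times> UNIV) wd" "w = wa @ ws @ code_nat (ara_init A) @ wd"
    using code unfolding code_ara_def by blast
  obtain als where als: "set als = ara_alph A" "wa = Open # nums als @ [Close]"
    using code_set_map ws(1) unfolding code_nat_set_def by blast
  obtain qs where qs: "set qs = ara_states A" "ws = Open # nums qs @ [Close]"
    using code_set_map ws(2) unfolding code_nat_set_def by blast
  have "code_set (\<lambda>d u. u = ?ent d) (ara_states A \<times> ara_alph A \<times> UNIV) wd"
    using ws(3) by (simp add: case_prod_unfold)
  then obtain ds where ds: "set ds = ara_states A \<times> ara_alph A \<times> UNIV"
    "wd = Open # concat (map ?ent ds) @ [Close]"
    by (rule code_set_map)
  interpret input_text w als qs "ara_init A" ds "ara_delta A" ?ent
    by unfold_locales (simp_all add: ws(4) als qs ds)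
  let ?V = "{v :: bool list. length v = length w}"
  define rd where "rd v = bits_num (True # v)" for v
  define wr where "wr v = bits_num (False # v)" for v
  \<comment> \<open>The initial state is 1 and the idle state 0. The other control states are at
    least 2, and their lowest digit separates \<open>rd\<close> from \<open>wr\<close>.\<close>
  interpret C: counter_simulation A ?V states "1 :: nat" 0 rd wr
  proof
    show "safety_ara A" by (rule A)
    show "finite ?V" using finite_lists_length_eq[of "UNIV :: bool set" "length w"] by simp
    show "states ` ?V = Pow (ara_states A)"
    proof
      show "states ` ?V \<subseteq> Pow (ara_states A)" using states_sub qs by auto
      show "Pow (ara_states A) \<subseteq> states ` ?V" using states_ex qs by blast
    qed
    show "inj_on rd ?V" "inj_on wr ?V"
      using bits_num_inj[of "b # v" "b # v'" for b v v'] unfolding rd_def wr_def by (blast intro!: inj_onI)+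
    show "rd v \<notin> {1, 0}" "wr v \<notin> {1, 0}" for v
      using bits_num_pos[of v] by (auto simp: rd_def wr_def)
    show "rd v \<noteq> wr v'" for v v'
      using bits_num_inj[of "True # v" "False # v'"] unfolding rd_def wr_def by blast
  qed simp
  have V: "set (vecs (length w)) = ?V" by (rule set_vecs)
  have sub: "states v \<subseteq> ara_states A" for v using states_sub qs by simp
  \<comment> \<open>The table has an entry for every state, letter and Boolean, so the absence of a
    violated entry means that all obligations are satisfied.\<close>
  have fails: "fails b a (states u) P Pd \<longleftrightarrow> (\<exists>q\<in>states u. \<not> sat P Pd (ara_delta A q a b))"
    if "a \<in> ara_alph A" for b a u P Pd
    using that sub[of u] unfolding fails_def ds(1) by blast
  have counters: "C.counters = (\<Union>v\<in>?V. {cnt (states v)})"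
    unfolding C.counters_def C.SV[symmetric] by auto
  have trf: "C.trf a D (cnt (states u)) =
      (\<Union>u'\<in>set (vecs (length w)). if fails False a (states u) (states u') D then {} else {cnt (states u')})"
    if a: "a \<in> ara_alph A" for a D u
    unfolding C.trf_cnt[OF sub]
  proof (intro set_eqI iffI)
    fix x assume "x \<in> cnt ` {c'. c' \<subseteq> ara_states A \<and> (\<forall>q\<in>states u. sat c' D (ara_delta A q a False))}"
    then obtain c' where c': "x = cnt c'" "c' \<subseteq> ara_states A" "\<forall>q\<in>states u. sat c' D (ara_delta A q a False)" by blast
    from C.S_ex[OF c'(2)] obtain u' where u': "u' \<in> set (vecs (length w))" "states u' = c'" unfolding V by blast
    have "x \<in> (if fails False a (states u) (states u') D then {} else {cnt (states u')})"
      using c' u'(2) fails[OF a] by simp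
    then show "x \<in> (\<Union>u'\<in>set (vecs (length w)). if fails False a (states u) (states u') D then {} else {cnt (states u')})"
      using u'(1) by (rule UN_I[rotated])
  next
    fix x assume "x \<in> (\<Union>u'\<in>set (vecs (length w)). if fails False a (states u) (states u') D then {} else {cnt (states u')})"
    then obtain u' where "x \<in> (if fails False a (states u) (states u') D then {} else {cnt (states u')})" by (rule UN_E)
    then have "x = cnt (states u')" "\<forall>q\<in>states u. sat (states u') D (ara_delta A q a False)"
      using fails[OF a] by (auto split: if_splits)
    then show "x \<in> cnt ` {c'. c' \<subseteq> ara_states A \<and> (\<forall>q\<in>states u. sat c' D (ara_delta A q a False))}"
      using sub by blast
  qed
  have table: "code_instr C.counters (Transf (C.trf a (states v'))) ([Bit False, Bit True, Stop] @ table_code a v')"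
    if a: "a \<in> ara_alph A" for a v'
  proof -
    have inner: "code_set code_nat_set (C.trf a (states v') (cnt (states u)))
      ([Open] @ concat (map (\<lambda>u'. if fails False a (states u) (states u') (states v') then [] else marked_code u')
         (vecs (length w))) @ [Close])" for u
      unfolding trf[OF a] append.simps
      by (intro code_set_codes codes_concat) (simp add: codes_empty codes_single code_marked)
    have "code_set (\<lambda>c t. \<exists>t1 t2. code_nat_set c t1 \<and> code_set code_nat_set (C.trf a (states v') c) t2 \<and> t = t1 @ t2)
      C.counters (table_code a v')"
      unfolding counters table_code_def append.simps V[symmetric]
      by (intro code_set_codes codes_concat codes_single exI conjI, rule code_marked, rule inner, simp)
    then show ?thesis by (auto simp: code_nats)
  qed
  let ?E = "\<lambda>(s, l, ins, s') t. \<exists>u. code_instr C.counters ins u \<and> t = code_nat s @ code_label l @ u @ code_nat s'"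
  let ?T4 = "\<lambda>v. \<Union>a\<in>set als. \<Union>v'\<in>set (vecs (length w)).
    if fails True a (states v) (states v') (states v') then {} else {(rd v, Some a, Transf (C.trf a (states v')), wr v')}"
  \<comment> \<open>The transitions are grouped by \<open>v\<close> and ordered as in
    \<open>transitions_code v\<close>, so that unions and concatenations match.\<close>
  let ?T = "\<lambda>v. {(0, None, Dec (cnt (states v)), rd v)} \<union> ({(wr v, None, Inc (cnt (states v)), 0)} \<union>
    ((if ara_init A \<in> states v then {(1, None, Dec (cnt (states v)), rd v)} else {}) \<union> ?T4 v))"
  have T4: "?T4 v = {(rd v, Some a, Transf (C.trf a (states v')), wr v') | a v'. v' \<in> ?V \<and> a \<in> ara_alph A \<and>
      (\<forall>q\<in>states v. sat (states v') (states v') (ara_delta A q a True))}" (is "_ = ?R") for v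
  proof (intro set_eqI iffI)
    fix x assume "x \<in> ?T4 v"
    then obtain a v' where a: "a \<in> set als" and v': "v' \<in> set (vecs (length w))"
      and x: "x \<in> (if fails True a (states v) (states v') (states v') then {} else {(rd v, Some a, Transf (C.trf a (states v')), wr v')})"
      by (elim UN_E)
    from x have "\<not> fails True a (states v) (states v') (states v')" "x = (rd v, Some a, Transf (C.trf a (states v')), wr v')"
      by (simp_all split: if_splits)
    then show "x \<in> ?R" using a v' fails[of a True v "states v'" "states v'"] unfolding als(1) V by blast
  next
    fix x assume "x \<in> ?R"
    then obtain a v' where x: "x = (rd v, Some a, Transf (C.trf a (states v')), wr v')" "v' \<in> ?V" "a \<in> ara_alph A"
      "\<forall>q\<in>states v. sat (states v') (states v') (ara_delta A q a True)" by blast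
    then have "\<not> fails True a (states v) (states v') (states v')" using fails[of a True v "states v'" "states v'"] by blast
    then show "x \<in> ?T4 v" using x(1-3) unfolding als(1) V by (intro UN_I[of a] UN_I[of v']) simp_all
  qed
  have trans: "C.ipc_trans = (\<Union>v\<in>set (vecs (length w)). ?T v)"
    unfolding C.ipc_trans_def T4 unfolding V by (auto split: if_splits)
  have "codes ?E (?T v) (transitions_code v)" for v
    unfolding transitions_code_def
  proof (intro codes_Un)
    have dec: "code_instr C.counters (Dec (cnt (states v))) ([Bit True, Stop] @ marked_code v)"
      using code_marked by (auto simp: code_nats)
    have inc: "code_instr C.counters (Inc (cnt (states v))) ([Stop] @ marked_code v)"
      using code_marked by (auto simp: code_nats)
    show "codes ?E {(0, None, Dec (cnt (states v)), rd v)} ([Stop, Stop, Bit True, Stop] @ marked_code v @ state_code True v)"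
      by (rule codes_single) (use dec in \<open>auto simp: code_nats code_state rd_def wr_def simp del: code_instr.simps bits_num.simps\<close>)
    show "codes ?E {(wr v, None, Inc (cnt (states v)), 0)} (state_code False v @ [Stop, Stop] @ marked_code v @ [Stop])"
      by (rule codes_single) (use inc in \<open>auto simp: code_nats code_state rd_def wr_def simp del: code_instr.simps bits_num.simps\<close>)
    have "codes ?E {(1, None, Dec (cnt (states v)), rd v)} ([Bit True, Stop, Stop, Bit True, Stop] @ marked_code v @ state_code True v)"
      by (rule codes_single) (use dec in \<open>auto simp: code_nats code_state rd_def wr_def simp del: code_instr.simps bits_num.simps\<close>)
    then show "codes ?E (if ara_init A \<in> states v then {(1, None, Dec (cnt (states v)), rd v)} else {})
       (if ara_init A \<in> states v then [Bit True, Stop, Stop, Bit True, Stop] @ marked_code v @ state_code True v else [])"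
      by (rule codes_if)
    have "codes ?E {(rd v, Some a, Transf (C.trf a (states v')), wr v')} (transition_code v a v')" if "a \<in> set als" for a v'
      using table[of a v'] that als(1) unfolding transition_code_def
      by (intro codes_single) (auto simp: code_nats code_state rd_def wr_def simp del: code_instr.simps bits_num.simps)
    then show "codes ?E (?T4 v) (concat (map (\<lambda>a. concat (map (\<lambda>v'.
       if fails True a (states v) (states v') (states v') then [] else transition_code v a v') (vecs (length w)))) als))"
      by (intro codes_concat codes_if)
  qed
  then have delta: "code_set ?E C.ipc_trans ([Open] @ concat (map transitions_code (vecs (length w))) @ [Close])"
    unfolding trans append.simps by (intro code_set_codes codes_concat)
  have alph: "code_nat_set (ara_alph A) (Open # nums als @ [Close])"
    using ws(1) als(2) by simp
  let ?e = "\<lambda>n w. w = code_nat n"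
  have "codes ?e ({1} \<union> ({0} \<union> (\<Union>v\<in>set (vecs (length w)). {rd v} \<union> {wr v})))
     ([Bit True, Stop] @ ([Stop] @ concat (map (\<lambda>v. state_code True v @ state_code False v) (vecs (length w)))))"
    by (intro codes_Un codes_concat codes_single) (simp_all only: rd_def wr_def code_state code_nats One_nat_def)
  moreover have "{1} \<union> ({0} \<union> (\<Union>v\<in>set (vecs (length w)). {rd v} \<union> {wr v})) = {1, 0} \<union> rd ` ?V \<union> wr ` ?V"
    unfolding V by auto
  ultimately have "codes ?e ({1, 0} \<union> rd ` ?V \<union> wr ` ?V)
     ([Bit True, Stop] @ ([Stop] @ concat (map (\<lambda>v. state_code True v @ state_code False v) (vecs (length w)))))"
    by (simp only:)
  from code_set_codes[OF this]
  have states: "code_nat_set ({1, 0} \<union> rd ` ?V \<union> wr ` ?V)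
     ([Open, Bit True, Stop, Stop] @ concat (map (\<lambda>v. state_code True v @ state_code False v) (vecs (length w))) @ [Close])"
    by (simp only: code_nat_set_def append.simps append_assoc)
  have basis: "code_nat_set (cnt (ara_states A)) (pset (\<lambda>_. True) (\<lambda>_. 0))"
    using code_cnt[of qs] by (simp add: pset_def sel_all qs(1))
  have counters_code: "code_set code_nat_set C.counters ([Open] @ concat (map marked_code (vecs (length w))) @ [Close])"
    unfolding counters V[symmetric] append.simps by (intro code_set_codes codes_concat codes_single code_marked)
  have "code_ipcant C.ipc ipcant_code"
    unfolding code_ipcant_def C.ipc_def ipcant.select_convs
  proof (intro exI conjI)
    show "ipcant_code = (Open # nums als @ [Close]) @
      ([Open, Bit True, Stop, Stop] @ concat (map (\<lambda>v. state_code True v @ state_code False v) (vecs (length w))) @ [Close]) @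
      code_nat 1 @ pset (\<lambda>_. True) (\<lambda>_. 0) @
      ([Open] @ concat (map marked_code (vecs (length w))) @ [Close]) @
      ([Open] @ concat (map transitions_code (vecs (length w))) @ [Close])"
      by (simp add: ipcant_code_def code_nats)
  qed (rule alph states basis counters_code delta)+
  then show ?thesis
    using runs_print_ipcant C.safety_ipc C.card_basis C.ipc_lang_eq C.ipc_alph_ipc by blast
qed

theorem theorem3p2:
  shows "\<exists>(f :: tok list \<Rightarrow> tok list) (k :: nat).
    polyspace_computable_on {w. \<exists>A. safety_ara A \<and> code_ara A w} f \<and>
    (\<forall>(A :: (nat, nat) ara) w. safety_ara A \<and> code_ara A w \<longrightarrow>
       (\<exists>(M :: (nat, nat, nat) ipcant).
          safety_ipcant M \<and> code_ipcant M (f w) \<and>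
          ipc_alph M = ara_alph A \<and>
          card (ipc_basis M) \<le> k * card (ara_states A) \<and>
          ipc_lang M = str ` ara_lang A))"
proof -
  obtain T where T: "turing_machine T" and comp: "\<And>w h m r.
      runs w print_ipcant (\<lambda>_. 0, \<lambda>_ _. 0, []) (h, m, r) \<Longrightarrow> tm_computes_in_space T w r (length w + 2)"
    using program_to_tm[OF _ com_ok_print_ipcant] by auto
  \<comment> \<open>The function is the one computed by the machine, chosen through its output;
    \<open>computes_unique\<close> identifies it with the printed text on valid inputs.\<close>
  define f where "f w = (SOME y. tm_computes_in_space T w y (length w + 2))" for w
  have f: "f w = y" if "tm_computes_in_space T w y (length w + 2)" for w y
    unfolding f_def using that by (rule some_equality) (rule computes_unique[OF _ that])
  \<comment> \<open>\<open>[:2, 1:]\<close> is the polynomial with value \<open>2 + n\<close> at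
    \<open>n\<close>.\<close>
  have "tm_computes_in_space T w (f w) (poly [:2, 1:] (length w))"
    if A: "safety_ara A" and code: "code_ara A w" for A w
  proof -
    obtain y where "runs w print_ipcant (\<lambda>_. 0, \<lambda>_ _. 0, []) (\<lambda>_. 0, \<lambda>_ _. 0, y)"
      using code_of_output[OF A code] by blast
    from comp[OF this] show ?thesis using f by (simp add: add.commute)
  qed
  then have "polyspace_computable_on {w. \<exists>A. safety_ara A \<and> code_ara A w} f"
    unfolding polyspace_computable_on_def using T by blast
  moreover have "\<exists>M :: (nat, nat, nat) ipcant. safety_ipcant M \<and> code_ipcant M (f w) \<and>
      ipc_alph M = ara_alph A \<and> card (ipc_basis M) \<le> 2 * card (ara_states A) \<and> ipc_lang M = str ` ara_lang A"
    if A: "safety_ara A" and code: "code_ara A w" for A w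
  proof -
    obtain M :: "(nat, nat, nat) ipcant" and y where y: "runs w print_ipcant (\<lambda>_. 0, \<lambda>_ _. 0, []) (\<lambda>_. 0, \<lambda>_ _. 0, y)"
      and M: "safety_ipcant M" "code_ipcant M y" "ipc_alph M = ara_alph A"
        "card (ipc_basis M) \<le> 2 * card (ara_states A)" "ipc_lang M = str ` ara_lang A"
      using code_of_output[OF A code] by blast
    have "f w = y" by (rule f[OF comp[OF y]])
    show ?thesis unfolding \<open>f w = y\<close> by (rule exI[of _ M]) (intro conjI M)
  qed
  ultimately show ?thesis
    by (intro exI[where x = f] exI[where x = "2 :: nat"] conjI) simp_all
qed

end
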